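(* Let $\mathfrak{G}_\infty^*=\prod_{k=1}^\infty\mathfrak{g}_k^*$ be the strong dual of $\mathfrak{G}_\infty$. Define $$\{\mathcal{F},\mathcal{G}\}_{\mathfrak{G}_\infty^*}(\Gamma):=\big\langle[\mathrm{d}\mathcal{F}[\Gamma],\mathrm{d}\mathcal{G}[\Gamma]]_{\mathfrak{G}_\infty},\Gamma\big\rangle_{\mathfrak{G}_\infty-\mathfrak{G}_\infty^*},\qquad\mathcal{F},\mathcal{G}\in\mathcal{C}^\infty(\mathfrak{G}_\infty^* ),\ \Gamma\in\mathfrak{G}_\infty^*,$$ and let $\mathcal{A}_\infty\subset\mathcal{C}^\infty(\mathfrak{G}_\infty^* )$ be the algebra generated, with respect to pointwise product, by the functionals $\Gamma\mapsto\langle F,\Gamma\rangle_{\mathfrak{G}_\infty-\mathfrak{G}_\infty^*}$ with $F\in\mathfrak{G}_\infty$ together with the real constant functionals. Then the triple $(\mathfrak{G}_\infty^*,\mathcal{A}_\infty,\{\cdot,\cdot\}_{\mathfrak{G}_\infty^*})$ is a weak Poisson vector space.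
   Context: Fix $d\in\mathbb{N}$. Points of $\mathbb{R}^{2d}$ are $z=(x,v)$. For $k\in\mathbb{N}$, $\mathfrak{g}_k$ is the real vector space of smooth functions $f:(\mathbb{R}^{2d})^k\to\mathbb{R}$ invariant under permutations of $z_1,\dots,z_k\in\mathbb{R}^{2d}$, with the topology generated by the seminorms $\sup_{|\alpha|\le n}\|\partial^\alpha f\|_{L^\infty(K)}$ ($K$ compact, $n\in\mathbb{N}$); $\mathfrak{g}_k^*$ is its strong dual (permutation-invariant compactly supported distributions on $(\mathbb{R}^{2d})^k$). $\mathfrak{G}_\infty:=\bigoplus_{k=1}^\infty\mathfrak{g}_k$ with the locally convex direct sum topology (sequences with finitely many nonzero components); $\mathfrak{G}_\infty^*$ carries the product topology, and $\mathfrak{G}_\infty^{**}\cong\mathfrak{G}_\infty$, so Gâteaux derivatives $\mathrm{d}\mathcal{F}[\Gamma]$ are identified with elements of $\mathfrak{G}_\infty$. Lie bracket on $\mathfrak{G}_\infty$: for $F=(f^{(\ell)})_\ell$, $G=(g^{(j)})_j$, $$[F,G]^{(k)}_{\mathfrak{G}_\infty}=\sum_{\substack{\ell,j\ge1\\\ell+j-1=k}}\mathrm{Sym}_k(f^{(\ell)}\wedge_1g^{(j)}),$$ $$f^{(\ell)}\wedge_1g^{(j)}(z_1,\dots,z_k)=\ell j\big(\nabla_{x_1}f^{(\ell)}(z_1,\dots,z_\ell)\cdot\nabla_{v_1}g^{(j)}(z_1,z_{\ell+1},\dots,z_k)-\nabla_{x_1}g^{(j)}(z_1,\dots,z_j)\cdot\nabla_{v_1}f^{(\ell)}(z_1,z_{j+1},\dots,z_k)\big),$$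 $\mathrm{Sym}_k(h)(z_1,\dots,z_k)=\frac1{k!}\sum_{\pi\in\mathbb{S}_k}h(z_{\pi(1)},\dots,z_{\pi(k)})$. Smoothness is in the Gâteaux sense: all iterated directional derivatives $\mathrm{d}^nf:X\times X^n\to Y$ exist and are jointly continuous; $\mathcal{C}^\infty(X)=\mathcal{C}^\infty(X,\mathbb{R})$. A weak Poisson vector space is a triple $(X,\mathcal{A},\{\cdot,\cdot\})$ with $X$ a locally convex space, $\mathcal{A}\subset\mathcal{C}^\infty(X)$ a unital subalgebra, such that: (WP1) $\{\cdot,\cdot\}:\mathcal{A}\times\mathcal{A}\to\mathcal{A}$ is bilinear, antisymmetric, and satisfies the Jacobi identity and the Leibniz rule $\{\mathcal{F},\mathcal{G}\mathcal{H}\}=\mathcal{H}\{\mathcal{F},\mathcal{G}\}+\mathcal{G}\{\mathcal{F},\mathcal{H}\}$; (WP2) for all $x,v\in X$, if $\mathrm{d}\mathcal{F}[x](v)=0$ for every $\mathcal{F}\in\mathcal{A}$ then $v=0$; (WP3) for every $\mathcal{F}\in\mathcal{A}$ there is a $\mathcal{C}^\infty$ map $X_{\mathcal{F}}:X\to X$ with $\mathrm{d}\mathcal{G}[x](X_{\mathcal{F}}(x))=\{\mathcal{G},\mathcal{F}\}(x)$ for all $\mathcal{G}\in\mathcal{A}$, $x\in X$. *)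

theory Defs
  imports "HOL-Analysis.Analysis"
begin

text \<open>Locally convex spaces are Hausdorff here. The convexity condition is spelled out because
  \<^const>\<open>convex\<close> cannot be used inside the class specification.\<close>

class locally_convex_space = real_vector + topological_ab_group_add + t2_space +
  assumes tendsto_scaleR_nhds: "LIM p (nhds a \<times>\<^sub>F nhds x). fst p *\<^sub>R snd p :> nhds (a *\<^sub>R x)"
    and convex_nhd_base: "open U \<Longrightarrow> x \<in> U \<Longrightarrow> \<exists>V. open V \<and> x \<in> V \<and> V \<subseteq> U \<and>
      (\<forall>y\<in>V. \<forall>z\<in>V. \<forall>t\<ge>0. \<forall>s\<ge>0. t + s = 1 \<longrightarrow> t *\<^sub>R y + s *\<^sub>R z \<in> V)"

instance real :: locally_convex_space
proof
  show "LIM p (nhds a \<times>\<^sub>F nhds x). fst p *\<^sub>R snd p :> nhds (a *\<^sub>R x)" for a x :: real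
    using tendsto_mult_Pair[of a x] by simp
  show "\<exists>V. open V \<and> x \<in> V \<and> V \<subseteq> U \<and>
      (\<forall>y\<in>V. \<forall>z\<in>V. \<forall>t\<ge>0. \<forall>s\<ge>0. t + s = 1 \<longrightarrow> t *\<^sub>R y + s *\<^sub>R z \<in> V)"
    if "open U" "x \<in> U" for U and x :: real
  proof -
    obtain e where "e > 0" "ball x e \<subseteq> U" using \<open>open U\<close> \<open>x \<in> U\<close> open_contains_ball by blast
    then show ?thesis using convex_ball[of x e] unfolding convex_def by (intro exI[of _ "ball x e"]) (simp add: convex_def)
  qed
qed

text \<open>Open sets of the translation-invariant topology with \<open>N\<close> as a base of neighbourhoods of 0.\<close>

definition lc_open :: "('a::real_vector set \<Rightarrow> bool) \<Rightarrow> 'a set \<Rightarrow> bool" where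
  "lc_open N W \<longleftrightarrow> (\<forall>x\<in>W. \<exists>U. N U \<and> (\<forall>u\<in>U. x + u \<in> W))"

definition balanced :: "'a::real_vector set \<Rightarrow> bool" where
  "balanced U \<longleftrightarrow> (\<forall>c x. \<bar>c\<bar> \<le> 1 \<longrightarrow> x \<in> U \<longrightarrow> c *\<^sub>R x \<in> U)"

locale lc_base =
  fixes N :: "'a::real_vector set \<Rightarrow> bool"
  assumes N_UNIV: "N UNIV"
    and N_Int: "N U \<Longrightarrow> N V \<Longrightarrow> N (U \<inter> V)"
    and N_scale: "N U \<Longrightarrow> c > 0 \<Longrightarrow> N {x. c *\<^sub>R x \<in> U}"
    and N_convex: "N U \<Longrightarrow> convex U"
    and N_balanced: "N U \<Longrightarrow> balanced U"
    and N_absorbing: "N U \<Longrightarrow> \<exists>c>0. c *\<^sub>R x \<in> U"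
    and N_separating: "x \<noteq> 0 \<Longrightarrow> \<exists>U. N U \<and> x \<notin> U"
begin

lemma N_0: "N U \<Longrightarrow> 0 \<in> U"
  using N_absorbing[of U 0] by auto

lemma N_half:
  assumes "N U" "x \<in> U" "y \<in> U" shows "(1/2) *\<^sub>R x + (1/2) *\<^sub>R y \<in> U"
  using N_convex[OF assms(1)] assms by (simp add: convex_def)

lemma N_half2:
  assumes "N U" "2 *\<^sub>R x \<in> U" "2 *\<^sub>R y \<in> U" shows "x + y \<in> U"
  using N_half[OF assms] by simp

lemma lc_open_UNIV: "lc_open N UNIV"
  unfolding lc_open_def using N_UNIV by blast

lemma lc_open_Int: "lc_open N S \<Longrightarrow> lc_open N T \<Longrightarrow> lc_open N (S \<inter> T)"
  unfolding lc_open_def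
proof
  fix x assume "\<forall>x\<in>S. \<exists>U. N U \<and> (\<forall>u\<in>U. x + u \<in> S)" "\<forall>x\<in>T. \<exists>U. N U \<and> (\<forall>u\<in>U. x + u \<in> T)" "x \<in> S \<inter> T"
  then obtain U V where "N U" "\<forall>u\<in>U. x + u \<in> S" "N V" "\<forall>u\<in>V. x + u \<in> T" by blast
  then show "\<exists>U. N U \<and> (\<forall>u\<in>U. x + u \<in> S \<inter> T)"
    by (intro exI[of _ "U \<inter> V"]) (simp add: N_Int)
qed

lemma lc_open_Union: "\<forall>S\<in>K. lc_open N S \<Longrightarrow> lc_open N (\<Union>K)"
  unfolding lc_open_def
proof
  fix x assume K: "\<forall>S\<in>K. \<forall>x\<in>S. \<exists>U. N U \<and> (\<forall>u\<in>U. x + u \<in> S)" and "x \<in> \<Union>K"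
  then obtain T where T: "T \<in> K" "x \<in> T" by blast
  then obtain U where "N U" "\<forall>u\<in>U. x + u \<in> T" using K by meson
  then show "\<exists>U. N U \<and> (\<forall>u\<in>U. x + u \<in> \<Union>K)" using T(1) by (intro exI[of _ U]) auto
qed

lemma lc_open_interior:
  "lc_open N {x. \<exists>U. N U \<and> (\<forall>u\<in>U. x + u \<in> S)}"
  unfolding lc_open_def
proof clarify
  fix x U assume U: "N U" "\<forall>u\<in>U. x + u \<in> S"
  let ?V = "{u. 2 *\<^sub>R u \<in> U}"
  have V: "N ?V" using N_scale[OF U(1), of 2] by simp
  have "\<exists>U. N U \<and> (\<forall>u\<in>U. x + v + u \<in> S)" if "v \<in> ?V" for v
    using U that V N_half2[OF U(1)] by (intro exI[of _ ?V]) (simp add: add.assoc)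
  then show "\<exists>U. N U \<and> (\<forall>u\<in>U. x + u \<in> {x. \<exists>U. N U \<and> (\<forall>u\<in>U. x + u \<in> S)})"
    using V by (intro exI[of _ ?V]) auto
qed

lemma lc_nhd:
  assumes "N U" shows "\<exists>W. lc_open N W \<and> x \<in> W \<and> (\<forall>y\<in>W. y - x \<in> U)"
proof -
  let ?W = "{y. \<exists>V. N V \<and> (\<forall>u\<in>V. y + u \<in> (+) x ` U)}"
  have "x \<in> ?W" using assms by auto
  moreover have "y - x \<in> U" if y: "y \<in> ?W" for y
  proof -
    obtain V where "N V" "\<forall>u\<in>V. y + u \<in> (+) x ` U" using y by blast
    then have "y + 0 \<in> (+) x ` U" using N_0 by blast
    then show ?thesis by auto
  qed
  ultimately show ?thesis using lc_open_interior by blast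
qed

end

locale lc_base_topology = lc_base N for N :: "'a::{real_vector,topological_space} set \<Rightarrow> bool" +
  assumes open_eq: "(open :: 'a set \<Rightarrow> bool) = lc_open N"
begin

lemma eventually_nhds_N: "eventually P (nhds x) \<longleftrightarrow> (\<exists>U. N U \<and> (\<forall>u\<in>U. P (x + u)))"
proof
  assume "eventually P (nhds x)"
  then obtain S where "open S" "x \<in> S" "\<forall>y\<in>S. P y" unfolding eventually_nhds by blast
  then show "\<exists>U. N U \<and> (\<forall>u\<in>U. P (x + u))" unfolding open_eq lc_open_def by blast
next
  assume "\<exists>U. N U \<and> (\<forall>u\<in>U. P (x + u))"
  then obtain U where U: "N U" "\<forall>u\<in>U. P (x + u)" by blast
  obtain W where "lc_open N W" "x \<in> W" "\<forall>y\<in>W. y - x \<in> U" using lc_nhd[OF U(1)] by blast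
  moreover have "P y" if "y \<in> W" for y
    using U(2) calculation(3) that by (metis add.commute diff_add_cancel)
  ultimately show "eventually P (nhds x)" unfolding eventually_nhds open_eq by blast
qed

lemma tendsto_add_nhds: "LIM p (nhds a \<times>\<^sub>F nhds b). fst p + snd p :> nhds (a + b :: 'a)"
  unfolding filterlim_iff
proof (intro allI impI)
  fix P assume "eventually P (nhds (a + b))"
  then obtain U where U: "N U" "\<forall>u\<in>U. P (a + b + u)" unfolding eventually_nhds_N by blast
  let ?V = "{u. 2 *\<^sub>R u \<in> U}"
  have V: "N ?V" using N_scale[OF U(1), of 2] by simp
  have ev: "eventually (\<lambda>y. y - x \<in> ?V) (nhds x)" for x
    unfolding eventually_nhds_N using V by (intro exI[of _ ?V]) simp
  show "\<forall>\<^sub>F p in nhds a \<times>\<^sub>F nhds b. P (fst p + snd p)"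
    unfolding eventually_prod_filter
  proof (intro exI conjI allI impI)
    show "eventually (\<lambda>y. y - a \<in> ?V) (nhds a)" "eventually (\<lambda>y. y - b \<in> ?V) (nhds b)"
      by (rule ev)+
    fix x y assume "x - a \<in> ?V" "y - b \<in> ?V"
    then have "(x - a) + (y - b) \<in> U" using N_half2[OF U(1)] by auto
    then have "P (a + b + ((x - a) + (y - b)))" using U(2) by blast
    then show "P (fst (x, y) + snd (x, y))" by (simp add: algebra_simps)
  qed
qed

lemma tendsto_uminus: "(uminus \<longlongrightarrow> - a) (nhds (a::'a))"
  unfolding filterlim_iff
proof (intro allI impI)
  fix P assume "eventually P (nhds (- a))"
  then obtain U where U: "N U" "\<forall>u\<in>U. P (- a + u)" unfolding eventually_nhds_N by blast
  have "- u \<in> U" if "u \<in> U" for u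
    using N_balanced[OF U(1)] that unfolding balanced_def by (metis abs_1 abs_minus_cancel order_refl scaleR_minus1_left)
  then show "\<forall>\<^sub>F x in nhds a. P (- x)"
    using U unfolding eventually_nhds_N by (metis minus_add_distrib)
qed

lemma tendsto_scale: "LIM p (nhds a \<times>\<^sub>F nhds x). fst p *\<^sub>R snd p :> nhds (a *\<^sub>R x :: 'a)"
  unfolding filterlim_iff
proof (intro allI impI)
  fix P assume "eventually P (nhds (a *\<^sub>R x))"
  then obtain U where U: "N U" "\<forall>u\<in>U. P (a *\<^sub>R x + u)" unfolding eventually_nhds_N by blast
  have bal: "c *\<^sub>R y \<in> U" if "\<bar>c\<bar> \<le> 1" "y \<in> U" for c y
    using N_balanced[OF U(1)] that unfolding balanced_def by blast
  obtain c where c: "c > 0" "c *\<^sub>R x \<in> U" using N_absorbing[OF U(1)] by blast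
  let ?r = "2 * (\<bar>a\<bar> + 1)"
  let ?V = "{u. ?r *\<^sub>R u \<in> U}"
  have V: "N ?V" using N_scale[OF U(1), of ?r] by simp
  define e where "e = min 1 (c/2)"
  have e: "e > 0" "e \<le> 1" "2 * e \<le> c" using c by (auto simp: e_def)
  show "\<forall>\<^sub>F p in nhds a \<times>\<^sub>F nhds x. P (fst p *\<^sub>R snd p)"
    unfolding eventually_prod_filter
  proof (intro exI conjI allI impI)
    show "eventually (\<lambda>b. \<bar>b - a\<bar> < e) (nhds a)"
      using e(1) unfolding eventually_nhds_metric dist_real_def by blast
    show "eventually (\<lambda>y. y - x \<in> ?V) (nhds x)" unfolding eventually_nhds_N using V by (intro exI[of _ ?V]) simp
    fix b y assume b: "\<bar>b - a\<bar> < e" and y: "y - x \<in> ?V"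
    have "\<bar>2 * (b - a)\<bar> \<le> c" unfolding abs_mult using b e(3) by simp
    moreover have "\<bar>b\<bar> \<le> \<bar>a\<bar> + 1" using b e(2) by arith
    ultimately have "\<bar>2 * (b - a) / c\<bar> \<le> 1" "\<bar>b / (\<bar>a\<bar> + 1)\<bar> \<le> 1"
      using c(1) by (simp_all add: abs_divide)
    note small = this
    have "(2 * (b - a) / c) *\<^sub>R (c *\<^sub>R x) \<in> U"
      by (rule bal[OF small(1) c(2)])
    then have 1: "2 *\<^sub>R ((b - a) *\<^sub>R x) \<in> U" using c by simp
    have "(b / (\<bar>a\<bar> + 1)) *\<^sub>R (?r *\<^sub>R (y - x)) \<in> U"
      using y by (intro bal[OF small(2)]) simp
    moreover have "(b / (\<bar>a\<bar> + 1)) * ?r = 2 * b" by (simp add: field_simps)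
    ultimately have 2: "2 *\<^sub>R (b *\<^sub>R (y - x)) \<in> U" by (metis scaleR_scaleR)
    have "P (a *\<^sub>R x + ((b - a) *\<^sub>R x + b *\<^sub>R (y - x)))"
      using U(2) N_half2[OF U(1) 1 2] by blast
    then show "P (fst (b, y) *\<^sub>R snd (b, y))" by (simp add: algebra_simps)
  qed
qed

lemma separation:
  assumes "x \<noteq> (y::'a)" shows "\<exists>S T. open S \<and> open T \<and> x \<in> S \<and> y \<in> T \<and> S \<inter> T = {}"
proof -
  obtain U where U: "N U" "x - y \<notin> U" using N_separating[of "x - y"] assms by auto
  let ?V = "{u. 2 *\<^sub>R u \<in> U}"
  have V: "N ?V" using N_scale[OF U(1), of 2] by simp
  obtain S where S: "lc_open N S" "x \<in> S" "\<forall>z\<in>S. z - x \<in> ?V" using lc_nhd[OF V] by blast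
  obtain T where T: "lc_open N T" "y \<in> T" "\<forall>z\<in>T. z - y \<in> ?V" using lc_nhd[OF V] by blast
  have "S \<inter> T = {}"
  proof (rule ccontr)
    assume "S \<inter> T \<noteq> {}"
    then obtain z where "2 *\<^sub>R (z - x) \<in> U" "2 *\<^sub>R (z - y) \<in> U" using S T by auto
    moreover then have "(-1) *\<^sub>R (2 *\<^sub>R (z - x)) \<in> U"
      using N_balanced[OF U(1)] unfolding balanced_def by (metis abs_1 abs_minus_cancel order_refl)
    then have "2 *\<^sub>R (x - z) \<in> U" by (simp add: algebra_simps)
    ultimately have "(x - z) + (z - y) \<in> U" using N_half2[OF U(1)] by blast
    then show False using U by simp
  qed
  then show ?thesis using S T unfolding open_eq by blast
qed

lemma convex_base:
  assumes "open S" "x \<in> S" shows "\<exists>V. open V \<and> convex V \<and> x \<in> V \<and> V \<subseteq> (S :: 'a set)"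
proof -
  obtain U where U: "N U" "\<forall>u\<in>U. x + u \<in> S" using assms unfolding open_eq lc_open_def by blast
  let ?W = "{y. \<exists>V. N V \<and> (\<forall>u\<in>V. y + u \<in> (+) x ` U)}"
  have "convex ?W"
    unfolding convex_alt
  proof clarify
    fix y z t V V' assume t: "0 \<le> (t::real)" "t \<le> 1" and V: "N V" "\<forall>u\<in>V. y + u \<in> (+) x ` U"
      and V': "N V'" "\<forall>u\<in>V'. z + u \<in> (+) x ` U"
    have "((1 - t) *\<^sub>R y + t *\<^sub>R z) + u \<in> (+) x ` U" if "u \<in> V \<inter> V'" for u
    proof -
      have "(1 - t) *\<^sub>R (y + u) + t *\<^sub>R (z + u) \<in> (+) x ` U"
        using convex_translation[OF N_convex[OF U(1)], of x] V V' that t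
        unfolding convex_alt by blast
      then show ?thesis by (simp add: algebra_simps)
    qed
    then show "\<exists>V. N V \<and> (\<forall>u\<in>V. (1 - t) *\<^sub>R y + t *\<^sub>R z + u \<in> (+) x ` U)"
      using N_Int[OF V(1) V'(1)] by blast
  qed
  moreover have "x \<in> ?W" using U by auto
  moreover have "?W \<subseteq> S"
  proof clarify
    fix y V assume "N V" "\<forall>u\<in>V. y + u \<in> (+) x ` U"
    then have "y + 0 \<in> (+) x ` U" using N_0 by blast
    then show "y \<in> S" using U by auto
  qed
  ultimately show ?thesis using lc_open_interior unfolding open_eq by blast
qed

end

text \<open>A point of phase space is \<open>z = (x, v)\<close>. For the \<open>k\<close>-fold product of phase space we use
  configurations \<open>z 1, \<dots>, z k\<close> inside one type of sequences, with functions of \<open>k\<close> points being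
  functions that only depend on the entries with index in \<open>{1..k}\<close> (the entry \<open>z 0\<close> is never used).
  For such functions, continuity with respect to the product topology on sequences is continuity on
  the \<open>k\<close>-fold product, and suprema over compact sets of sequences are exactly suprema over compact
  subsets of the \<open>k\<close>-fold product.\<close>

type_synonym 'd phase = "(real^'d) \<times> (real^'d)"
type_synonym 'd config = "nat \<Rightarrow> 'd phase"

definition shift :: "nat \<times> 'd::finite phase \<Rightarrow> real \<Rightarrow> 'd config \<Rightarrow> 'd config" where
  "shift a t z = z(fst a := z (fst a) + t *\<^sub>R snd a)"

definition partial :: "nat \<times> 'd::finite phase \<Rightarrow> ('d config \<Rightarrow> real) \<Rightarrow> 'd config \<Rightarrow> real" where
  "partial a f z = deriv (\<lambda>t. f (shift a t z)) 0"

definition coords :: "nat \<Rightarrow> (nat \<times> 'd::finite phase) set" where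
  "coords k = {1..k} \<times> Basis"

text \<open>All iterated partial derivatives in the first \<open>k\<close> points exist everywhere and are continuous.
  A list of coordinates stands for a multi-index.\<close>

definition smooth :: "nat \<Rightarrow> ('d::finite config \<Rightarrow> real) \<Rightarrow> bool" where
  "smooth k f \<longleftrightarrow> (\<forall>as \<in> lists (coords k).
     continuous_on UNIV (foldr partial as f) \<and>
     (\<forall>a \<in> coords k. \<forall>z. (\<lambda>t. foldr partial as f (shift a t z)) differentiable at 0))"

text \<open>The space of smooth symmetric functions of \<open>k\<close> points (written \<open>g\<close> with index \<open>k\<close> in the
  literature).\<close>

definition obs :: "nat \<Rightarrow> ('d::finite config \<Rightarrow> real) set" where
  "obs k = {f. smooth k f
     \<and> (\<forall>z w. (\<forall>i\<in>{1..k}. z i = w i) \<longrightarrow> f z = f w)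
     \<and> (\<forall>\<pi>. \<pi> permutes {1..k} \<longrightarrow> (\<forall>z. f (\<lambda>i. z (\<pi> i)) = f z))}"

definition obs_seminorm :: "nat \<Rightarrow> nat \<Rightarrow> 'd::finite config set \<Rightarrow> ('d config \<Rightarrow> real) \<Rightarrow> real" where
  "obs_seminorm k n K f =
     (SUP (as, z) \<in> {as \<in> lists (coords k). length as \<le> n} \<times> K. \<bar>foldr partial as f z\<bar>)"

definition obs_ball ::
  "nat \<Rightarrow> nat \<Rightarrow> 'd::finite config set \<Rightarrow> ('d config \<Rightarrow> real) \<Rightarrow> real \<Rightarrow> ('d config \<Rightarrow> real) set" where
  "obs_ball k n K f e = {g \<in> obs k. obs_seminorm k n K (\<lambda>z. g z - f z) < e}"

definition obs_topology :: "nat \<Rightarrow> ('d::finite config \<Rightarrow> real) topology" where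
  "obs_topology k = topology_generated_by
     {obs_ball k n K f e | n K f e. compact K \<and> K \<noteq> {} \<and> f \<in> obs k \<and> 0 < e}"

lemma smoothD1: "smooth k f \<Longrightarrow> as \<in> lists (coords k) \<Longrightarrow> continuous_on UNIV (foldr partial as f)"
  unfolding smooth_def by blast

lemma smoothD2:
  "smooth k f \<Longrightarrow> as \<in> lists (coords k) \<Longrightarrow> a \<in> coords k \<Longrightarrow>
   (\<lambda>t. foldr partial as f (shift a t z)) differentiable at 0"
  unfolding smooth_def by blast

lemma smoothD3:
  assumes "smooth k f" "as \<in> lists (coords k)" "a \<in> coords k"
  shows "((\<lambda>t. foldr partial as f (shift a t z)) has_real_derivative partial a (foldr partial as f) z) (at 0)"
  using smoothD2[OF assms, of z] unfolding partial_def[of a]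
  by (simp only: DERIV_deriv_iff_real_differentiable)

lemma foldr_partial_add:
  assumes "smooth k f" "smooth k g" "as \<in> lists (coords k)"
  shows "foldr partial as (\<lambda>z. f z + g z) = (\<lambda>z. foldr partial as f z + foldr partial as g z)"
  using assms(3)
proof (induction as)
  case (Cons a as)
  show ?case
  proof
    fix z
    have "partial a (\<lambda>z. foldr partial as f z + foldr partial as g z) z
        = partial a (foldr partial as f) z + partial a (foldr partial as g) z"
      using Cons(1,2) unfolding partial_def[of a "\<lambda>z. foldr partial as f z + foldr partial as g z"]
      by (intro DERIV_imp_deriv DERIV_add smoothD3[OF assms(1)] smoothD3[OF assms(2)])
    then show "foldr partial (a # as) (\<lambda>z. f z + g z) z = foldr partial (a # as) f z + foldr partial (a # as) g z"
      by (simp add: Cons)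
  qed
qed simp

lemma foldr_partial_scale:
  assumes "smooth k f" "as \<in> lists (coords k)"
  shows "foldr partial as (\<lambda>z. c * f z) = (\<lambda>z. c * foldr partial as f z)"
  using assms(2)
proof (induction as)
  case (Cons a as)
  show ?case
  proof
    fix z
    have "partial a (\<lambda>z. c * foldr partial as f z) z = c * partial a (foldr partial as f) z"
      using Cons(1,2) unfolding partial_def[of a "\<lambda>z. c * foldr partial as f z"]
      by (intro DERIV_imp_deriv DERIV_cmult smoothD3[OF assms(1)])
    then show "foldr partial (a # as) (\<lambda>z. c * f z) z = c * foldr partial (a # as) f z"
      by (simp add: Cons)
  qed
qed simp

lemma smooth_add:
  assumes "smooth k f" "smooth k g" shows "smooth k (\<lambda>z. f z + g z)"
  unfolding smooth_def
proof (intro ballI conjI, goal_cases)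
  case (1 as)
  then show ?case
    by (simp add: foldr_partial_add[OF assms 1] continuous_on_add smoothD1[OF assms(1)] smoothD1[OF assms(2)])
next
  case (2 as a)
  then show ?case
    using smoothD2[OF assms(1) 2] smoothD2[OF assms(2) 2]
    by (simp add: foldr_partial_add[OF assms 2(1)] differentiable_add)
qed

lemma smooth_scale:
  assumes "smooth k f" shows "smooth k (\<lambda>z. c * f z)"
  unfolding smooth_def
proof (intro ballI conjI, goal_cases)
  case (1 as)
  then show ?case
    by (simp add: foldr_partial_scale[OF assms 1] continuous_on_mult_left smoothD1[OF assms(1)])
next
  case (2 as a)
  then show ?case
    using smoothD2[OF assms(1) 2]
    by (simp add: foldr_partial_scale[OF assms 2(1)] differentiable_mult)
qed

lemma foldr_partial_0: "foldr partial as (\<lambda>z. 0) = (\<lambda>z. 0)"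
  by (induction as) (auto simp: partial_def)

lemma smooth_0: "smooth k (\<lambda>z. 0)"
  by (simp add: smooth_def foldr_partial_0)

lemma obs_smooth: "f \<in> obs k \<Longrightarrow> smooth k f"
  by (simp add: obs_def)

lemma obs_cong: "f \<in> obs k \<Longrightarrow> (\<And>i. i \<in> {1..k} \<Longrightarrow> z i = w i) \<Longrightarrow> f z = f w"
  unfolding obs_def by blast

lemma obs_permute: "f \<in> obs k \<Longrightarrow> \<pi> permutes {1..k} \<Longrightarrow> f (\<lambda>i. z (\<pi> i)) = f z"
  unfolding obs_def by blast

lemma obsI:
  "smooth k f \<Longrightarrow> (\<And>z w. (\<And>i. i \<in> {1..k} \<Longrightarrow> z i = w i) \<Longrightarrow> f z = f w) \<Longrightarrow>
   (\<And>\<pi> z. \<pi> permutes {1..k} \<Longrightarrow> f (\<lambda>i. z (\<pi> i)) = f z) \<Longrightarrow> f \<in> obs k"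
  unfolding obs_def by blast

lemma obs_0: "(\<lambda>z. 0) \<in> obs k"
  by (rule obsI) (simp_all add: smooth_0)

lemma obs_add:
  assumes "f \<in> obs k" "g \<in> obs k" shows "(\<lambda>z. f z + g z) \<in> obs k"
proof (rule obsI)
  show "smooth k (\<lambda>z. f z + g z)" using assms by (intro smooth_add obs_smooth)
  show "f z + g z = f w + g w" if "\<And>i. i \<in> {1..k} \<Longrightarrow> z i = w i" for z w
    using obs_cong[OF assms(1) that] obs_cong[OF assms(2) that] by simp
  show "f (\<lambda>i. z (\<pi> i)) + g (\<lambda>i. z (\<pi> i)) = f z + g z" if "\<pi> permutes {1..k}" for \<pi> z
    using obs_permute[OF assms(1) that, of z] obs_permute[OF assms(2) that, of z] by simp
qed

lemma obs_scale:
  assumes "f \<in> obs k" shows "(\<lambda>z. c * f z) \<in> obs k"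
proof (rule obsI)
  show "smooth k (\<lambda>z. c * f z)" using assms by (intro smooth_scale obs_smooth)
  show "c * f z = c * f w" if "\<And>i. i \<in> {1..k} \<Longrightarrow> z i = w i" for z w
    using obs_cong[OF assms(1) that] by simp
  show "c * f (\<lambda>i. z (\<pi> i)) = c * f z" if "\<pi> permutes {1..k}" for \<pi> z
    using obs_permute[OF assms(1) that, of z] by simp
qed

lemma obs_diff: "f \<in> obs k \<Longrightarrow> g \<in> obs k \<Longrightarrow> (\<lambda>z. f z - g z) \<in> obs k"
  using obs_add[OF _ obs_scale[of g k "-1"], of f] by simp

text \<open>The direct sum over \<open>k \<ge> 1\<close>; the component with index 0 is a dummy.\<close>

typedef (overloaded) ('d::finite) hierarchy =
  "{F :: nat \<Rightarrow> 'd config \<Rightarrow> real.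
      F 0 = (\<lambda>z. 0) \<and> (\<forall>k\<ge>1. F k \<in> obs k) \<and> finite {k. F k \<noteq> (\<lambda>z. 0)}}"
  morphisms component Abs_hierarchy
  by (rule exI[of _ "\<lambda>k z. 0"]) (auto simp: obs_0)

setup_lifting type_definition_hierarchy

instantiation hierarchy :: (finite) real_vector
begin

lift_definition zero_hierarchy :: "'a hierarchy" is "\<lambda>k z. 0"
  by (auto simp: obs_0)

lift_definition plus_hierarchy :: "'a hierarchy \<Rightarrow> 'a hierarchy \<Rightarrow> 'a hierarchy" is "\<lambda>F G k z. F k z + G k z"
proof (safe intro!: obs_add)
  fix F G :: "nat \<Rightarrow> 'a config \<Rightarrow> real"
  assume "finite {k. F k \<noteq> (\<lambda>z. 0)}" "finite {k. G k \<noteq> (\<lambda>z. 0)}"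
  then show "finite {k. (\<lambda>z. F k z + G k z) \<noteq> (\<lambda>z. 0)}"
    by (rule finite_subset[OF _ finite_UnI, rotated]) (auto simp: fun_eq_iff)
qed auto

lift_definition scaleR_hierarchy :: "real \<Rightarrow> 'a hierarchy \<Rightarrow> 'a hierarchy" is "\<lambda>c F k z. c * F k z"
proof (safe intro!: obs_scale)
  fix F :: "nat \<Rightarrow> 'a config \<Rightarrow> real" and c :: real
  assume "finite {k. F k \<noteq> (\<lambda>z. 0)}"
  then show "finite {k. (\<lambda>z. c * F k z) \<noteq> (\<lambda>z. 0)}"
    by (rule finite_subset[rotated]) (auto simp: fun_eq_iff)
qed auto

definition uminus_hierarchy :: "'a hierarchy \<Rightarrow> 'a hierarchy" where "uminus_hierarchy F = (-1) *\<^sub>R F"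
definition minus_hierarchy :: "'a hierarchy \<Rightarrow> 'a hierarchy \<Rightarrow> 'a hierarchy" where "minus_hierarchy F G = F + (-1) *\<^sub>R G"

instance
  by standard (unfold uminus_hierarchy_def minus_hierarchy_def, (transfer; auto simp: fun_eq_iff algebra_simps)+)

end

lemmas component_simps = zero_hierarchy.rep_eq plus_hierarchy.rep_eq scaleR_hierarchy.rep_eq

lemma hierarchy_eqI: "(\<And>k z. component F k z = component G k z) \<Longrightarrow> F = G"
  by (metis component_inject ext)

lemma component_obs: "k \<ge> 1 \<Longrightarrow> component F k \<in> obs k"
  using component[of F] by auto

lemma component_zero: "component F 0 = (\<lambda>z. 0)"
  using component[of F] by auto

definition incl :: "nat \<Rightarrow> ('d::finite config \<Rightarrow> real) \<Rightarrow> 'd hierarchy" where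
  "incl k f = Abs_hierarchy (\<lambda>j. if j = k then f else (\<lambda>z. 0))"

lemma component_incl:
  assumes "k \<ge> 1" "f \<in> obs k"
  shows "component (incl k f) j = (if j = k then f else (\<lambda>z. 0))"
proof -
  have "finite {j. (if j = k then f else (\<lambda>z. 0)) \<noteq> (\<lambda>z. 0)}"
    by (rule finite_subset[of _ "{k}"]) auto
  then show ?thesis
    unfolding incl_def using assms by (subst Abs_hierarchy_inverse) (auto simp: obs_0)
qed

text \<open>The locally convex direct sum topology is the finest locally convex topology that makes all
  inclusions continuous: its neighbourhood base at 0 consists of the absolutely convex sets
  whose preimage under every inclusion is a neighbourhood of 0.\<close>

definition direct_sum_nhd :: "'d::finite hierarchy set \<Rightarrow> bool" where
  "direct_sum_nhd U \<longleftrightarrow> convex U \<and> balanced U \<and>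
     (\<forall>k\<ge>1. \<exists>W. openin (obs_topology k) W \<and> (\<lambda>z. 0) \<in> W \<and> incl k ` W \<subseteq> U)"

lemma obs_seminorm_bdd:
  assumes "f \<in> obs k" "compact K"
  shows "bdd_above ((\<lambda>(as, z). \<bar>foldr partial as f z\<bar>) ` ({as \<in> lists (coords k). length as \<le> n} \<times> K))"
proof -
  have "finite {as. set as \<subseteq> coords k \<and> length as \<le> n}"
    by (intro finite_lists_length_le) (auto simp: coords_def)
  then have fin: "finite {as \<in> lists (coords k). length as \<le> n}"
    by (rule finite_subset[rotated]) auto
  have "bdd_above ((\<lambda>z. \<bar>foldr partial as f z\<bar>) ` K)" if "as \<in> lists (coords k)" for as
  proof -
    have "continuous_on K (\<lambda>z. \<bar>foldr partial as f z\<bar>)"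
      using continuous_on_subset[OF smoothD1[OF obs_smooth[OF assms(1)] that]]
      by (intro continuous_on_rabs) auto
    then show ?thesis
      by (intro bounded_imp_bdd_above compact_imp_bounded compact_continuous_image assms(2))
  qed
  then have "bdd_above (\<Union>as\<in>{as \<in> lists (coords k). length as \<le> n}. (\<lambda>z. \<bar>foldr partial as f z\<bar>) ` K)"
    by (subst bdd_above_UN[OF fin]) auto
  then show ?thesis
    by (rule bdd_above_mono) auto
qed

lemma obs_seminorm_upper:
  assumes "f \<in> obs k" "compact K" "as \<in> lists (coords k)" "length as \<le> n" "z \<in> K"
  shows "\<bar>foldr partial as f z\<bar> \<le> obs_seminorm k n K f"
proof -
  have "(as, z) \<in> {as \<in> lists (coords k). length as \<le> n} \<times> K" using assms by auto
  from cSUP_upper[OF this obs_seminorm_bdd[OF assms(1,2)]]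
  show ?thesis unfolding obs_seminorm_def by simp
qed

lemma obs_seminorm_least:
  assumes "K \<noteq> {}" "\<And>as z. as \<in> lists (coords k) \<Longrightarrow> length as \<le> n \<Longrightarrow> z \<in> K \<Longrightarrow> \<bar>foldr partial as f z\<bar> \<le> C"
  shows "obs_seminorm k n K f \<le> C"
proof -
  have "[] \<in> {as \<in> lists (coords k). length as \<le> n}" by auto
  then have "{as \<in> lists (coords k). length as \<le> n} \<times> K \<noteq> {}" using assms(1) by blast
  then show ?thesis unfolding obs_seminorm_def by (intro cSUP_least) (auto intro: assms(2))
qed

lemma obs_seminorm_0: "K \<noteq> {} \<Longrightarrow> compact K \<Longrightarrow> obs_seminorm k n K (\<lambda>z. 0) = 0"
  using obs_seminorm_upper[OF obs_0, of K "[]" k n]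
  by (intro antisym obs_seminorm_least) (auto simp: foldr_partial_0)

lemma obs_seminorm_scale:
  assumes "f \<in> obs k" "compact K" "K \<noteq> {}"
  shows "obs_seminorm k n K (\<lambda>z. c * f z) \<le> \<bar>c\<bar> * obs_seminorm k n K f"
  using assms
  by (intro obs_seminorm_least)
    (simp_all add: foldr_partial_scale[of k, OF obs_smooth] abs_mult mult_left_mono obs_seminorm_upper)

lemma obs_seminorm_add:
  assumes "f \<in> obs k" "g \<in> obs k" "compact K" "K \<noteq> {}"
  shows "obs_seminorm k n K (\<lambda>z. f z + g z) \<le> obs_seminorm k n K f + obs_seminorm k n K g"
proof (rule obs_seminorm_least)
  fix as :: "(nat \<times> 'a phase) list" and z assume *: "as \<in> lists (coords k)" "length as \<le> n" "z \<in> K"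
  then have "foldr partial as (\<lambda>z. f z + g z) z = foldr partial as f z + foldr partial as g z"
    using assms by (simp add: foldr_partial_add[of k] obs_smooth)
  moreover have "\<bar>foldr partial as f z\<bar> \<le> obs_seminorm k n K f" "\<bar>foldr partial as g z\<bar> \<le> obs_seminorm k n K g"
    using * assms by (auto intro!: obs_seminorm_upper)
  ultimately show "\<bar>foldr partial as (\<lambda>z. f z + g z) z\<bar> \<le> obs_seminorm k n K f + obs_seminorm k n K g"
    by linarith
qed fact

lemma obs_seminorm_mono:
  assumes "f \<in> obs k" "compact K'" "K \<noteq> {}" "n \<le> n'" "K \<subseteq> K'"
  shows "obs_seminorm k n K f \<le> obs_seminorm k n' K' f"
  using assms by (intro obs_seminorm_least obs_seminorm_upper) auto

lemma obs_ball_open: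
  assumes "f \<in> obs k" "compact K" "K \<noteq> {}" "0 < e"
  shows "openin (obs_topology k) (obs_ball k n K f e)"
  unfolding obs_topology_def by (rule topology_generated_by_Basis) (use assms in blast)

lemma obs_ball_mono:
  assumes "f \<in> obs k" "compact K'" "K \<noteq> {}" "n \<le> n'" "K \<subseteq> K'" "e' \<le> e"
  shows "obs_ball k n' K' f e' \<subseteq> obs_ball k n K f e"
proof
  fix g assume "g \<in> obs_ball k n' K' f e'"
  then have g: "g \<in> obs k" "obs_seminorm k n' K' (\<lambda>z. g z - f z) < e'" by (simp_all add: obs_ball_def)
  have "obs_seminorm k n K (\<lambda>z. g z - f z) \<le> obs_seminorm k n' K' (\<lambda>z. g z - f z)"
    using assms g by (intro obs_seminorm_mono obs_diff)
  then show "g \<in> obs_ball k n K f e" using g assms(6) by (simp add: obs_ball_def)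
qed

lemma openin_obs_topologyD:
  assumes "openin (obs_topology k) W" "f \<in> W"
  shows "f \<in> obs k \<and> (\<exists>n K e. compact K \<and> K \<noteq> {} \<and> 0 < e \<and> obs_ball k n K f e \<subseteq> W)"
  using assms unfolding obs_topology_def openin_topology_generated_by_iff
proof (induction arbitrary: f rule: generate_topology_on.induct)
  case Empty
  then show ?case by simp
next
  case (Int A B)
  have f: "f \<in> obs k" using Int by simp
  obtain n K e where 1: "compact K" "K \<noteq> {}" "0 < e" "obs_ball k n K f e \<subseteq> A"
    using Int.IH(1)[of f] Int.prems by auto
  obtain n' K' e' where 2: "compact K'" "K' \<noteq> {}" "0 < e'" "obs_ball k n' K' f e' \<subseteq> B"
    using Int.IH(2)[of f] Int.prems by auto
  have "obs_ball k (max n n') (K \<union> K') f (min e e') \<subseteq> obs_ball k n K f e"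
    "obs_ball k (max n n') (K \<union> K') f (min e e') \<subseteq> obs_ball k n' K' f e'"
    using 1 2 f by (simp_all add: obs_ball_mono compact_Un)
  then have "obs_ball k (max n n') (K \<union> K') f (min e e') \<subseteq> A \<inter> B" using 1 2 by blast
  then show ?case using 1 2 f
    by (intro conjI exI[of _ "max n n'"] exI[of _ "K \<union> K'"] exI[of _ "min e e'"]) auto
next
  case (UN T)
  then obtain S where S: "S \<in> T" "f \<in> S" by blast
  have f: "f \<in> obs k" using UN.IH[OF S] by simp
  obtain n K e where 1: "compact K" "K \<noteq> {}" "0 < e" "obs_ball k n K f e \<subseteq> S"
    using UN.IH[OF S] by auto
  then show ?case using f S
    by (intro conjI exI[of _ n] exI[of _ K] exI[of _ e]) auto
next
  case (Basis S)
  then obtain n K h e where S: "S = obs_ball k n K h e"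
    and h: "h \<in> obs k" "compact K" "K \<noteq> {}" "0 < e" by blast
  let ?e = "e - obs_seminorm k n K (\<lambda>z. f z - h z)"
  have f: "f \<in> obs k" "?e > 0" using Basis S by (simp_all add: obs_ball_def)
  have "obs_ball k n K f ?e \<subseteq> S"
  proof
    fix g assume "g \<in> obs_ball k n K f ?e"
    then have g: "g \<in> obs k" "obs_seminorm k n K (\<lambda>z. g z - f z) < ?e" by (simp_all add: obs_ball_def)
    have "obs_seminorm k n K (\<lambda>z. (g z - f z) + (f z - h z))
      \<le> obs_seminorm k n K (\<lambda>z. g z - f z) + obs_seminorm k n K (\<lambda>z. f z - h z)"
      using f g h by (intro obs_seminorm_add obs_diff)
    then show "g \<in> S" using g S by (simp add: obs_ball_def)
  qed
  then show ?case using f h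
    by (intro conjI exI[of _ n] exI[of _ K] exI[of _ ?e])
qed

lemma obs_nhd_0_iff:
  "(\<exists>W. openin (obs_topology k) W \<and> (\<lambda>z. 0) \<in> W \<and> W \<subseteq> S) \<longleftrightarrow>
   (\<exists>n K e. compact K \<and> K \<noteq> {} \<and> 0 < e \<and> (\<forall>f\<in>obs k. obs_seminorm k n K f < e \<longrightarrow> f \<in> S))" (is "?L \<longleftrightarrow> ?R")
proof
  assume ?L
  then obtain W where W: "openin (obs_topology k) W" "(\<lambda>z. 0) \<in> W" "W \<subseteq> S" by blast
  obtain n K e where "compact K" "K \<noteq> {}" "0 < e" "obs_ball k n K (\<lambda>z. 0) e \<subseteq> W"
    using openin_obs_topologyD[OF W(1,2)] by auto
  then show ?R using W(3)
    by (intro exI[of _ n] exI[of _ K] exI[of _ e]) (auto simp: obs_ball_def)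
next
  assume ?R
  then obtain n K e where *: "compact K" "K \<noteq> {}" "0 < e" "\<forall>f\<in>obs k. obs_seminorm k n K f < e \<longrightarrow> f \<in> S"
    by blast
  have "(\<lambda>z. 0) \<in> obs_ball k n K (\<lambda>z. 0) e"
    using obs_seminorm_0[OF *(2,1), of k n] *(3) by (simp add: obs_ball_def obs_0)
  moreover have "obs_ball k n K (\<lambda>z. 0) e \<subseteq> S" using *(4) by (auto simp: obs_ball_def)
  ultimately show ?L using obs_ball_open[OF obs_0 *(1-3)] by blast
qed

lemma direct_sum_nhd_iff:
  "direct_sum_nhd U \<longleftrightarrow> convex U \<and> balanced U \<and>
     (\<forall>k\<ge>1. \<exists>n K e. compact K \<and> K \<noteq> {} \<and> 0 < e \<and> (\<forall>f\<in>obs k. obs_seminorm k n K f < e \<longrightarrow> incl k f \<in> U))"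
proof -
  have "(\<exists>W. openin (obs_topology k) W \<and> (\<lambda>z. 0) \<in> W \<and> incl k ` W \<subseteq> U) \<longleftrightarrow>
        (\<exists>W. openin (obs_topology k) W \<and> (\<lambda>z. 0) \<in> W \<and> W \<subseteq> incl k -` U)" for k
    by (simp only: image_subset_iff_subset_vimage)
  then show ?thesis unfolding direct_sum_nhd_def by (simp only: obs_nhd_0_iff vimage_eq)
qed

lemma incl_add:
  assumes "k \<ge> 1" "f \<in> obs k" "g \<in> obs k" shows "incl k (\<lambda>z. f z + g z) = incl k f + incl k g"
  by (rule hierarchy_eqI) (use assms in \<open>simp add: component_incl component_simps obs_add\<close>)

lemma incl_scale:
  assumes "k \<ge> 1" "f \<in> obs k" shows "incl k (\<lambda>z. c * f z) = c *\<^sub>R incl k f"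
  by (rule hierarchy_eqI) (use assms in \<open>simp add: component_incl component_simps obs_scale\<close>)

lemma component_sum: "component (sum F A) j z = (\<Sum>k\<in>A. component (F k) j z)"
  by (induction A rule: infinite_finite_induct) (simp_all add: component_simps)

definition supp :: "'d::finite hierarchy \<Rightarrow> nat set" where
  "supp F = {k. component F k \<noteq> (\<lambda>z. 0)}"

lemma finite_supp: "finite (supp F)"
  using component[of F] by (simp add: supp_def)

lemma supp_pos: "k \<in> supp F \<Longrightarrow> k \<ge> 1"
  by (cases k) (auto simp: supp_def component_zero)

lemma hierarchy_expand: "F = (\<Sum>k\<in>supp F. incl k (component F k))"
proof (rule hierarchy_eqI)
  fix j z
  have "component (\<Sum>k\<in>supp F. incl k (component F k)) j z
      = (\<Sum>k\<in>supp F. if j = k then component F k z else 0)"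
    unfolding component_sum
    by (rule sum.cong) (simp_all add: component_incl[OF supp_pos component_obs[OF supp_pos]])
  also have "\<dots> = component F j z"
    by (subst sum.delta'[OF finite_supp]) (auto simp: supp_def)
  finally show "component F j z = component (\<Sum>k\<in>supp F. incl k (component F k)) j z" by simp
qed

interpretation direct_sum: lc_base direct_sum_nhd
proof
  show "direct_sum_nhd UNIV"
    unfolding direct_sum_nhd_iff
    by (auto simp: balanced_def intro!: exI[of _ "{\<lambda>i. 0}"] exI[of _ "1::real"])
next
  show "convex U" "balanced U" if "direct_sum_nhd U" for U :: "'a hierarchy set"
    using that by (simp_all add: direct_sum_nhd_def)
next
  fix U V :: "'a hierarchy set" assume U: "direct_sum_nhd U" and V: "direct_sum_nhd V"
  have "\<exists>W. openin (obs_topology k) W \<and> (\<lambda>z. 0) \<in> W \<and> incl k ` W \<subseteq> U \<inter> V" if k: "k \<ge> 1" for k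
  proof -
    obtain W where W: "openin (obs_topology k) W" "(\<lambda>z. 0) \<in> W" "incl k ` W \<subseteq> U"
      using U k unfolding direct_sum_nhd_def by meson
    obtain W' where W': "openin (obs_topology k) W'" "(\<lambda>z. 0) \<in> W'" "incl k ` W' \<subseteq> V"
      using V k unfolding direct_sum_nhd_def by meson
    show ?thesis using W W' by (intro exI[of _ "W \<inter> W'"]) auto
  qed
  then show "direct_sum_nhd (U \<inter> V)"
    using U V unfolding direct_sum_nhd_def by (simp add: convex_Int balanced_def)
next
  fix U :: "'a hierarchy set" and c :: real assume U: "direct_sum_nhd U" and c: "c > 0"
  have "convex {x. c *\<^sub>R x \<in> U}"
    using convex_linear_vimage[of "(*\<^sub>R) c" U] U by (simp add: direct_sum_nhd_def linear_scale_self vimage_def)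
  moreover have "balanced {x. c *\<^sub>R x \<in> U}"
    using U unfolding direct_sum_nhd_def balanced_def
    by (metis (no_types, lifting) mem_Collect_eq scaleR_left_commute)
  moreover have "\<exists>n K e. compact K \<and> K \<noteq> {} \<and> 0 < e \<and>
      (\<forall>f\<in>obs k. obs_seminorm k n K f < e \<longrightarrow> incl k f \<in> {x. c *\<^sub>R x \<in> U})" if k: "k \<ge> 1" for k
  proof -
    obtain n K e where *: "compact K" "K \<noteq> {}" "0 < e" "\<forall>f\<in>obs k. obs_seminorm k n K f < e \<longrightarrow> incl k f \<in> U"
      using U k unfolding direct_sum_nhd_iff by meson
    have "incl k f \<in> {x. c *\<^sub>R x \<in> U}" if f: "f \<in> obs k" "obs_seminorm k n K f < e / c" for f
    proof -
      have "obs_seminorm k n K (\<lambda>z. c * f z) \<le> c * obs_seminorm k n K f"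
        using obs_seminorm_scale[OF f(1) *(1,2), of n c] c by simp
      also have "\<dots> < e" using f(2) c by (simp add: pos_less_divide_eq mult.commute)
      finally have "incl k (\<lambda>z. c * f z) \<in> U" using *(4) f(1) by (simp add: obs_scale)
      then show ?thesis using k f(1) by (simp add: incl_scale)
    qed
    then show ?thesis using * c by (intro exI[of _ n] exI[of _ K] exI[of _ "e / c"]) simp
  qed
  ultimately show "direct_sum_nhd {x. c *\<^sub>R x \<in> U}"
    unfolding direct_sum_nhd_iff by blast
next
  fix U :: "'a hierarchy set" and F assume U: "direct_sum_nhd U"
  have conv: "convex U" and bal: "balanced U" using U by (simp_all add: direct_sum_nhd_def)
  have 0: "0 \<in> U"
  proof -
    obtain W :: "('a config \<Rightarrow> real) set" where "(\<lambda>z. 0) \<in> W" "incl 1 ` W \<subseteq> U"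
      using U unfolding direct_sum_nhd_def by (metis le_refl)
    then have "0 *\<^sub>R incl 1 (\<lambda>z. 0) \<in> U"
      using bal unfolding balanced_def by (metis abs_zero image_subset_iff zero_le_one)
    then show ?thesis by simp
  qed
  have one: "\<exists>c>0. c *\<^sub>R incl k f \<in> U" if k: "k \<ge> 1" and f: "f \<in> obs k" for k f
  proof -
    obtain n K e where *: "compact K" "K \<noteq> {}" "0 < e" "\<forall>f\<in>obs k. obs_seminorm k n K f < e \<longrightarrow> incl k f \<in> U"
      using U k unfolding direct_sum_nhd_iff by meson
    define p where "p = obs_seminorm k n K f"
    define c where "c = e / (\<bar>p\<bar> + 1)"
    have c: "c > 0" using * by (simp add: c_def)
    have "obs_seminorm k n K (\<lambda>z. c * f z) \<le> c * p"
      using obs_seminorm_scale[OF f *(1,2), of n c] c by (simp add: p_def)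
    also have "\<dots> \<le> c * \<bar>p\<bar>" using c by simp
    also have "\<dots> < c * (\<bar>p\<bar> + 1)" using c by simp
    also have "\<dots> = e" by (simp add: c_def)
    finally have "incl k (\<lambda>z. c * f z) \<in> U" using *(4) f by (simp add: obs_scale)
    then show ?thesis using k f c by (auto simp: incl_scale)
  qed
  have "\<exists>c>0. c *\<^sub>R (\<Sum>k\<in>A. incl k (component F k)) \<in> U" if "finite A" "A \<subseteq> supp F" for A
    using that
  proof (induction A rule: finite_induct)
    case empty
    then show ?case using 0 by (intro exI[of _ 1]) simp
  next
    case (insert k A)
    let ?y = "incl k (component F k)" and ?s = "\<Sum>k\<in>A. incl k (component F k)"
    obtain c where c: "c > 0" "c *\<^sub>R ?y \<in> U"
      using one[of k "component F k"] insert.prems supp_pos component_obs by blast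
    obtain d where d: "d > 0" "d *\<^sub>R ?s \<in> U" using insert by blast
    define m where "m = min c d"
    have m: "m > 0" "m \<le> c" "m \<le> d" using c d by (simp_all add: m_def)
    have small: "a *\<^sub>R x \<in> U" if "b *\<^sub>R x \<in> U" "0 < a" "a \<le> b" for a b :: real and x
    proof -
      have "(a / b) *\<^sub>R (b *\<^sub>R x) \<in> U"
        using bal that unfolding balanced_def by (metis abs_of_nonneg divide_le_eq_1_pos divide_nonneg_nonneg less_eq_real_def order_less_le_trans)
      then show ?thesis using that by simp
    qed
    have "(1/2) *\<^sub>R (m *\<^sub>R ?y) + (1/2) *\<^sub>R (m *\<^sub>R ?s) \<in> U"
      by (rule convexD[OF conv small[OF c(2) m(1,2)] small[OF d(2) m(1,3)]]) simp_all
    then have "(m / 2) *\<^sub>R (?y + ?s) \<in> U" by (simp add: scaleR_add_right)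
    then show ?case using m insert.hyps by (intro exI[of _ "m / 2"]) simp
  qed
  then show "\<exists>c>0. c *\<^sub>R F \<in> U" using finite_supp hierarchy_expand[of F] by (metis order_refl)
next
  fix F :: "'a hierarchy" assume "F \<noteq> 0"
  then obtain k z where kz: "component F k z \<noteq> 0"
    using hierarchy_eqI[of F 0] by (auto simp: component_simps)
  let ?U = "{G. \<bar>component G k z\<bar> < \<bar>component F k z\<bar>}"
  have "convex ?U"
  proof -
    have "convex ((\<lambda>G. component G k z) -` ball 0 \<bar>component F k z\<bar>)"
      by (intro convex_linear_vimage linearI convex_ball) (simp_all add: component_simps)
    then show ?thesis by (simp add: vimage_def dist_real_def)
  qed
  moreover have "balanced ?U"
    unfolding balanced_def
    by (auto simp: component_simps abs_mult intro: le_less_trans[OF mult_left_le_one_le])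
  moreover have "\<exists>n K e. compact K \<and> K \<noteq> {} \<and> 0 < e \<and> (\<forall>f\<in>obs j. obs_seminorm j n K f < e \<longrightarrow> incl j f \<in> ?U)"
    if j: "j \<ge> 1" for j
  proof (intro exI[of _ "0::nat"] exI[of _ "{z}"] exI[of _ "\<bar>component F k z\<bar>"] conjI ballI impI)
    fix f :: "'a config \<Rightarrow> real" assume f: "f \<in> obs j" "obs_seminorm j 0 {z} f < \<bar>component F k z\<bar>"
    have "\<bar>foldr partial [] f z\<bar> \<le> obs_seminorm j 0 {z} f"
      by (rule obs_seminorm_upper[OF f(1)]) simp_all
    then show "incl j f \<in> ?U" using f j kz by (auto simp: component_incl)
  qed (use kz in simp_all)
  ultimately have "direct_sum_nhd ?U" unfolding direct_sum_nhd_iff by blast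
  then show "\<exists>U. direct_sum_nhd U \<and> F \<notin> U" by (intro exI[of _ ?U]) simp
qed

instantiation hierarchy :: (finite) topological_space
begin

definition open_hierarchy :: "'a hierarchy set \<Rightarrow> bool" where
  "open_hierarchy = lc_open direct_sum_nhd"

instance
proof (standard, unfold open_hierarchy_def)
qed (fact direct_sum.lc_open_UNIV direct_sum.lc_open_Int direct_sum.lc_open_Union)+

end

interpretation direct_sum: lc_base_topology direct_sum_nhd
  by standard (rule open_hierarchy_def)

instance hierarchy :: (finite) locally_convex_space
proof
  fix U :: "'a hierarchy set" and x assume "open U" "x \<in> U"
  from direct_sum.convex_base[OF this]
  show "\<exists>V. open V \<and> x \<in> V \<and> V \<subseteq> U \<and>
      (\<forall>y\<in>V. \<forall>z\<in>V. \<forall>t\<ge>0. \<forall>s\<ge>0. t + s = 1 \<longrightarrow> t *\<^sub>R y + s *\<^sub>R z \<in> V)"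
    unfolding convex_def by blast
qed (fact direct_sum.tendsto_add_nhds direct_sum.tendsto_uminus direct_sum.tendsto_scale direct_sum.separation)+

definition vn_bounded :: "'a::{real_vector,topological_space} set \<Rightarrow> bool" where
  "vn_bounded B \<longleftrightarrow> (\<forall>U. open U \<longrightarrow> 0 \<in> U \<longrightarrow> (\<exists>s>0. \<forall>t\<ge>s. B \<subseteq> (*\<^sub>R) t ` U))"

lemma lcs_absorbing:
  fixes x :: "'a::locally_convex_space"
  assumes "open U" "0 \<in> U" shows "\<exists>s>0. \<forall>t\<ge>s. x \<in> (*\<^sub>R) t ` U"
proof -
  have "((\<lambda>p. fst p *\<^sub>R snd p) \<longlongrightarrow> 0 *\<^sub>R x) (nhds 0 \<times>\<^sub>F nhds x)"
    by (rule tendsto_scaleR_nhds)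
  then have "eventually (\<lambda>p. fst p *\<^sub>R snd p \<in> U) (nhds (0::real) \<times>\<^sub>F nhds x)"
    using assms by (auto dest: topological_tendstoD)
  then obtain P Q where "eventually P (nhds (0::real))" "eventually Q (nhds x)" "\<And>c y. P c \<Longrightarrow> Q y \<Longrightarrow> c *\<^sub>R y \<in> U"
    unfolding eventually_prod_filter by auto
  then have "eventually (\<lambda>c. c *\<^sub>R x \<in> U) (nhds (0::real))"
    by (metis (no_types, lifting) eventually_mono eventually_nhds_x_imp_x)
  then obtain d where d: "d > 0" "\<And>c. \<bar>c\<bar> < d \<Longrightarrow> c *\<^sub>R x \<in> U"
    unfolding eventually_nhds_metric by auto
  show ?thesis
  proof (intro exI[of _ "2 / d"] conjI allI impI)
    show "2 / d > 0" using d by simp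
    fix t assume t: "2 / d \<le> t"
    then have "t > 0" using d(1) by (smt (verit) divide_pos_pos)
    moreover have "1 / t < d"
    proof -
      have "2 \<le> t * d" using t d(1) by (simp add: pos_divide_le_eq)
      then show ?thesis using \<open>t > 0\<close> by (simp add: pos_divide_less_eq mult.commute)
    qed
    ultimately have "(1 / t) *\<^sub>R x \<in> U" "x = t *\<^sub>R ((1 / t) *\<^sub>R x)" by (simp_all add: d(2))
    then show "x \<in> (*\<^sub>R) t ` U" by blast
  qed
qed

lemma vn_bounded_empty: "vn_bounded {}"
  unfolding vn_bounded_def by (auto intro: exI[of _ 1])

lemma vn_bounded_singleton: "vn_bounded {x :: 'a::locally_convex_space}"
  unfolding vn_bounded_def using lcs_absorbing by auto

lemma vn_bounded_Un:
  assumes "vn_bounded A" "vn_bounded B" shows "vn_bounded (A \<union> B)"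
  unfolding vn_bounded_def
proof (intro allI impI)
  fix U :: "'a set" assume U: "open U" "0 \<in> U"
  obtain s where s: "s > 0" "\<forall>t\<ge>s. A \<subseteq> (*\<^sub>R) t ` U" using assms(1) U unfolding vn_bounded_def by meson
  obtain r where r: "r > 0" "\<forall>t\<ge>r. B \<subseteq> (*\<^sub>R) t ` U" using assms(2) U unfolding vn_bounded_def by meson
  show "\<exists>s>0. \<forall>t\<ge>s. A \<union> B \<subseteq> (*\<^sub>R) t ` U"
    using s r by (intro exI[of _ "max s r"]) auto
qed

typedef (overloaded) 'a strong_dual =
  "{L :: 'a::locally_convex_space \<Rightarrow> real. linear L \<and> continuous_on UNIV L}"
  morphisms pairing Abs_strong_dual
  by (rule exI[of _ "\<lambda>x. 0"]) (auto intro: linear_zero)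

setup_lifting type_definition_strong_dual

instantiation strong_dual :: (locally_convex_space) real_vector
begin

lift_definition zero_strong_dual :: "'a strong_dual" is "\<lambda>x. 0"
  by (auto intro: linear_zero)

lift_definition plus_strong_dual :: "'a strong_dual \<Rightarrow> 'a strong_dual \<Rightarrow> 'a strong_dual" is "\<lambda>L M x. L x + M x"
  by (auto intro!: linear_compose_add continuous_on_add)

lift_definition scaleR_strong_dual :: "real \<Rightarrow> 'a strong_dual \<Rightarrow> 'a strong_dual" is "\<lambda>c L x. c * L x"
  by (auto intro!: continuous_on_mult_left simp: linear_iff algebra_simps)

definition uminus_strong_dual :: "'a strong_dual \<Rightarrow> 'a strong_dual" where
  "uminus_strong_dual L = (-1) *\<^sub>R L"
definition minus_strong_dual :: "'a strong_dual \<Rightarrow> 'a strong_dual \<Rightarrow> 'a strong_dual" where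
  "minus_strong_dual L M = L + (-1) *\<^sub>R M"

instance
  by standard (unfold uminus_strong_dual_def minus_strong_dual_def, (transfer; auto simp: fun_eq_iff algebra_simps)+)

end

lemmas pairing_simps = zero_strong_dual.rep_eq plus_strong_dual.rep_eq scaleR_strong_dual.rep_eq

lemma linear_pairing: "linear (pairing L)" and continuous_pairing: "continuous_on UNIV (pairing L)"
  using pairing[of L] by auto

text \<open>The strong topology, i.e. uniform convergence on bounded sets: polars of bounded sets form a
  neighbourhood base at 0.\<close>

definition polar_nhd :: "'a::locally_convex_space strong_dual set \<Rightarrow> bool" where
  "polar_nhd U \<longleftrightarrow> (\<exists>B. vn_bounded B \<and> U = {L. \<forall>x\<in>B. \<bar>pairing L x\<bar> \<le> 1})"

lemma vn_bounded_scale: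
  assumes "vn_bounded B" "c > 0" shows "vn_bounded ((*\<^sub>R) c ` B)"
  unfolding vn_bounded_def
proof (intro allI impI)
  fix U :: "'a set" assume U: "open U" "0 \<in> U"
  obtain s where s: "s > 0" "\<forall>t\<ge>s. B \<subseteq> (*\<^sub>R) t ` U" using assms(1) U unfolding vn_bounded_def by meson
  have "(*\<^sub>R) c ` B \<subseteq> (*\<^sub>R) t ` U" if t: "t \<ge> c * s" for t
  proof -
    have "s \<le> t / c" using t assms(2) by (simp add: pos_le_divide_eq mult.commute)
    then have "B \<subseteq> (*\<^sub>R) (t / c) ` U" using s(2) by blast
    then have "(*\<^sub>R) c ` B \<subseteq> (*\<^sub>R) c ` (*\<^sub>R) (t / c) ` U" by (rule image_mono)
    then show ?thesis using assms(2) by (simp add: image_image)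
  qed
  then show "\<exists>s>0. \<forall>t\<ge>s. (*\<^sub>R) c ` B \<subseteq> (*\<^sub>R) t ` U"
    using s(1) assms(2) by (intro exI[of _ "c * s"]) simp
qed

lemma strong_dual_eqI: "(\<And>x. pairing L x = pairing M x) \<Longrightarrow> L = M"
  by (metis pairing_inject ext)

lemma pairing_bounded:
  assumes "vn_bounded B" shows "\<exists>C>0. \<forall>x\<in>B. \<bar>pairing L x\<bar> \<le> C"
proof -
  let ?U = "{x. \<bar>pairing L x\<bar> < 1}"
  have lin: "pairing L (c *\<^sub>R x) = c * pairing L x" for c x
    using linear_scale[OF linear_pairing, of L c x] by simp
  have "open ?U"
    by (intro open_Collect_less continuous_on_rabs continuous_pairing continuous_on_const)
  moreover have "0 \<in> ?U" using lin[of 0 0] by simp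
  ultimately obtain s where s: "s > 0" "B \<subseteq> (*\<^sub>R) s ` ?U"
    using assms unfolding vn_bounded_def by (meson order_refl)
  have "\<bar>pairing L x\<bar> \<le> s" if x: "x \<in> B" for x
  proof -
    obtain u where u: "x = s *\<^sub>R u" "\<bar>pairing L u\<bar> < 1" using s(2) x by blast
    then have "\<bar>pairing L x\<bar> = s * \<bar>pairing L u\<bar>" using s(1) by (simp add: lin abs_mult)
    then show ?thesis using u(2) s(1) by (simp add: mult_left_le)
  qed
  then show ?thesis using s(1) by blast
qed

lemma polar_nhdI: "vn_bounded B \<Longrightarrow> polar_nhd {L. \<forall>x\<in>B. \<bar>pairing L x\<bar> \<le> 1}"
  unfolding polar_nhd_def by blast

interpretation strong_dual: lc_base polar_nhd
proof
  show "polar_nhd (UNIV :: 'a strong_dual set)"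
    using polar_nhdI[OF vn_bounded_empty] by simp
next
  fix U V :: "'a strong_dual set" assume "polar_nhd U" "polar_nhd V"
  then obtain A B where A: "vn_bounded A" "U = {L. \<forall>x\<in>A. \<bar>pairing L x\<bar> \<le> 1}"
    and B: "vn_bounded B" "V = {L. \<forall>x\<in>B. \<bar>pairing L x\<bar> \<le> 1}"
    unfolding polar_nhd_def by blast
  then have "U \<inter> V = {L. \<forall>x\<in>A \<union> B. \<bar>pairing L x\<bar> \<le> 1}" by blast
  then show "polar_nhd (U \<inter> V)" using polar_nhdI[OF vn_bounded_Un[OF A(1) B(1)]] by simp
next
  fix U :: "'a strong_dual set" and c :: real assume "polar_nhd U" and c: "c > 0"
  then obtain B where B: "vn_bounded B" "U = {L. \<forall>x\<in>B. \<bar>pairing L x\<bar> \<le> 1}"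
    unfolding polar_nhd_def by blast
  have "{L. c *\<^sub>R L \<in> U} = {L. \<forall>x\<in>(*\<^sub>R) c ` B. \<bar>pairing L x\<bar> \<le> 1}"
    by (simp add: B(2) pairing_simps linear_scale[OF linear_pairing])
  then show "polar_nhd {L. c *\<^sub>R L \<in> U}" using polar_nhdI[OF vn_bounded_scale[OF B(1) c]] by simp
next
  fix U :: "'a strong_dual set" assume "polar_nhd U"
  then obtain B where B: "vn_bounded B" "U = {L. \<forall>x\<in>B. \<bar>pairing L x\<bar> \<le> 1}"
    unfolding polar_nhd_def by blast
  show "convex U"
    unfolding convex_def
  proof (intro ballI allI impI)
    fix L M and u v :: real assume LM: "L \<in> U" "M \<in> U" and uv: "0 \<le> u" "0 \<le> v" "u + v = 1"
    have "\<bar>u * pairing L x + v * pairing M x\<bar> \<le> 1" if "x \<in> B" for x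
    proof -
      have "\<bar>pairing L x\<bar> \<le> 1" "\<bar>pairing M x\<bar> \<le> 1" using LM that B(2) by auto
      then have "u * \<bar>pairing L x\<bar> + v * \<bar>pairing M x\<bar> \<le> u * 1 + v * 1"
        using uv by (intro add_mono mult_left_mono)
      moreover have "\<bar>u * pairing L x + v * pairing M x\<bar> \<le> u * \<bar>pairing L x\<bar> + v * \<bar>pairing M x\<bar>"
        using uv abs_triangle_ineq[of "u * pairing L x" "v * pairing M x"] by (simp add: abs_mult)
      ultimately show ?thesis using uv by simp
    qed
    then show "u *\<^sub>R L + v *\<^sub>R M \<in> U" by (simp add: B(2) pairing_simps)
  qed
  show "balanced U"
    unfolding balanced_def B(2)
    by (simp add: pairing_simps abs_mult mult_le_one)
  fix L
  obtain C where C: "C > 0" "\<forall>x\<in>B. \<bar>pairing L x\<bar> \<le> C" using pairing_bounded[OF B(1)] by blast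
  then have "(1 / C) *\<^sub>R L \<in> U" by (simp add: B(2) pairing_simps abs_mult)
  then show "\<exists>c>0. c *\<^sub>R L \<in> U" using C(1) by (intro exI[of _ "1 / C"]) simp
next
  fix L :: "'a strong_dual" assume "L \<noteq> 0"
  then obtain x where x: "pairing L x \<noteq> 0" using strong_dual_eqI[of L 0] by (auto simp: pairing_simps)
  let ?x = "(2 / pairing L x) *\<^sub>R x"
  have "pairing L ?x = 2" using x linear_scale[OF linear_pairing, of L "2 / pairing L x" x] by simp
  then have "L \<notin> {L. \<forall>x\<in>{?x}. \<bar>pairing L x\<bar> \<le> 1}" by simp
  then show "\<exists>U. polar_nhd U \<and> L \<notin> U" using polar_nhdI[OF vn_bounded_singleton] by blast
qed

instantiation strong_dual :: (locally_convex_space) topological_space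
begin

definition open_strong_dual :: "'a strong_dual set \<Rightarrow> bool" where
  "open_strong_dual = lc_open polar_nhd"

instance
proof (standard, unfold open_strong_dual_def)
qed (fact strong_dual.lc_open_UNIV strong_dual.lc_open_Int strong_dual.lc_open_Union)+

end

interpretation strong_dual: lc_base_topology polar_nhd
  by standard (rule open_strong_dual_def)

instance strong_dual :: (locally_convex_space) locally_convex_space
proof
  fix U :: "'a strong_dual set" and x assume "open U" "x \<in> U"
  from strong_dual.convex_base[OF this]
  show "\<exists>V. open V \<and> x \<in> V \<and> V \<subseteq> U \<and>
      (\<forall>y\<in>V. \<forall>z\<in>V. \<forall>t\<ge>0. \<forall>s\<ge>0. t + s = 1 \<longrightarrow> t *\<^sub>R y + s *\<^sub>R z \<in> V)"
    unfolding convex_def by blast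
qed (fact strong_dual.tendsto_add_nhds strong_dual.tendsto_uminus strong_dual.tendsto_scale strong_dual.separation)+

definition obs_bounded :: "nat \<Rightarrow> ('d::finite config \<Rightarrow> real) set \<Rightarrow> bool" where
  "obs_bounded k B \<longleftrightarrow> B \<subseteq> obs k \<and> (\<forall>n K. compact K \<longrightarrow> K \<noteq> {} \<longrightarrow> (\<exists>C. \<forall>f\<in>B. obs_seminorm k n K f \<le> C))"

lemma direct_sum_nhd_absorbs:
  assumes "vn_bounded B" "direct_sum_nhd U"
  shows "\<exists>t>0. \<forall>F\<in>B. (1 / t) *\<^sub>R F \<in> U"
proof -
  obtain W where W: "open W" "0 \<in> W" "\<forall>y\<in>W. y - 0 \<in> U"
    using direct_sum.lc_nhd[OF assms(2), of 0] unfolding open_hierarchy_def by blast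
  obtain t where t: "t > 0" "B \<subseteq> (*\<^sub>R) t ` W"
    using assms(1) W(1,2) unfolding vn_bounded_def by (meson order_refl)
  have "(1 / t) *\<^sub>R F \<in> U" if F: "F \<in> B" for F
  proof -
    obtain w where w: "w \<in> W" "F = t *\<^sub>R w" using t(2) F by blast
    have "(1 / t) *\<^sub>R F = w" using w(2) t(1) by simp
    then show ?thesis using W(3) w(1) by simp
  qed
  then show ?thesis using t(1) by blast
qed

lemma vn_bounded_incl:
  assumes k: "k \<ge> 1" and B: "obs_bounded k B" shows "vn_bounded (incl k ` B)"
  unfolding vn_bounded_def
proof (intro allI impI)
  fix U :: "'a hierarchy set" assume U: "open U" "0 \<in> U"
  obtain V where V: "direct_sum_nhd V" "\<forall>v\<in>V. 0 + v \<in> U"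
    using U unfolding open_hierarchy_def lc_open_def by meson
  obtain n K e where *: "compact K" "K \<noteq> {}" "0 < e" "\<forall>f\<in>obs k. obs_seminorm k n K f < e \<longrightarrow> incl k f \<in> V"
    using V(1) k unfolding direct_sum_nhd_iff by meson
  obtain C where C: "\<forall>f\<in>B. obs_seminorm k n K f \<le> C" using B * unfolding obs_bounded_def by meson
  show "\<exists>s>0. \<forall>t\<ge>s. incl k ` B \<subseteq> (*\<^sub>R) t ` U"
  proof (intro exI[of _ "(\<bar>C\<bar> + 1) / e"] conjI allI impI subsetI)
    show "0 < (\<bar>C\<bar> + 1) / e" using * by simp
    fix t F assume t: "(\<bar>C\<bar> + 1) / e \<le> t" and "F \<in> incl k ` B"
    then obtain f where f: "f \<in> B" "F = incl k f" by blast
    have fo: "f \<in> obs k" using f B unfolding obs_bounded_def by blast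
    have "t > 0" using t *(3) by (smt (verit) divide_pos_pos)
    have "obs_seminorm k n K (\<lambda>z. (1 / t) * f z) \<le> \<bar>1 / t\<bar> * obs_seminorm k n K f"
      by (rule obs_seminorm_scale[OF fo *(1,2)])
    also have "\<dots> \<le> \<bar>1 / t\<bar> * C" using C f(1) by (intro mult_left_mono) auto
    also have "\<dots> = C / t" using \<open>t > 0\<close> by simp
    also have "\<dots> < e"
    proof -
      have "\<bar>C\<bar> + 1 \<le> t * e" using t *(3) by (simp add: pos_divide_le_eq)
      then have "C < e * t" by (simp add: mult.commute)
      then show ?thesis using \<open>t > 0\<close> by (simp add: pos_divide_less_eq)
    qed
    finally have "incl k (\<lambda>z. (1 / t) * f z) \<in> U" using *(4) V(2) obs_scale[OF fo, of "1 / t"] by simp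
    then have "(1 / t) *\<^sub>R F \<in> U" unfolding f(2) incl_scale[OF k fo] .
    moreover have "F = t *\<^sub>R ((1 / t) *\<^sub>R F)" using \<open>t > 0\<close> by simp
    ultimately show "F \<in> (*\<^sub>R) t ` U" by blast
  qed
qed

lemma vn_bounded_component:
  assumes k: "k \<ge> 1" and B: "vn_bounded B" shows "obs_bounded k ((\<lambda>F. component F k) ` B)"
  unfolding obs_bounded_def
proof (intro conjI allI impI)
  show "(\<lambda>F. component F k) ` B \<subseteq> obs k" using component_obs[OF k] by blast
  fix n and K :: "'a config set" assume K: "compact K" "K \<noteq> {}"
  let ?p = "\<lambda>F. obs_seminorm k n K (component F k)"
  have scale: "?p (c *\<^sub>R F) \<le> \<bar>c\<bar> * ?p F" for c F
    using obs_seminorm_scale[OF component_obs[OF k] K, of n c F] by (simp add: component_simps)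
  have add: "?p (F + G) \<le> ?p F + ?p G" for F G
    using obs_seminorm_add[OF component_obs[OF k] component_obs[OF k] K, of n F G] by (simp add: component_simps)
  have pos: "?p F \<ge> 0" for F
  proof -
    obtain z where "z \<in> K" using K by blast
    have "\<bar>foldr partial [] (component F k) z\<bar> \<le> ?p F"
      by (rule obs_seminorm_upper[OF component_obs[OF k] K(1)]) (use \<open>z \<in> K\<close> in simp_all)
    then show ?thesis by simp
  qed
  let ?U = "{F. ?p F < 1}"
  have "convex ?U"
    unfolding convex_def
  proof (intro ballI allI impI)
    fix F G and u v :: real assume FG: "F \<in> ?U" "G \<in> ?U" and uv: "0 \<le> u" "0 \<le> v" "u + v = 1"
    have "?p (u *\<^sub>R F + v *\<^sub>R G) \<le> u * ?p F + v * ?p G"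
      using add[of "u *\<^sub>R F" "v *\<^sub>R G"] scale[of u F] scale[of v G] uv by simp
    also have "\<dots> < 1" using FG uv by (intro convex_bound_lt) simp_all
    finally show "u *\<^sub>R F + v *\<^sub>R G \<in> ?U" by simp
  qed
  moreover have "balanced ?U"
    unfolding balanced_def
  proof (intro allI impI)
    fix c :: real and F assume "\<bar>c\<bar> \<le> 1" "F \<in> ?U"
    then have "\<bar>c\<bar> * ?p F < 1" using mult_left_le_one_le[OF pos[of F], of "\<bar>c\<bar>"] by simp
    then show "c *\<^sub>R F \<in> ?U" using scale[of c F] by simp
  qed
  moreover have "\<exists>n K e. compact K \<and> K \<noteq> {} \<and> 0 < e \<and>
      (\<forall>f\<in>obs j. obs_seminorm j n K f < e \<longrightarrow> incl j f \<in> ?U)" if j: "j \<ge> 1" for j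
    using K j by (intro exI[of _ n] exI[of _ K] exI[of _ "1::real"]) (simp add: component_incl obs_seminorm_0)
  ultimately have "direct_sum_nhd ?U" unfolding direct_sum_nhd_iff by blast
  from direct_sum_nhd_absorbs[OF B this]
  obtain t where t: "t > 0" "\<forall>F\<in>B. ?p ((1 / t) *\<^sub>R F) < 1" by blast
  have "?p F \<le> t" if F: "F \<in> B" for F
  proof -
    have "?p (t *\<^sub>R ((1 / t) *\<^sub>R F)) \<le> t * ?p ((1 / t) *\<^sub>R F)" using scale[of t "(1 / t) *\<^sub>R F"] t(1) by simp
    also have "\<dots> \<le> t * 1" using t F by (intro mult_left_mono) (simp_all add: less_imp_le)
    finally show ?thesis using t(1) by simp
  qed
  then show "\<exists>C. \<forall>f\<in>(\<lambda>F. component F k) ` B. obs_seminorm k n K f \<le> C" by blast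
qed

lemma vn_bounded_supp:
  assumes B: "vn_bounded B" shows "finite (\<Union>F\<in>B. supp F)"
proof (rule ccontr)
  assume "infinite (\<Union>F\<in>B. supp F)"
  define I where "I = (\<Union>F\<in>B. supp F)"
  have inf: "infinite I" using \<open>infinite _\<close> by (simp add: I_def)
  have I_pos: "k \<ge> 1" if "k \<in> I" for k using that supp_pos by (auto simp only: I_def)
  have "\<forall>k\<in>I. \<exists>F z. F \<in> B \<and> component F k z \<noteq> 0" by (auto simp: I_def supp_def fun_eq_iff)
  then obtain F z where Fz: "\<And>k. k \<in> I \<Longrightarrow> F k \<in> B \<and> component (F k) k (z k) \<noteq> 0" by metis
  define a where "a k = \<bar>component (F k) k (z k)\<bar> / real k" for k
  have a: "a k > 0" if k: "k \<in> I" for k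
  proof -
    have "k \<ge> 1" using k by (rule I_pos)
    then show ?thesis using Fz[OF k] by (simp add: a_def)
  qed
  let ?U = "{G. \<forall>k\<in>I. \<bar>component G k (z k)\<bar> \<le> a k}"
  have "convex ?U"
    unfolding convex_def
  proof (intro ballI allI impI CollectI)
    fix G H and u v :: real and k
    assume GH: "G \<in> ?U" "H \<in> ?U" and uv: "0 \<le> u" "0 \<le> v" "u + v = 1" and k: "k \<in> I"
    let ?g = "component G k (z k)" and ?h = "component H k (z k)"
    have "\<bar>u * ?g + v * ?h\<bar> \<le> u * \<bar>?g\<bar> + v * \<bar>?h\<bar>"
      using uv abs_triangle_ineq[of "u * ?g" "v * ?h"] by (simp add: abs_mult)
    also have "\<dots> \<le> a k" using GH k uv by (intro convex_bound_le) simp_all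
    finally show "\<bar>component (u *\<^sub>R G + v *\<^sub>R H) k (z k)\<bar> \<le> a k" by (simp add: component_simps)
  qed
  moreover have "balanced ?U"
    unfolding balanced_def
  proof (intro allI impI CollectI ballI)
    fix c :: real and G k assume c: "\<bar>c\<bar> \<le> 1" and G: "G \<in> ?U" and k: "k \<in> I"
    have "\<bar>c\<bar> * \<bar>component G k (z k)\<bar> \<le> \<bar>component G k (z k)\<bar>" using c by (intro mult_left_le_one_le) simp_all
    also have "\<dots> \<le> a k" using G k by blast
    finally show "\<bar>component (c *\<^sub>R G) k (z k)\<bar> \<le> a k" by (simp add: component_simps abs_mult)
  qed
  moreover have "\<exists>n K e. compact K \<and> K \<noteq> {} \<and> 0 < e \<and>
      (\<forall>f\<in>obs j. obs_seminorm j n K f < e \<longrightarrow> incl j f \<in> ?U)" if j: "j \<ge> 1" for j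
  proof (intro exI[of _ "0::nat"] exI[of _ "{z j}"] exI[of _ "if j \<in> I then a j else 1"] conjI ballI impI CollectI)
    show "(if j \<in> I then a j else 1) > 0" using a[of j] by simp
    fix f k assume f: "f \<in> obs j" "obs_seminorm j 0 {z j} f < (if j \<in> I then a j else 1)" and k: "k \<in> I"
    have "\<bar>foldr partial [] f (z j)\<bar> \<le> obs_seminorm j 0 {z j} f"
      by (rule obs_seminorm_upper[OF f(1)]) simp_all
    then have "\<bar>f (z k)\<bar> \<le> a k" if "j = k" using that f(2) k by simp
    then show "\<bar>component (incl j f) k (z k)\<bar> \<le> a k"
      using a[OF k] by (auto simp: component_incl[OF j f(1)])
  qed simp_all
  ultimately have "direct_sum_nhd ?U" unfolding direct_sum_nhd_iff by blast
  from direct_sum_nhd_absorbs[OF B this]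
  obtain t where t: "t > 0" "\<forall>F\<in>B. (1 / t) *\<^sub>R F \<in> ?U" by blast
  obtain k where k: "k \<in> I" "k > nat \<lceil>t\<rceil>" using inf by (meson infinite_nat_iff_unbounded)
  then have tk: "t < real k" by linarith
  have "(1 / t) *\<^sub>R F k \<in> ?U" using t(2) Fz[OF k(1)] by blast
  then have "\<bar>component ((1 / t) *\<^sub>R F k) k (z k)\<bar> \<le> a k" using k(1) by blast
  then have "\<bar>component (F k) k (z k)\<bar> / t \<le> \<bar>component (F k) k (z k)\<bar> / real k"
    using t(1) by (simp add: component_simps a_def abs_mult)
  moreover have "\<bar>component (F k) k (z k)\<bar> / real k < \<bar>component (F k) k (z k)\<bar> / t"
    using Fz[OF k(1)] tk t(1) by (intro divide_strict_left_mono) simp_all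
  ultimately show False by simp
qed

lemma pairing_expand: "pairing \<Gamma> F = (\<Sum>k\<in>supp F. pairing \<Gamma> (incl k (component F k)))"
proof -
  have "pairing \<Gamma> (\<Sum>k\<in>supp F. incl k (component F k)) = (\<Sum>k\<in>supp F. pairing \<Gamma> (incl k (component F k)))"
    by (rule linear_sum[OF linear_pairing])
  then show ?thesis using hierarchy_expand[of F] by metis
qed

lemma obs_bounded_scale:
  assumes "obs_bounded k B" shows "obs_bounded k ((\<lambda>f z. c * f z) ` B)"
  unfolding obs_bounded_def
proof (intro conjI allI impI)
  show "(\<lambda>f z. c * f z) ` B \<subseteq> obs k" using assms obs_scale unfolding obs_bounded_def by blast
  fix n and K :: "'a config set" assume K: "compact K" "K \<noteq> {}"
  obtain C where C: "\<forall>f\<in>B. obs_seminorm k n K f \<le> C" using assms K unfolding obs_bounded_def by meson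
  have "obs_seminorm k n K (\<lambda>z. c * f z) \<le> \<bar>c\<bar> * C" if f: "f \<in> B" for f
  proof -
    have "f \<in> obs k" using f assms unfolding obs_bounded_def by blast
    from obs_seminorm_scale[OF this K, of n c]
    have "obs_seminorm k n K (\<lambda>z. c * f z) \<le> \<bar>c\<bar> * obs_seminorm k n K f" .
    also have "\<dots> \<le> \<bar>c\<bar> * C" using C f by (intro mult_left_mono) simp_all
    finally show ?thesis .
  qed
  then show "\<exists>C. \<forall>f\<in>(\<lambda>f z. c * f z) ` B. obs_seminorm k n K f \<le> C"
    by (intro exI[of _ "\<bar>c\<bar> * C"]) simp
qed

text \<open>The next two results identify the strong dual of the direct sum with the product over \<open>k \<ge> 1\<close> of
  the strong duals of the spaces \<^term>\<open>obs k\<close>, carrying the product topology.\<close>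

theorem open_strong_dual_hierarchy_iff:
  fixes W :: "'d::finite hierarchy strong_dual set"
  shows "open W \<longleftrightarrow> (\<forall>\<Gamma>\<in>W. \<exists>S B. finite S \<and> S \<subseteq> {1..} \<and> (\<forall>k\<in>S. obs_bounded k (B k)) \<and>
     (\<forall>\<Delta>. (\<forall>k\<in>S. \<forall>f\<in>B k. \<bar>pairing \<Delta> (incl k f) - pairing \<Gamma> (incl k f)\<bar> \<le> 1) \<longrightarrow> \<Delta> \<in> W))"
    (is "_ \<longleftrightarrow> (\<forall>\<Gamma>\<in>W. ?P \<Gamma>)")
proof -
  have diff: "pairing (L - M) F = pairing L F - pairing M F" for L M :: "'d hierarchy strong_dual" and F
    unfolding minus_strong_dual_def pairing_simps by simp
  have "(\<exists>U. polar_nhd U \<and> (\<forall>u\<in>U. \<Gamma> + u \<in> W)) \<longleftrightarrow> ?P \<Gamma>" for \<Gamma>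
  proof
    assume "\<exists>U. polar_nhd U \<and> (\<forall>u\<in>U. \<Gamma> + u \<in> W)"
    then obtain B where B: "vn_bounded B" "\<And>L. \<forall>F\<in>B. \<bar>pairing L F\<bar> \<le> 1 \<Longrightarrow> \<Gamma> + L \<in> W"
      unfolding polar_nhd_def by blast
    define S where "S = (\<Union>F\<in>B. supp F)"
    have S: "finite S" "S \<subseteq> {1..}" using vn_bounded_supp[OF B(1)] supp_pos by (auto simp: S_def)
    define C where "C k = (\<lambda>f z. real (card S) * f z) ` (\<lambda>F. component F k) ` B" for k :: nat
    have "obs_bounded k (C k)" if "k \<in> S" for k
      unfolding C_def using that S(2) by (intro obs_bounded_scale vn_bounded_component B(1)) auto
    moreover have "\<Delta> \<in> W"
      if close: "\<forall>k\<in>S. \<forall>f\<in>C k. \<bar>pairing \<Delta> (incl k f) - pairing \<Gamma> (incl k f)\<bar> \<le> 1" for \<Delta>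
    proof -
      have "\<bar>pairing (\<Delta> - \<Gamma>) F\<bar> \<le> 1" if F: "F \<in> B" for F
      proof (cases "supp F = {}")
        case True
        then show ?thesis by (subst pairing_expand) simp
      next
        case False
        have sub: "supp F \<subseteq> S" using F by (auto simp: S_def)
        then have card: "card S > 0" using False S(1) by (auto simp: card_gt_0_iff)
        have "\<bar>pairing (\<Delta> - \<Gamma>) (incl k (component F k))\<bar> \<le> 1 / real (card S)" if k: "k \<in> supp F" for k
        proof -
          have ko: "k \<ge> 1" "component F k \<in> obs k" using k supp_pos component_obs by blast+
          have "(\<lambda>z. real (card S) * component F k z) \<in> C k" using F by (auto simp: C_def)
          then have "\<bar>pairing (\<Delta> - \<Gamma>) (incl k (\<lambda>z. real (card S) * component F k z))\<bar> \<le> 1"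
            using close sub k unfolding diff by blast
          then have "real (card S) * \<bar>pairing (\<Delta> - \<Gamma>) (incl k (component F k))\<bar> \<le> 1"
            by (simp add: incl_scale[OF ko] linear_scale[OF linear_pairing] abs_mult)
          then show ?thesis using card by (simp add: pos_le_divide_eq mult.commute)
        qed
        then have "(\<Sum>k\<in>supp F. \<bar>pairing (\<Delta> - \<Gamma>) (incl k (component F k))\<bar>) \<le> (\<Sum>k\<in>supp F. 1 / real (card S))"
          by (rule sum_mono)
        also have "\<dots> \<le> 1" using card card_mono[OF S(1) sub] by simp
        finally show ?thesis
          by (subst pairing_expand) (rule order_trans[OF sum_abs])
      qed
      then have "\<Gamma> + (\<Delta> - \<Gamma>) \<in> W" by (intro B(2)) blast
      then show ?thesis by simp
    qed
    ultimately show "?P \<Gamma>" using S by (intro exI[of _ S] exI[of _ C]) blast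
  next
    assume "?P \<Gamma>"
    then obtain S B where S: "finite S" "S \<subseteq> {1..}" "\<forall>k\<in>S. obs_bounded k (B k)"
      and W: "\<And>\<Delta>. \<forall>k\<in>S. \<forall>f\<in>B k. \<bar>pairing \<Delta> (incl k f) - pairing \<Gamma> (incl k f)\<bar> \<le> 1 \<Longrightarrow> \<Delta> \<in> W"
      by blast
    have "vn_bounded (\<Union>k\<in>A. incl k ` B k)" if "finite A" "A \<subseteq> S" for A
      using that
    proof (induction A rule: finite_induct)
      case empty
      then show ?case by (simp add: vn_bounded_empty)
    next
      case (insert k A)
      then have "vn_bounded (incl k ` B k)" using S by (intro vn_bounded_incl) auto
      then show ?case using insert by (simp add: vn_bounded_Un)
    qed
    then have "polar_nhd {L. \<forall>F\<in>(\<Union>k\<in>S. incl k ` B k). \<bar>pairing L F\<bar> \<le> 1}"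
      using S(1) by (intro polar_nhdI) simp
    moreover have "\<Gamma> + L \<in> W" if "\<forall>F\<in>(\<Union>k\<in>S. incl k ` B k). \<bar>pairing L F\<bar> \<le> 1" for L
      using that by (intro W) (simp add: pairing_simps)
    ultimately show "\<exists>U. polar_nhd U \<and> (\<forall>u\<in>U. \<Gamma> + u \<in> W)" by blast
  qed
  then show ?thesis unfolding open_strong_dual_def lc_open_def by simp
qed

theorem strong_dual_hierarchy_product:
  fixes L :: "nat \<Rightarrow> ('d::finite config \<Rightarrow> real) \<Rightarrow> real"
  assumes add: "\<And>k f g. k \<ge> 1 \<Longrightarrow> f \<in> obs k \<Longrightarrow> g \<in> obs k \<Longrightarrow> L k (\<lambda>z. f z + g z) = L k f + L k g"
    and scale: "\<And>k c f. k \<ge> 1 \<Longrightarrow> f \<in> obs k \<Longrightarrow> L k (\<lambda>z. c * f z) = c * L k f"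
    and cont: "\<And>k. k \<ge> 1 \<Longrightarrow> continuous_map (obs_topology k) euclideanreal (L k)"
  shows "\<exists>!\<Gamma>. \<forall>k\<ge>1. \<forall>f\<in>obs k. pairing \<Gamma> (incl k f) = L k f"
proof
  let ?M = "\<lambda>F. \<Sum>k\<in>supp F. L k (component F k)"
  have L0: "L k (\<lambda>z. 0) = 0" if "k \<ge> 1" for k using scale[OF that obs_0, of 0] by simp
  have M: "?M F = (\<Sum>k\<in>A. L k (component F k))" if "finite A" "supp F \<subseteq> A" "A \<subseteq> {1..}" for F A
  proof (rule sum.mono_neutral_left[OF that(1,2)], rule ballI)
    fix k assume "k \<in> A - supp F"
    then have "component F k = (\<lambda>z. 0)" "k \<ge> 1" using that(3) by (auto simp: supp_def)
    then show "L k (component F k) = 0" using L0 by simp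
  qed
  have lin: "linear ?M"
  proof (rule linearI)
    fix F G :: "'d hierarchy" and c :: real
    let ?A = "supp F \<union> supp G"
    have A: "finite ?A" "?A \<subseteq> {1..}" using finite_supp supp_pos by auto
    have comp: "component (F + G) k = (\<lambda>z. component F k z + component G k z)" for k
      by (simp add: component_simps)
    have "supp (F + G) \<subseteq> ?A" by (auto simp: supp_def comp)
    then have "?M (F + G) = (\<Sum>k\<in>?A. L k (component (F + G) k))" by (rule M[OF A(1) _ A(2)])
    also have "\<dots> = (\<Sum>k\<in>?A. L k (component F k) + L k (component G k))"
      unfolding comp using A(2) by (intro sum.cong refl add component_obs) auto
    also have "\<dots> = ?M F + ?M G"
      using M[of ?A F] M[of ?A G] A by (simp add: sum.distrib)
    finally show "?M (F + G) = ?M F + ?M G" .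
    have comp: "component (c *\<^sub>R F) k = (\<lambda>z. c * component F k z)" for k
      by (simp add: component_simps)
    have "supp (c *\<^sub>R F) \<subseteq> supp F" by (auto simp: supp_def comp)
    then have "?M (c *\<^sub>R F) = (\<Sum>k\<in>supp F. L k (component (c *\<^sub>R F) k))"
      by (rule M[OF finite_supp]) (use supp_pos in auto)
    also have "\<dots> = (\<Sum>k\<in>supp F. c * L k (component F k))"
      unfolding comp using supp_pos by (intro sum.cong refl scale component_obs) blast+
    finally show "?M (c *\<^sub>R F) = c *\<^sub>R ?M F" by (simp add: sum_distrib_left)
  qed
  have incl: "?M (incl k f) = L k f" if k: "k \<ge> 1" and f: "f \<in> obs k" for k f
  proof -
    have "supp (incl k f) \<subseteq> {k}" by (auto simp: supp_def component_incl[OF k f] split: if_splits)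
    then have "?M (incl k f) = (\<Sum>j\<in>{k}. L j (component (incl k f) j))" using k by (intro M) auto
    then show ?thesis by (simp add: component_incl[OF k f])
  qed
  have "continuous_on UNIV ?M"
    unfolding continuous_on_open_invariant
  proof (intro allI impI exI conjI)
    fix V :: "real set" assume V: "open V"
    show "?M -` V \<inter> UNIV = ?M -` V \<inter> UNIV" ..
    show "open (?M -` V)"
      unfolding open_hierarchy_def lc_open_def
    proof
      fix F assume "F \<in> ?M -` V"
      then obtain e where e: "e > 0" "\<And>y. \<bar>y - ?M F\<bar> < e \<Longrightarrow> y \<in> V"
        using V unfolding open_dist dist_real_def by blast
      let ?U = "{G. \<bar>?M G\<bar> < e}"
      have "convex (?M -` ball 0 e)" by (rule convex_linear_vimage[OF lin convex_ball])
      then have "convex ?U" by (simp add: vimage_def dist_real_def)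
      moreover have "balanced ?U"
        unfolding balanced_def
      proof (intro allI impI CollectI)
        fix c :: real and G assume "\<bar>c\<bar> \<le> 1" "G \<in> ?U"
        then show "\<bar>?M (c *\<^sub>R G)\<bar> < e"
          using mult_left_le_one_le[of "\<bar>?M G\<bar>" "\<bar>c\<bar>"] by (simp only: linear_scale[OF lin]) (simp add: abs_mult)
      qed
      moreover have "\<exists>W. openin (obs_topology k) W \<and> (\<lambda>z. 0) \<in> W \<and> incl k ` W \<subseteq> ?U" if k: "k \<ge> 1" for k
      proof -
        let ?W = "{f \<in> topspace (obs_topology k). L k f \<in> ball 0 e}"
        have W: "openin (obs_topology k) ?W"
          using cont[OF k] by (rule openin_continuous_map_preimage) simp
        have 0: "(\<lambda>z. 0) \<in> topspace (obs_topology k)"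
        proof -
          have "(\<lambda>z. 0) \<in> obs_ball k 0 {\<lambda>i. 0} (\<lambda>z. 0) 1"
            by (simp add: obs_ball_def obs_0 obs_seminorm_0)
          moreover have "openin (obs_topology k) (obs_ball k 0 {\<lambda>i. 0} (\<lambda>z. 0) 1)"
            by (rule obs_ball_open[OF obs_0]) simp_all
          ultimately show ?thesis using openin_subset by blast
        qed
        have "incl k f \<in> ?U" if f: "f \<in> ?W" for f
        proof -
          have "f \<in> obs k" using openin_obs_topologyD[OF W f] by blast
          then show ?thesis using f incl[OF k] by (simp add: dist_real_def)
        qed
        then show ?thesis using W 0 L0[OF k] e(1) by (intro exI[of _ ?W]) auto
      qed
      ultimately have "direct_sum_nhd ?U" unfolding direct_sum_nhd_def by blast
      moreover have "F + G \<in> ?M -` V" if "G \<in> ?U" for G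
        using that e(2)[of "?M (F + G)"] linear_add[OF lin, of F G] by simp
      ultimately show "\<exists>U. direct_sum_nhd U \<and> (\<forall>G\<in>U. F + G \<in> ?M -` V)" by blast
    qed
  qed
  then have "pairing (Abs_strong_dual ?M) = ?M" using lin by (simp add: Abs_strong_dual_inverse)
  then show "\<forall>k\<ge>1. \<forall>f\<in>obs k. pairing (Abs_strong_dual ?M) (incl k f) = L k f" using incl by simp
next
  fix \<Gamma> assume G: "\<forall>k\<ge>1. \<forall>f\<in>obs k. pairing \<Gamma> (incl k f) = L k f"
  have P: "pairing \<Gamma> F = (\<Sum>k\<in>supp F. L k (component F k))" for F
  proof -
    have "(\<Sum>k\<in>supp F. pairing \<Gamma> (incl k (component F k))) = (\<Sum>k\<in>supp F. L k (component F k))"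
    proof (rule sum.cong[OF refl])
      fix k assume "k \<in> supp F"
      then have k: "k \<ge> 1" by (rule supp_pos)
      show "pairing \<Gamma> (incl k (component F k)) = L k (component F k)"
        by (rule G[rule_format, OF k component_obs[OF k]])
    qed
    then show ?thesis using pairing_expand[of \<Gamma> F] by simp
  qed
  show "\<Gamma> = Abs_strong_dual (\<lambda>F. \<Sum>k\<in>supp F. L k (component F k))"
    unfolding P[symmetric] by (simp add: pairing_inverse)
qed

text \<open>\<open>gateaux n f x v\<close> is the iterated directional derivative of order \<open>n\<close> at \<open>x\<close> in the directions
  \<open>v 0, \<dots>, v (n - 1)\<close>; it ignores the other entries of \<open>v\<close>, so its joint continuity for the product
  topology on sequences of directions is joint continuity in \<open>x\<close> and these \<open>n\<close> directions.\<close>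

primrec gateaux :: "nat \<Rightarrow> ('a::locally_convex_space \<Rightarrow> 'b::locally_convex_space) \<Rightarrow> 'a \<Rightarrow> (nat \<Rightarrow> 'a) \<Rightarrow> 'b" where
  "gateaux 0 f x v = f x"
| "gateaux (Suc n) f x v =
     Lim (at (0::real)) (\<lambda>t. (1 / t) *\<^sub>R (gateaux n f (x + t *\<^sub>R v n) v - gateaux n f x v))"

definition gateaux_smooth :: "('a::locally_convex_space \<Rightarrow> 'b::locally_convex_space) \<Rightarrow> bool" where
  "gateaux_smooth f \<longleftrightarrow> (\<forall>n.
     (\<forall>x v. \<exists>l. ((\<lambda>t. (1 / t) *\<^sub>R (gateaux n f (x + t *\<^sub>R v n) v - gateaux n f x v)) \<longlongrightarrow> l) (at (0::real))) \<and>
     continuous_on UNIV (\<lambda>(x, v). gateaux n f x v))"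

definition gateaux_deriv :: "('a::locally_convex_space \<Rightarrow> real) \<Rightarrow> 'a \<Rightarrow> 'a \<Rightarrow> real" where
  "gateaux_deriv f x v = gateaux 1 f x (\<lambda>_. v)"

definition function_subalgebra :: "('a \<Rightarrow> real) set \<Rightarrow> bool" where
  "function_subalgebra A \<longleftrightarrow>
     (\<lambda>x. 0) \<in> A \<and>
     (\<forall>f\<in>A. \<forall>c. (\<lambda>x. c * f x) \<in> A) \<and>
     (\<forall>f\<in>A. \<forall>g\<in>A. (\<lambda>x. f x + g x) \<in> A \<and> (\<lambda>x. f x * g x) \<in> A)"

definition weak_poisson_vector_space ::
  "('a::locally_convex_space \<Rightarrow> real) set \<Rightarrow> (('a \<Rightarrow> real) \<Rightarrow> ('a \<Rightarrow> real) \<Rightarrow> ('a \<Rightarrow> real)) \<Rightarrow> bool" where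
  "weak_poisson_vector_space A br \<longleftrightarrow>
     A \<subseteq> {f. gateaux_smooth f} \<and> function_subalgebra A \<and> (\<lambda>x. 1) \<in> A \<and>
     (\<forall>f\<in>A. \<forall>g\<in>A. br f g \<in> A) \<and>
     (\<forall>f\<in>A. \<forall>g\<in>A. \<forall>h\<in>A. \<forall>a b.
        br (\<lambda>x. a * f x + b * g x) h = (\<lambda>x. a * br f h x + b * br g h x) \<and>
        br h (\<lambda>x. a * f x + b * g x) = (\<lambda>x. a * br h f x + b * br h g x)) \<and>
     (\<forall>f\<in>A. \<forall>g\<in>A. br f g = (\<lambda>x. - br g f x)) \<and>
     (\<forall>f\<in>A. \<forall>g\<in>A. \<forall>h\<in>A. \<forall>x. br f (br g h) x + br g (br h f) x + br h (br f g) x = 0) \<and>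
     (\<forall>f\<in>A. \<forall>g\<in>A. \<forall>h\<in>A. br f (\<lambda>x. g x * h x) = (\<lambda>x. h x * br f g x + g x * br f h x)) \<and>
     (\<forall>x v. (\<forall>f\<in>A. gateaux_deriv f x v = 0) \<longrightarrow> v = 0) \<and>
     (\<forall>f\<in>A. \<exists>X. gateaux_smooth X \<and> (\<forall>g\<in>A. \<forall>x. gateaux_deriv g x (X x) = br g f x))"

definition grad_x1 :: "('d::finite config \<Rightarrow> real) \<Rightarrow> 'd config \<Rightarrow> real^'d" where
  "grad_x1 f z = (\<chi> a. partial (1, (axis a 1, 0)) f z)"

definition grad_v1 :: "('d::finite config \<Rightarrow> real) \<Rightarrow> 'd config \<Rightarrow> real^'d" where
  "grad_v1 f z = (\<chi> a. partial (1, (0, axis a 1)) f z)"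

text \<open>For \<open>z = (z 1, \<dots>, z k)\<close> this is the configuration \<open>(z 1, z (l + 1), \<dots>, z k)\<close>.\<close>

definition skip_block :: "nat \<Rightarrow> 'd::finite config \<Rightarrow> 'd config" where
  "skip_block l z = (\<lambda>i. if i = 1 then z 1 else z (l + i - 1))"

definition wedge1 ::
  "nat \<Rightarrow> nat \<Rightarrow> ('d::finite config \<Rightarrow> real) \<Rightarrow> ('d config \<Rightarrow> real) \<Rightarrow> 'd config \<Rightarrow> real" where
  "wedge1 l j f g z = real (l * j) *
     (grad_x1 f z \<bullet> grad_v1 g (skip_block l z) - grad_x1 g z \<bullet> grad_v1 f (skip_block j z))"

definition symmetrize :: "nat \<Rightarrow> ('d::finite config \<Rightarrow> real) \<Rightarrow> 'd config \<Rightarrow> real" where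
  "symmetrize k h z = (1 / fact k) * (\<Sum>\<pi> | \<pi> permutes {1..k}. h (\<lambda>i. z (\<pi> i)))"

definition hierarchy_bracket :: "'d::finite hierarchy \<Rightarrow> 'd hierarchy \<Rightarrow> 'd hierarchy" where
  "hierarchy_bracket F G = Abs_hierarchy (\<lambda>k z.
     \<Sum>(l, j) | 1 \<le> l \<and> 1 \<le> j \<and> l + j - 1 = k.
       symmetrize k (wedge1 l j (component F l) (component G j)) z)"

text \<open>The derivative at \<open>\<Gamma>\<close> is a continuous linear functional on the strong dual. As the direct sum is
  reflexive, it is the evaluation at an element of the direct sum; that element is unique because
  the dual separates points.\<close>

definition gradient :: "('d::finite hierarchy strong_dual \<Rightarrow> real) \<Rightarrow> 'd hierarchy strong_dual \<Rightarrow> 'd hierarchy" where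
  "gradient \<F> \<Gamma> = (THE F. \<forall>\<Delta>. gateaux_deriv \<F> \<Gamma> \<Delta> = pairing \<Delta> F)"

definition poisson_bracket ::
  "('d::finite hierarchy strong_dual \<Rightarrow> real) \<Rightarrow> ('d hierarchy strong_dual \<Rightarrow> real) \<Rightarrow>
   'd hierarchy strong_dual \<Rightarrow> real" where
  "poisson_bracket \<F> \<G> \<Gamma> = pairing \<Gamma> (hierarchy_bracket (gradient \<F> \<Gamma>) (gradient \<G> \<Gamma>))"

definition A_inf :: "('d::finite hierarchy strong_dual \<Rightarrow> real) set" where
  "A_inf = function_subalgebra hull (range (\<lambda>F \<Gamma>. pairing \<Gamma> F) \<union> range (\<lambda>c \<Gamma>. c))"

end

theory Submission
  imports Defs
begin

text \<open>The Jacobi identity of the Lie bracket is transported from classical mechanics. For a finite set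
  \<open>A\<close> of labels, send \<open>F\<close> to the function
  \<open>z \<mapsto> (\<Sum>k. \<Sum>m : {1..k} \<rightarrow> A. F k (z (m 1), \<dots>, z (m k)))\<close> on phase space configurations. Because all maps
  \<open>m\<close> are allowed, not only the injective ones, the bracket of the direct sum becomes exactly the
  canonical Poisson bracket of the particles in \<open>A\<close>, for which Jacobi is the symmetry of second
  derivatives. An \<open>F\<close> whose image vanishes for every \<open>A\<close> is 0: the surjective \<open>m\<close> also sum to 0, and
  if \<open>A = {1..K}\<close> with \<open>K\<close> the top degree, this sum is \<open>K!\<close> times the component of degree \<open>K\<close>.

  A functional in the algebra has a gradient that is a polynomial combination of fixed elements
  \<open>F\<close>, so its Hamiltonian vector field is the same combination of the maps dual to \<open>G \<mapsto> [G, F]\<close>.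
  These maps are continuous because \<open>[f, g]\<close> with \<open>g\<close> fixed is a differential operator in \<open>f\<close>. The
  bracket is a biderivation, so Jacobi for all functionals follows from the linear ones.\<close>

subsection \<open>Calculus on configurations\<close>

text \<open>Smoothness on configurations is given only through iterated partial derivatives and
  their continuity. Derivatives there are taken along coordinate shifts, and the chain rule and the
  symmetry of second derivatives come from the mean value theorem. The obstacle is that a map m may
  repeat labels: moving one particle then moves several arguments of F k at once. In return,
  repetition makes the transfer exact. A derivative with respect to particle p pins one argument at
  p, so the canonical bracket multiplies two sums over tuples that share the entry p. Gluing two
  such tuples gives a tuple of length l + j - 1, but two injective tuples may collide in their
  remaining entries, so injective tuples are not closed under gluing. Checking Jacobi on the
  components directly would have to track nested symmetrizations instead. One class of differential
  operators with relabelled arguments, closed under differentiation, yields both the smoothness of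
  bracket components and the continuity of the bracket in one argument.\<close>

lemma shift_0 [simp]: "shift a 0 z = z"
  by (simp add: shift_def)

lemma shift_shift: "shift a s (shift a t z) = shift a (t + s) z"
  by (auto simp: shift_def scaleR_add_left)

lemma shift_commute: "shift a s (shift b t z) = shift b t (shift a s z)"
  by (auto simp: shift_def fun_eq_iff)

lemma continuous_on_shift [continuous_intros]:
  assumes "continuous_on S f" "continuous_on S g"
  shows "continuous_on S (\<lambda>x. shift a (f x) (g x))"
  unfolding shift_def fun_upd_def
proof (rule continuous_on_coordinatewise_then_product)
  fix i
  have "continuous_on S (\<lambda>x. g x j)" for j
    using assms(2) by (rule continuous_on_product_then_coordinatewise)
  then show "continuous_on S (\<lambda>x. if i = fst a then g x (fst a) + f x *\<^sub>R snd a else g x i)"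
    using assms(1) by (cases "i = fst a") (auto intro!: continuous_intros)
qed

lemma tendsto_shift:
  assumes "(f \<longlongrightarrow> s) F" "(g \<longlongrightarrow> w) F"
  shows "((\<lambda>x. shift a (f x) (g x)) \<longlongrightarrow> shift a s w) F"
proof -
  have "continuous_on UNIV (\<lambda>p. shift a (fst p) (snd p))"
    by (intro continuous_intros)
  then have "isCont (\<lambda>p. shift a (fst p) (snd p)) (s, w)"
    by (simp add: continuous_on_eq_continuous_at)
  from isCont_tendsto_compose[OF this tendsto_Pair[OF assms]] show ?thesis by simp
qed

lemma smooth_continuous: "smooth k f \<Longrightarrow> continuous_on UNIV f"
  using smoothD1[of k f "[]"] by simp

lemma smooth_has_partial:
  assumes "smooth k f" "a \<in> coords k"
  shows "((\<lambda>t. f (shift a t z)) has_real_derivative partial a f z) (at 0)"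
  using smoothD3[OF assms(1) _ assms(2), of "[]"] by simp

lemma smooth_foldr_partial:
  fixes f :: "'d::finite config \<Rightarrow> real"
  assumes "smooth k f" "bs \<in> lists (coords k)" shows "smooth k (foldr partial bs f)"
  unfolding smooth_def
proof (intro ballI conjI allI)
  fix as :: "(nat \<times> 'd phase) list" assume as: "as \<in> lists (coords k)"
  have eq: "foldr partial as (foldr partial bs f) = foldr partial (as @ bs) f" by simp
  have "as @ bs \<in> lists (coords k)" using as assms(2) by simp
  note * = smoothD1[OF assms(1) this] smoothD2[OF assms(1) this]
  show "continuous_on UNIV (foldr partial as (foldr partial bs f))" unfolding eq by (rule *)
  fix a :: "nat \<times> 'd phase" and z assume "a \<in> coords k"
  then show "(\<lambda>t. foldr partial as (foldr partial bs f) (shift a t z)) differentiable at 0"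
    unfolding eq by (rule *)
qed

lemma smooth_partial: "smooth k f \<Longrightarrow> a \<in> coords k \<Longrightarrow> smooth k (partial a f)"
  using smooth_foldr_partial[of k f "[a]"] by simp

text \<open>A class closed under partial derivatives contains all iterated ones, by induction on the
  multi-index. The derivative enters as a witness \<open>g'\<close>, since \<open>partial\<close> is
  built on the total function \<open>deriv\<close> and alone does not give
  differentiability.\<close>

lemma smooth_coinduct:
  fixes f :: "'d::finite config \<Rightarrow> real"
  assumes "P f" and cont: "\<And>g. P g \<Longrightarrow> continuous_on UNIV g"
    and deriv: "\<And>g a. P g \<Longrightarrow> a \<in> coords k \<Longrightarrow>
      \<exists>g'. P g' \<and> (\<forall>z. ((\<lambda>t. g (shift a t z)) has_real_derivative g' z) (at 0))"
  shows "smooth k f"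
proof -
  have partial: "P (partial a g)" if g: "P g" "a \<in> coords k" for a and g :: "'d config \<Rightarrow> real"
  proof -
    obtain g' where g': "P g'" "\<forall>z. ((\<lambda>t. g (shift a t z)) has_real_derivative g' z) (at 0)"
      using deriv[OF g] by blast
    then have "partial a g = g'"
      by (auto simp: partial_def fun_eq_iff intro!: DERIV_imp_deriv)
    then show ?thesis using g'(1) by simp
  qed
  have P: "P (foldr partial as f)" if "as \<in> lists (coords k)" for as
    using that by (induction as) (auto intro: assms(1) partial)
  show ?thesis
    unfolding smooth_def
  proof (intro ballI conjI allI)
    fix as :: "(nat \<times> 'd phase) list" assume "as \<in> lists (coords k)"
    note Pas = P[OF this]
    show "continuous_on UNIV (foldr partial as f)" by (rule cont[OF Pas])
    fix a :: "nat \<times> 'd phase" and z assume "a \<in> coords k"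
    then show "(\<lambda>t. foldr partial as f (shift a t z)) differentiable at 0"
      using deriv[OF Pas, of a] unfolding real_differentiable_def by blast
  qed
qed

lemma smooth_const: "smooth k (\<lambda>z. c)"
proof (rule smooth_coinduct[where P = "\<lambda>g. \<exists>c. g = (\<lambda>z. c)"])
  fix g :: "'a config \<Rightarrow> real" assume "\<exists>c. g = (\<lambda>z. c)"
  then obtain c where g: "g = (\<lambda>z. c)" by blast
  show "continuous_on UNIV g" by (simp add: g)
  show "\<exists>g'. (\<exists>c. g' = (\<lambda>z. c)) \<and> (\<forall>z. ((\<lambda>t. g (shift a t z)) has_real_derivative g' z) (at 0))" for a
    by (rule exI[of _ "\<lambda>z. 0"]) (auto simp: g)
qed blast

section \<open>Mean value theorem and chain rule along coordinate shifts\<close>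

lemma has_partial_shift:
  assumes "\<And>w. ((\<lambda>t. f (shift a t w)) has_real_derivative g w) (at 0)"
  shows "((\<lambda>t. f (shift a t z)) has_real_derivative g (shift a s z)) (at s)"
  using assms[of "shift a s z"] by (simp add: shift_shift DERIV_shift[of _ _ 0 s, simplified] add.commute)

lemma smooth_has_partial_at:
  assumes "smooth k f" "a \<in> coords k"
  shows "((\<lambda>t. f (shift a t z)) has_real_derivative partial a f (shift a s z)) (at s)"
  by (rule has_partial_shift) (rule smooth_has_partial[OF assms])

text \<open>The bound on \<open>\<xi>\<close> is weak so that \<open>h = 0\<close> is covered too,
  which lets \<open>\<xi>\<close> be chosen as a function of every increment.\<close>

lemma MVT_two_sided:
  fixes f :: "real \<Rightarrow> real"
  assumes "\<And>x. (f has_real_derivative f' x) (at x)"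
  shows "\<exists>\<xi>. \<bar>\<xi>\<bar> \<le> \<bar>h\<bar> \<and> f h - f 0 = h * f' \<xi>"
proof (cases h "0::real" rule: linorder_cases)
  case less
  then obtain \<xi> where "h < \<xi>" "\<xi> < 0" "f 0 - f h = (0 - h) * f' \<xi>"
    using MVT2[of h 0 f f'] assms by blast
  then show ?thesis by (intro exI[of _ \<xi>]) (auto simp: algebra_simps)
next
  case equal
  then show ?thesis by auto
next
  case greater
  then obtain \<xi> where "0 < \<xi>" "\<xi> < h" "f h - f 0 = (h - 0) * f' \<xi>"
    using MVT2[of 0 h f f'] assms by blast
  then show ?thesis by (intro exI[of _ \<xi>]) auto
qed

text \<open>The increment of f along the shifted curve splits into a pure shift from
  \<open>\<gamma> t\<close> and the increment along \<open>\<gamma>\<close>. The mean value theorem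
  turns the first into t times a value of g near \<open>\<gamma> 0\<close>, and continuity of g
  gives the limit. Along \<open>\<gamma>\<close> just the derivative of the composite is assumed, so
  coordinates can be added one at a time.\<close>

lemma has_derivative_shift_curve:
  assumes part: "\<And>w. ((\<lambda>t. f (shift a t w)) has_real_derivative g w) (at 0)"
    and g: "continuous_on UNIV g"
    and \<gamma>: "(\<gamma> \<longlongrightarrow> \<gamma> 0) (at 0)"
    and D: "((\<lambda>t. f (\<gamma> t)) has_real_derivative D) (at 0)"
  shows "((\<lambda>t. f (shift a t (\<gamma> t))) has_real_derivative g (\<gamma> 0) + D) (at 0)"
proof -
  have "\<exists>\<xi>. \<bar>\<xi>\<bar> \<le> \<bar>t\<bar> \<and> f (shift a t (\<gamma> t)) - f (shift a 0 (\<gamma> t)) = t * g (shift a \<xi> (\<gamma> t))" for t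
    by (rule MVT_two_sided) (rule has_partial_shift[OF part])
  then obtain \<xi> where \<xi>: "\<And>t. \<bar>\<xi> t\<bar> \<le> \<bar>t\<bar>"
      "\<And>t. f (shift a t (\<gamma> t)) - f (\<gamma> t) = t * g (shift a (\<xi> t) (\<gamma> t))"
    by (simp, metis)
  have "(\<xi> \<longlongrightarrow> 0) (at 0)"
    by (rule Lim_null_comparison[of _ "\<lambda>t. \<bar>t\<bar>"])
      (use \<xi>(1) in \<open>auto intro!: tendsto_eq_intros always_eventually\<close>)
  from tendsto_shift[OF this \<gamma>, of a]
  have "((\<lambda>t. g (shift a (\<xi> t) (\<gamma> t))) \<longlongrightarrow> g (\<gamma> 0)) (at 0)"
    using g isCont_tendsto_compose by (fastforce simp: continuous_on_eq_continuous_at)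
  moreover have "((\<lambda>t. (f (\<gamma> t) - f (\<gamma> 0)) / t) \<longlongrightarrow> D) (at 0)"
    using D by (simp add: DERIV_def)
  ultimately have "((\<lambda>t. g (shift a (\<xi> t) (\<gamma> t)) + (f (\<gamma> t) - f (\<gamma> 0)) / t) \<longlongrightarrow> g (\<gamma> 0) + D) (at 0)"
    by (rule tendsto_add)
  moreover have "\<forall>\<^sub>F t in at 0. g (shift a (\<xi> t) (\<gamma> t)) + (f (\<gamma> t) - f (\<gamma> 0)) / t
      = (f (shift a t (\<gamma> t)) - f (\<gamma> 0)) / t"
    unfolding eventually_at_filter
  proof (intro always_eventually allI impI)
    fix t :: real assume "t \<noteq> 0"
    then have "g (shift a (\<xi> t) (\<gamma> t)) = (f (shift a t (\<gamma> t)) - f (\<gamma> t)) / t" using \<xi>(2)[of t] by simp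
    then show "g (shift a (\<xi> t) (\<gamma> t)) + (f (\<gamma> t) - f (\<gamma> 0)) / t = (f (shift a t (\<gamma> t)) - f (\<gamma> 0)) / t"
      by (simp add: diff_divide_distrib)
  qed
  ultimately have "((\<lambda>t. (f (shift a t (\<gamma> t)) - f (\<gamma> 0)) / t) \<longlongrightarrow> g (\<gamma> 0) + D) (at 0)"
    by (rule Lim_transform_eventually)
  then show ?thesis by (simp add: DERIV_def)
qed

lemma tendsto_componentwise_fun:
  assumes "\<And>i. ((\<lambda>x. f x i) \<longlongrightarrow> l i) F" shows "(f \<longlongrightarrow> (l :: nat \<Rightarrow> 'a::topological_space)) F"
  using assms limitin_componentwise[of "\<lambda>_. euclidean" UNIV f l F]
  by (simp add: euclidean_product_topology)

text \<open>Partial derivatives of elements of \<^term>\<open>obs k\<close> are no longer symmetric, so a class without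
  symmetry is needed.\<close>

definition smooth_pts :: "nat \<Rightarrow> ('d::finite config \<Rightarrow> real) \<Rightarrow> bool" where
  "smooth_pts k f \<longleftrightarrow> smooth k f \<and> (\<forall>z w. (\<forall>i\<in>{1..k}. z i = w i) \<longrightarrow> f z = f w)"

lemma smooth_pts_smooth: "smooth_pts k f \<Longrightarrow> smooth k f"
  by (simp add: smooth_pts_def)

lemma smooth_pts_cong: "smooth_pts k f \<Longrightarrow> (\<And>i. i \<in> {1..k} \<Longrightarrow> z i = w i) \<Longrightarrow> f z = f w"
  unfolding smooth_pts_def by blast

lemma obs_smooth_pts: "f \<in> obs k \<Longrightarrow> smooth_pts k f"
  by (auto simp: obs_def smooth_pts_def)

lemma smooth_pts_partial:
  assumes "smooth_pts k f" "a \<in> coords k" shows "smooth_pts k (partial a f)"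
  unfolding smooth_pts_def
proof (intro conjI allI impI)
  show "smooth k (partial a f)" using assms by (simp add: smooth_pts_smooth smooth_partial)
  fix z w :: "'a config" assume zw: "\<forall>i\<in>{1..k}. z i = w i"
  have "f (shift a t z) = f (shift a t w)" for t
    by (rule smooth_pts_cong[OF assms(1)]) (use zw assms(2) in \<open>auto simp: shift_def coords_def\<close>)
  then show "partial a f z = partial a f w" by (simp add: partial_def)
qed

lemma smooth_pts_foldr_partial:
  "smooth_pts k f \<Longrightarrow> bs \<in> lists (coords k) \<Longrightarrow> smooth_pts k (foldr partial bs f)"
  by (induction bs) (auto intro: smooth_pts_partial)

text \<open>Moving the point \<open>p\<close> moves every argument whose label under
  \<open>\<tau>\<close> is \<open>p\<close>. These arguments are released one by one, each by
  \<open>has_derivative_shift_curve\<close>.\<close>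

lemma has_derivative_shift_relabel:
  fixes f :: "'d::finite config \<Rightarrow> real"
  assumes f: "smooth_pts k f" and e: "e \<in> Basis"
  shows "((\<lambda>t. f (\<lambda>i. shift (p, e) t z (\<tau> i))) has_real_derivative
    (\<Sum>q | q \<in> {1..k} \<and> \<tau> q = p. partial (q, e) f (\<lambda>i. z (\<tau> i)))) (at 0)"
proof -
  define w where "w = (\<lambda>i. z (\<tau> i))"
  \<comment> \<open>\<open>\<gamma> Q\<close> moves just the arguments in \<open>Q\<close>; adding
    \<open>q\<close> to \<open>Q\<close> composes it with one shift of the slot
    \<open>q\<close>.\<close>
  define \<gamma> where "\<gamma> Q t = (\<lambda>i. if i \<in> Q then w i + t *\<^sub>R e else w i)" for Q :: "nat set" and t :: real
  have \<gamma>0: "\<gamma> Q 0 = w" for Q by (simp add: \<gamma>_def fun_eq_iff)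
  have "((\<lambda>t. f (\<gamma> Q t)) has_real_derivative (\<Sum>q\<in>Q. partial (q, e) f w)) (at 0)"
    if "finite Q" "Q \<subseteq> {1..k}" for Q
    using that
  proof (induction Q rule: finite_induct)
    case empty
    then show ?case by (simp add: \<gamma>_def)
  next
    case (insert q Q)
    have a: "(q, e) \<in> coords k" using insert.prems e by (simp add: coords_def)
    have \<gamma>: "shift (q, e) t (\<gamma> Q t) = \<gamma> (insert q Q) t" for t
      using insert.hyps by (auto simp: shift_def \<gamma>_def fun_eq_iff)
    have "((\<lambda>t. f (shift (q, e) t (\<gamma> Q t))) has_real_derivative
        partial (q, e) f (\<gamma> Q 0) + (\<Sum>q\<in>Q. partial (q, e) f w)) (at 0)"
    proof (rule has_derivative_shift_curve)
      show "((\<lambda>t. f (shift (q, e) t w)) has_real_derivative partial (q, e) f w) (at 0)" for w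
        by (rule smooth_has_partial[OF smooth_pts_smooth[OF f] a])
      show "continuous_on UNIV (partial (q, e) f)"
        by (rule smooth_continuous[OF smooth_partial[OF smooth_pts_smooth[OF f] a]])
      show "(\<gamma> Q \<longlongrightarrow> \<gamma> Q 0) (at 0)"
      proof (rule tendsto_componentwise_fun)
        show "((\<lambda>t. \<gamma> Q t i) \<longlongrightarrow> \<gamma> Q 0 i) (at 0)" for i
          by (cases "i \<in> Q") (auto simp: \<gamma>_def intro!: tendsto_eq_intros)
      qed
      show "((\<lambda>t. f (\<gamma> Q t)) has_real_derivative (\<Sum>q\<in>Q. partial (q, e) f w)) (at 0)"
        using insert by simp
    qed
    then show ?case using insert.hyps by (simp add: \<gamma> \<gamma>0)
  qed
  moreover have "finite {q. q \<in> {1..k} \<and> \<tau> q = p}" "{q. q \<in> {1..k} \<and> \<tau> q = p} \<subseteq> {1..k}" by auto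
  ultimately have "((\<lambda>t. f (\<gamma> {q. q \<in> {1..k} \<and> \<tau> q = p} t)) has_real_derivative
      (\<Sum>q | q \<in> {1..k} \<and> \<tau> q = p. partial (q, e) f w)) (at 0)" by blast
  \<comment> \<open>Outside \<open>{1..k}\<close> the two configurations may differ, but f does not
    see those entries.\<close>
  moreover have "f (\<gamma> {q. q \<in> {1..k} \<and> \<tau> q = p} t) = f (\<lambda>i. shift (p, e) t z (\<tau> i))" for t
    by (rule smooth_pts_cong[OF f]) (auto simp: \<gamma>_def w_def shift_def)
  ultimately show ?thesis by (simp add: w_def)
qed

text \<open>The mean value theorem, used once in direction \<open>a\<close> and once in direction
  \<open>b\<close>, writes the second difference as h^2 times the mixed derivative at a nearby
  point. The second difference is symmetric in \<open>a\<close> and \<open>b\<close>, which forces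
  the two mixed derivatives to agree.\<close>

lemma second_difference_tendsto:
  assumes f: "smooth k f" and a: "a \<in> coords k" and b: "b \<in> coords k"
  shows "((\<lambda>h. (f (shift a h (shift b h z)) - f (shift a h z) - f (shift b h z) + f z) / h\<^sup>2)
    \<longlongrightarrow> partial b (partial a f) z) (at 0)"
proof -
  let ?g = "partial a f" and ?h = "partial b (partial a f)"
  have g: "smooth k ?g" by (rule smooth_partial[OF f a])
  let ?D = "\<lambda>h. f (shift a h (shift b h z)) - f (shift a h z) - f (shift b h z) + f z"
  have "\<exists>\<xi> \<eta>. \<bar>\<xi>\<bar> \<le> \<bar>h\<bar> \<and> \<bar>\<eta>\<bar> \<le> \<bar>h\<bar> \<and> ?D h = h * (h * ?h (shift b \<eta> (shift a \<xi> z)))" for h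
  proof -
    have "((\<lambda>s. f (shift a s (shift b h z)) - f (shift a s z)) has_real_derivative
       ?g (shift a s (shift b h z)) - ?g (shift a s z)) (at s)" for s
      by (rule DERIV_diff[OF smooth_has_partial_at[OF f a] smooth_has_partial_at[OF f a]])
    from MVT_two_sided[OF this, of h] obtain \<xi> where \<xi>: "\<bar>\<xi>\<bar> \<le> \<bar>h\<bar>"
      "f (shift a h (shift b h z)) - f (shift a h z) - (f (shift a 0 (shift b h z)) - f (shift a 0 z))
        = h * (?g (shift a \<xi> (shift b h z)) - ?g (shift a \<xi> z))"
      by blast
    have D: "?D h = h * (?g (shift a \<xi> (shift b h z)) - ?g (shift a \<xi> z))"
      using \<xi>(2) by simp
    have "((\<lambda>s. ?g (shift b s (shift a \<xi> z))) has_real_derivative ?h (shift b s (shift a \<xi> z))) (at s)" for s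
      by (rule smooth_has_partial_at[OF g b])
    from MVT_two_sided[OF this, of h] obtain \<eta> where \<eta>: "\<bar>\<eta>\<bar> \<le> \<bar>h\<bar>"
      "?g (shift b h (shift a \<xi> z)) - ?g (shift b 0 (shift a \<xi> z)) = h * ?h (shift b \<eta> (shift a \<xi> z))"
      by blast
    have "?D h = h * (h * ?h (shift b \<eta> (shift a \<xi> z)))"
      unfolding D shift_commute[of a \<xi> b h] using \<eta>(2) by simp
    then show ?thesis using \<xi>(1) \<eta>(1) by blast
  qed
  then obtain \<xi> \<eta> where *: "\<And>h. \<bar>\<xi> h\<bar> \<le> \<bar>h\<bar>" "\<And>h. \<bar>\<eta> h\<bar> \<le> \<bar>h\<bar>"
      "\<And>h. ?D h = h * (h * ?h (shift b (\<eta> h) (shift a (\<xi> h) z)))"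
    by metis
  have "(\<xi> \<longlongrightarrow> 0) (at 0)" "(\<eta> \<longlongrightarrow> 0) (at 0)"
    by (rule Lim_null_comparison[of _ "\<lambda>t. \<bar>t\<bar>"];
      use *(1,2) in \<open>auto intro!: tendsto_eq_intros always_eventually\<close>)+
  then have "((\<lambda>h. shift b (\<eta> h) (shift a (\<xi> h) z)) \<longlongrightarrow> shift b 0 (shift a 0 z)) (at 0)"
    by (intro tendsto_shift tendsto_const)
  moreover have "continuous_on UNIV ?h"
    by (rule smooth_continuous[OF smooth_partial[OF g b]])
  ultimately have "((\<lambda>h. ?h (shift b (\<eta> h) (shift a (\<xi> h) z))) \<longlongrightarrow> ?h z) (at 0)"
    using isCont_tendsto_compose by (fastforce simp: continuous_on_eq_continuous_at)
  moreover have "\<forall>\<^sub>F h in at 0. ?h (shift b (\<eta> h) (shift a (\<xi> h) z)) = ?D h / h\<^sup>2"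
    unfolding eventually_at_filter
    by (intro always_eventually allI impI) (subst *(3), simp add: power2_eq_square)
  ultimately show ?thesis by (rule Lim_transform_eventually)
qed

lemma partial_commute:
  assumes "smooth k f" "a \<in> coords k" "b \<in> coords k"
  shows "partial a (partial b f) z = partial b (partial a f) z"
proof (rule tendsto_unique[OF _ second_difference_tendsto[OF assms(1,3,2), of z]])
  have eq: "f (shift b h (shift a h z)) - f (shift b h z) - f (shift a h z) + f z =
    f (shift a h (shift b h z)) - f (shift a h z) - f (shift b h z) + f z" for h
    by (simp add: shift_commute[of a _ b])
  show "((\<lambda>h. (f (shift b h (shift a h z)) - f (shift b h z) - f (shift a h z) + f z) / h\<^sup>2)
    \<longlongrightarrow> partial b (partial a f) z) (at 0)"
    unfolding eq by (rule second_difference_tendsto[OF assms])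
qed simp

subsection \<open>Differential operators and their seminorm estimates\<close>

lemma continuous_on_relabel:
  assumes "continuous_on UNIV (f :: (nat \<Rightarrow> 'a::topological_space) \<Rightarrow> real)"
  shows "continuous_on UNIV (\<lambda>z. f (\<lambda>i. z (\<tau> i)))"
  by (rule continuous_on_compose2[OF assms]) (auto intro!: continuous_on_coordinatewise_then_product)

text \<open>Relabellings \<open>\<tau>\<close> belong to the class because symmetrization and
  \<open>skip_block\<close> evaluate derivatives at rearranged points. The operators act on
  functions of k points, and their coefficients are smooth in m points.\<close>

inductive diff_op :: "nat \<Rightarrow> nat \<Rightarrow> (('d::finite config \<Rightarrow> real) \<Rightarrow> 'd config \<Rightarrow> real) \<Rightarrow> bool" for k m where
  diff_op_zero: "diff_op k m (\<lambda>f z. 0)"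
| diff_op_term: "smooth m c \<Longrightarrow> bs \<in> lists (coords k) \<Longrightarrow>
    diff_op k m (\<lambda>f z. c z * foldr partial bs f (\<lambda>i. z (\<tau> i)))"
| diff_op_add: "diff_op k m L \<Longrightarrow> diff_op k m M \<Longrightarrow> diff_op k m (\<lambda>f z. L f z + M f z)"

lemma diff_op_sum:
  "(\<And>x. x \<in> A \<Longrightarrow> diff_op k m (L x)) \<Longrightarrow> diff_op k m (\<lambda>f z. \<Sum>x\<in>A. L x f z)"
proof (induction A rule: infinite_finite_induct)
  case (insert x A)
  then have "diff_op k m (\<lambda>f z. L x f z + (\<Sum>x\<in>A. L x f z))" by (intro diff_op_add) simp_all
  then show ?case using insert.hyps by simp
qed (simp_all add: diff_op_zero)

lemma diff_op_continuous:
  assumes "diff_op k m L" "smooth_pts k f" shows "continuous_on UNIV (L f)"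
  using assms(1)
proof induction
  case (diff_op_term c bs \<tau>)
  have "continuous_on UNIV (foldr partial bs f)"
    by (rule smooth_continuous[OF smooth_foldr_partial[OF smooth_pts_smooth[OF assms(2)] diff_op_term(2)]])
  from continuous_on_mult[OF smooth_continuous[OF diff_op_term(1)] continuous_on_relabel[OF this]]
  show ?case .
qed (simp_all add: continuous_on_add)

text \<open>Product rule and chain rule. The operator \<open>L'\<close> is chosen before f:
  iteration then stays within operators, and the later bounds are uniform in f.\<close>

lemma diff_op_deriv:
  fixes L :: "('d::finite config \<Rightarrow> real) \<Rightarrow> 'd config \<Rightarrow> real"
  assumes "diff_op k m L" and a: "a \<in> coords m"
  shows "\<exists>L'. diff_op k m L' \<and>
    (\<forall>f z. smooth_pts k f \<longrightarrow> ((\<lambda>t. L f (shift a t z)) has_real_derivative L' f z) (at 0))"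
  using assms(1)
proof induction
  case diff_op_zero
  then show ?case by (intro exI[of _ "\<lambda>f z. 0"]) (simp add: diff_op.diff_op_zero)
next
  case (diff_op_term c bs \<tau>)
  obtain p e where a_eq: "a = (p, e)" by (cases a)
  then have e: "e \<in> Basis" using a by (simp add: coords_def)
  let ?Q = "{q. q \<in> {1..k} \<and> \<tau> q = p}"
  let ?L' = "\<lambda>f z. partial a c z * foldr partial bs f (\<lambda>i. z (\<tau> i))
    + (\<Sum>q\<in>?Q. c z * foldr partial ((q, e) # bs) f (\<lambda>i. z (\<tau> i)))"
  have "diff_op k m ?L'"
    using diff_op_term e
    by (intro diff_op_add diff_op_sum diff_op.diff_op_term smooth_partial[OF _ a]) (auto simp: coords_def)
  moreover have "((\<lambda>t. c (shift a t z) * foldr partial bs f (\<lambda>i. shift a t z (\<tau> i)))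
      has_real_derivative ?L' f z) (at 0)" if f: "smooth_pts k f" for f z
  proof -
    have 1: "((\<lambda>t. c (shift a t z)) has_real_derivative partial a c z) (at 0)"
      by (rule smooth_has_partial[OF diff_op_term(1) a])
    have 2: "((\<lambda>t. foldr partial bs f (\<lambda>i. shift a t z (\<tau> i))) has_real_derivative
      (\<Sum>q\<in>?Q. partial (q, e) (foldr partial bs f) (\<lambda>i. z (\<tau> i)))) (at 0)"
      unfolding a_eq by (rule has_derivative_shift_relabel[OF smooth_pts_foldr_partial[OF f diff_op_term(2)] e])
    show ?thesis using DERIV_mult[OF 1 2] by (simp add: sum_distrib_left mult.commute)
  qed
  ultimately show ?case by blast
next
  case (diff_op_add L M)
  then obtain L' M' where "diff_op k m L'" "diff_op k m M'"
    "\<And>f z. smooth_pts k f \<Longrightarrow> ((\<lambda>t. L f (shift a t z)) has_real_derivative L' f z) (at 0)"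
    "\<And>f z. smooth_pts k f \<Longrightarrow> ((\<lambda>t. M f (shift a t z)) has_real_derivative M' f z) (at 0)"
    by blast
  then show ?case
    by (intro exI[of _ "\<lambda>f z. L' f z + M' f z"]) (auto intro: diff_op.diff_op_add DERIV_add)
qed

text \<open>With f fixed, the functions \<open>L f\<close> for all differential operators
  \<open>L\<close> form a class closed under partial derivatives, so \<open>smooth_coinduct\<close>
  applies.\<close>

lemma diff_op_smooth:
  fixes f :: "'d::finite config \<Rightarrow> real"
  assumes "diff_op k m L" "smooth_pts k f" shows "smooth m (L f)"
proof (rule smooth_coinduct[where P = "\<lambda>g. \<exists>L. diff_op k m L \<and> g = L f"])
  show "continuous_on UNIV g" if "\<exists>L. diff_op k m L \<and> g = L f" for g
    using that assms(2) by (auto intro: diff_op_continuous)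
  fix g and a :: "nat \<times> 'd phase" assume "\<exists>L. diff_op k m L \<and> g = L f" and a: "a \<in> coords m"
  then obtain M where M: "diff_op k m M" "g = M f" by blast
  from diff_op_deriv[OF M(1) a] obtain M' where "diff_op k m M'"
    "\<forall>f z. smooth_pts k f \<longrightarrow> ((\<lambda>t. M f (shift a t z)) has_real_derivative M' f z) (at 0)" by blast
  then show "\<exists>g'. (\<exists>L. diff_op k m L \<and> g' = L f) \<and>
      (\<forall>z. ((\<lambda>t. g (shift a t z)) has_real_derivative g' z) (at 0))"
    using assms(2) by (intro exI[of _ "M' f"]) (auto simp: M(2))
qed (use assms(1) in blast)

lemma smooth_relabel:
  assumes "smooth_pts k f" shows "smooth m (\<lambda>z. f (\<lambda>i. z (\<tau> i)))"
  using diff_op_smooth[OF diff_op_term[OF smooth_const[of m 1], of "[]" k \<tau>] assms] by simp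

lemma diff_op_foldr_partial:
  fixes L :: "('d::finite config \<Rightarrow> real) \<Rightarrow> 'd config \<Rightarrow> real"
  assumes "diff_op k m L" "as \<in> lists (coords m)"
  shows "\<exists>L'. diff_op k m L' \<and> (\<forall>f. smooth_pts k f \<longrightarrow> foldr partial as (L f) = L' f)"
  using assms(2)
proof (induction as)
  case Nil
  then show ?case using assms(1) by auto
next
  case (Cons a as)
  then obtain L1 where L1: "diff_op k m L1" "\<forall>f. smooth_pts k f \<longrightarrow> foldr partial as (L f) = L1 f" by blast
  obtain L2 where L2: "diff_op k m L2"
    "\<forall>f z. smooth_pts k f \<longrightarrow> ((\<lambda>t. L1 f (shift a t z)) has_real_derivative L2 f z) (at 0)"
    using diff_op_deriv[OF L1(1) Cons.hyps(1)] by blast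
  have "foldr partial (a # as) (L f) = L2 f" if "smooth_pts k f" for f
    using L1(2) L2(2) that by (auto simp: partial_def[of a] fun_eq_iff intro!: DERIV_imp_deriv)
  then show ?case using L2(1) by blast
qed

section \<open>Seminorm estimates\<close>

lemma obs_seminorm_nonneg:
  assumes "f \<in> obs k" "compact K" "K \<noteq> {}" shows "0 \<le> obs_seminorm k n K f"
proof -
  obtain z where "z \<in> K" using assms(3) by blast
  then have "\<bar>foldr partial [] f z\<bar> \<le> obs_seminorm k n K f"
    by (intro obs_seminorm_upper assms) simp_all
  then show ?thesis by (meson abs_ge_zero order_trans)
qed

text \<open>The set \<open>A\<close> may hold points, or pairs of a multi-index and a point; the
  latter turn the bound into one for the supremum that defines \<open>obs_seminorm\<close>.\<close>

definition seminorm_bounded ::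
  "nat \<Rightarrow> (('d::finite config \<Rightarrow> real) \<Rightarrow> 'a \<Rightarrow> real) \<Rightarrow> 'a set \<Rightarrow> bool" where
  "seminorm_bounded k L A \<longleftrightarrow> (\<exists>n K C. compact K \<and> K \<noteq> {} \<and> 0 \<le> C \<and>
     (\<forall>f\<in>obs k. \<forall>x\<in>A. \<bar>L f x\<bar> \<le> C * obs_seminorm k n K f))"

text \<open>The assumption on \<open>N\<close> speaks of bounds alone, so it covers a sum of two
  operators on one set and also one family on a union of two index sets. The compact sets are
  united, the orders maximized and the constants added.\<close>

lemma seminorm_bounded_combine:
  fixes L :: "('d::finite config \<Rightarrow> real) \<Rightarrow> 'a \<Rightarrow> real"
  assumes "seminorm_bounded k L A" "seminorm_bounded k M B"
    and N: "\<And>f x a b. f \<in> obs k \<Longrightarrow> x \<in> D \<Longrightarrow> 0 \<le> a \<Longrightarrow> 0 \<le> b \<Longrightarrow>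
      (\<forall>x\<in>A. \<bar>L f x\<bar> \<le> a) \<Longrightarrow> (\<forall>x\<in>B. \<bar>M f x\<bar> \<le> b) \<Longrightarrow> \<bar>N f x\<bar> \<le> a + b"
  shows "seminorm_bounded k N D"
proof -
  obtain n K C where 1: "compact K" "K \<noteq> {}" "0 \<le> C"
      "\<forall>f\<in>obs k. \<forall>x\<in>A. \<bar>L f x\<bar> \<le> C * obs_seminorm k n K f"
    using assms(1) unfolding seminorm_bounded_def by blast
  obtain n' K' C' where 2: "compact K'" "K' \<noteq> {}" "0 \<le> C'"
      "\<forall>f\<in>obs k. \<forall>x\<in>B. \<bar>M f x\<bar> \<le> C' * obs_seminorm k n' K' f"
    using assms(2) unfolding seminorm_bounded_def by blast
  let ?K = "K \<union> K'" and ?n = "max n n'"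
  have K: "compact ?K" "?K \<noteq> {}" using 1 2 by (auto intro: compact_Un)
  have "\<bar>N f x\<bar> \<le> (C + C') * obs_seminorm k ?n ?K f" if f: "f \<in> obs k" and x: "x \<in> D" for f x
  proof -
    have le: "C * obs_seminorm k n K f \<le> C * obs_seminorm k ?n ?K f"
        "C' * obs_seminorm k n' K' f \<le> C' * obs_seminorm k ?n ?K f"
      using 1 2 K f by (auto intro!: mult_left_mono obs_seminorm_mono)
    have nn: "0 \<le> C * obs_seminorm k ?n ?K f" "0 \<le> C' * obs_seminorm k ?n ?K f"
      using 1 2 K f by (auto intro!: mult_nonneg_nonneg obs_seminorm_nonneg)
    have "\<bar>N f x\<bar> \<le> C * obs_seminorm k ?n ?K f + C' * obs_seminorm k ?n ?K f"
      using N[OF f x nn] 1(4) 2(4) f le order_trans by blast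
    then show ?thesis by (simp add: distrib_right)
  qed
  then show ?thesis unfolding seminorm_bounded_def
    using K 1(3) 2(3) by (intro exI[of _ ?n] exI[of _ ?K] exI[of _ "C + C'"]) auto
qed

lemma seminorm_bounded_zero: "seminorm_bounded k (\<lambda>f z. 0) (A :: 'a set)"
  unfolding seminorm_bounded_def
  by (intro exI[of _ 0] exI[of _ "{\<lambda>i. 0}"] exI[of _ "0::real"]) auto

text \<open>On a compact set the coefficient is bounded, and a relabelling, being continuous, sends
  the set to a compact one.\<close>

lemma diff_op_seminorm_bounded:
  fixes L :: "('d::finite config \<Rightarrow> real) \<Rightarrow> 'd config \<Rightarrow> real"
  assumes "diff_op k m L" and K: "compact K" "K \<noteq> {}"
  shows "seminorm_bounded k L K"
  using assms(1)
proof induction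
  case diff_op_zero
  then show ?case by (rule seminorm_bounded_zero)
next
  case (diff_op_term c bs \<tau>)
  let ?r = "\<lambda>z :: 'd config. \<lambda>i. z (\<tau> i)"
  have "continuous_on K c" using smooth_continuous[OF diff_op_term(1)] continuous_on_subset by blast
  then have "bounded (c ` K)" using K by (intro compact_imp_bounded compact_continuous_image)
  then obtain C where C: "\<And>z. z \<in> K \<Longrightarrow> \<bar>c z\<bar> \<le> C" unfolding bounded_iff by auto
  obtain z0 where "z0 \<in> K" using K(2) by blast
  then have C0: "0 \<le> C" using C[of z0] by linarith
  have rK: "compact (?r ` K)" "?r ` K \<noteq> {}"
    using K by (auto intro!: compact_continuous_image continuous_on_coordinatewise_then_product
        intro: continuous_on_subset[OF continuous_on_product_coordinates])
  show ?case
    unfolding seminorm_bounded_def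
  proof (intro exI conjI ballI)
    show "compact (?r ` K)" "?r ` K \<noteq> {}" "0 \<le> C" by fact+
    fix f :: "'d config \<Rightarrow> real" and z assume f: "f \<in> obs k" and z: "z \<in> K"
    have "\<bar>foldr partial bs f (?r z)\<bar> \<le> obs_seminorm k (length bs) (?r ` K) f"
      by (rule obs_seminorm_upper[OF f rK(1) diff_op_term(2)]) (use z in auto)
    then show "\<bar>c z * foldr partial bs f (?r z)\<bar> \<le> C * obs_seminorm k (length bs) (?r ` K) f"
      unfolding abs_mult using C[OF z] C0 by (intro mult_mono) auto
  qed
next
  case (diff_op_add L M)
  show ?case
    by (rule seminorm_bounded_combine[OF diff_op_add.IH]) (meson abs_triangle_ineq add_mono order_trans)
qed

text \<open>Only finitely many multi-indices have length at most n, and each derivative of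
  \<open>L f\<close> is again a differential operator applied to f. Their bounds are merged one
  multi-index at a time.\<close>

lemma diff_op_obs_seminorm:
  fixes L :: "('d::finite config \<Rightarrow> real) \<Rightarrow> 'd config \<Rightarrow> real"
  assumes L: "diff_op k m L" and K: "compact K" "K \<noteq> {}"
  shows "\<exists>n' K' C. compact K' \<and> K' \<noteq> {} \<and> 0 \<le> C \<and>
    (\<forall>f\<in>obs k. obs_seminorm m n K (L f) \<le> C * obs_seminorm k n' K' f)"
proof -
  let ?T = "{as. set as \<subseteq> coords m \<and> length as \<le> n} :: (nat \<times> 'd phase) list set"
  have "finite ?T" by (intro finite_lists_length_le) (auto simp: coords_def)
  moreover have "seminorm_bounded k (\<lambda>f (as, z). foldr partial as (L f) z) (T \<times> K)"
    if "finite T" "T \<subseteq> ?T" for T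
    using that
  proof (induction T rule: finite_induct)
    case empty
    then show ?case using seminorm_bounded_zero[of k "{}"] by (simp add: seminorm_bounded_def)
  next
    case (insert as T)
    then have "as \<in> lists (coords m)" by auto
    from diff_op_foldr_partial[OF L this] obtain L' where L': "diff_op k m L'"
      "\<And>f. smooth_pts k f \<Longrightarrow> foldr partial as (L f) = L' f" by blast
    have IH: "seminorm_bounded k (\<lambda>f (as, z). foldr partial as (L f) z) (T \<times> K)"
      using insert by simp
    show ?case
      by (rule seminorm_bounded_combine[OF diff_op_seminorm_bounded[OF L'(1) K] IH])
        (auto simp: L'(2)[OF obs_smooth_pts]; metis add_increasing add_increasing2)
  qed
  ultimately have "seminorm_bounded k (\<lambda>f (as, z). foldr partial as (L f) z) (?T \<times> K)" by blast
  then obtain n' K' C where *: "compact K'" "K' \<noteq> {}" "0 \<le> C"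
    "\<forall>f\<in>obs k. \<forall>(as, z)\<in>?T \<times> K. \<bar>foldr partial as (L f) z\<bar> \<le> C * obs_seminorm k n' K' f"
    unfolding seminorm_bounded_def by auto
  have "obs_seminorm m n K (L f) \<le> C * obs_seminorm k n' K' f" if "f \<in> obs k" for f
    by (rule obs_seminorm_least[OF K(2)]) (use *(4) that in \<open>auto simp: in_lists_conv_set subset_eq\<close>)
  then show ?thesis using * by blast
qed

subsection \<open>The Lie bracket\<close>

abbreviation x1_coord :: "'d::finite \<Rightarrow> nat \<times> 'd phase" where "x1_coord c \<equiv> (1, (axis c 1, 0))"
abbreviation v1_coord :: "'d::finite \<Rightarrow> nat \<times> 'd phase" where "v1_coord c \<equiv> (1, (0, axis c 1))"

lemma first_coords: "k \<ge> 1 \<Longrightarrow> x1_coord c \<in> coords k" "k \<ge> 1 \<Longrightarrow> v1_coord c \<in> coords k"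
  by (auto simp: coords_def Basis_prod_def)

text \<open>\<open>skip_block\<close> as a relabelling of indices, the form that
  \<open>diff_op\<close> and the particle sums work with.\<close>

abbreviation skip_index :: "nat \<Rightarrow> nat \<Rightarrow> nat" where
  "skip_index l i \<equiv> (if i = 1 then 1 else l + i - 1)"

lemma wedge1_expand:
  "wedge1 l j f g z = (\<Sum>c\<in>UNIV. real (l * j) *
     (partial (x1_coord c) f z * partial (v1_coord c) g (\<lambda>i. z (skip_index l i))
     - partial (x1_coord c) g z * partial (v1_coord c) f (\<lambda>i. z (skip_index j i))))"
proof -
  have "skip_block m z = (\<lambda>i. z (skip_index m i))" for m by (auto simp: skip_block_def)
  then show ?thesis
    by (simp add: wedge1_def grad_x1_def grad_v1_def inner_vec_def sum_subtractf sum_distrib_left right_diff_distrib)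
qed

lemma wedge1_swap: "wedge1 l j f g z = - wedge1 j l g f z"
  by (simp add: wedge1_def mult.commute right_diff_distrib)

lemma symmetrize_add: "symmetrize k (\<lambda>z. f z + g z) z = symmetrize k f z + symmetrize k g z"
  by (simp add: symmetrize_def sum.distrib distrib_left add_divide_distrib)

lemma symmetrize_scale: "symmetrize k (\<lambda>z. c * f z) z = c * symmetrize k f z"
  by (simp add: symmetrize_def sum_distrib_left)

lemma symmetrize_swap: "symmetrize k (wedge1 l j f g) z = - symmetrize k (wedge1 j l g f) z"
proof -
  have "wedge1 l j f g = (\<lambda>z. (-1) * wedge1 j l g f z)" by (auto simp: wedge1_swap[of l j])
  then show ?thesis using symmetrize_scale[of k "-1"] by simp
qed

lemma partial_add:
  assumes "smooth k f" "smooth k g" "a \<in> coords k"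
  shows "partial a (\<lambda>z. f z + g z) z = partial a f z + partial a g z"
  using foldr_partial_add[OF assms(1,2), of "[a]"] assms(3) by simp

lemma partial_scale:
  assumes "smooth k f" "a \<in> coords k" shows "partial a (\<lambda>z. c * f z) z = c * partial a f z"
  using foldr_partial_scale[OF assms(1), of "[a]"] assms(2) by simp

lemma wedge1_add:
  assumes "smooth l f" "smooth l f'" "l \<ge> 1"
  shows "wedge1 l j (\<lambda>z. f z + f' z) g z = wedge1 l j f g z + wedge1 l j f' g z"
  unfolding wedge1_expand sum.distrib[symmetric]
    partial_add[OF assms(1,2) first_coords(1)[OF assms(3)]] partial_add[OF assms(1,2) first_coords(2)[OF assms(3)]]
  by (intro sum.cong refl) (simp only: algebra_simps)

lemma wedge1_scale:
  assumes "smooth l f" "l \<ge> 1"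
  shows "wedge1 l j (\<lambda>z. c * f z) g z = c * wedge1 l j f g z"
  unfolding wedge1_expand sum_distrib_left
    partial_scale[OF assms(1) first_coords(1)[OF assms(2)]] partial_scale[OF assms(1) first_coords(2)[OF assms(2)]]
  by (intro sum.cong refl) (simp only: algebra_simps)

lemma wedge1_zero: "wedge1 l j (\<lambda>z. 0) g z = 0"
  by (simp add: wedge1_expand partial_def)

text \<open>The two arguments share the point \<open>z 1\<close>, so the second block
  \<open>z 1, z (l + 1), ...\<close> of length j ends at index \<open>l + j - 1 = k\<close>.\<close>

lemma wedge1_cong:
  assumes f: "smooth_pts l f" and g: "smooth_pts j g" and "l \<ge> 1" "j \<ge> 1" "k = l + j - 1"
    and zw: "\<And>i. i \<in> {1..k} \<Longrightarrow> z i = w i"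
  shows "wedge1 l j f g z = wedge1 l j f g w"
proof -
  have 1: "partial a f z = partial a f w" "partial a f (\<lambda>i. z (skip_index j i)) = partial a f (\<lambda>i. w (skip_index j i))"
    if "a \<in> coords l" for a
    by (rule smooth_pts_cong[OF smooth_pts_partial[OF f that]]; use assms(3-5) in \<open>auto intro!: zw\<close>)+
  have 2: "partial a g z = partial a g w" "partial a g (\<lambda>i. z (skip_index l i)) = partial a g (\<lambda>i. w (skip_index l i))"
    if "a \<in> coords j" for a
    by (rule smooth_pts_cong[OF smooth_pts_partial[OF g that]]; use assms(3-5) in \<open>auto intro!: zw\<close>)+
  show ?thesis
    unfolding wedge1_expand
    by (simp only: 1[OF first_coords(1)[OF assms(3)]] 1[OF first_coords(2)[OF assms(3)]]
        2[OF first_coords(1)[OF assms(4)]] 2[OF first_coords(2)[OF assms(4)]])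
qed

text \<open>With g fixed, its derivatives become smooth coefficients. Both the permutations and the
  skipped block act as relabellings of the points.\<close>

lemma diff_op_symmetrize_wedge1:
  fixes g :: "'d::finite config \<Rightarrow> real"
  assumes g: "smooth_pts j g" and "l \<ge> 1" "j \<ge> 1"
  shows "diff_op l m (\<lambda>f. symmetrize k (wedge1 l j f g))"
proof -
  define C where "C = real (l * j) / fact k"
  let ?L = "\<lambda>f z. \<Sum>\<pi> | \<pi> permutes {1..k}. \<Sum>c\<in>UNIV.
      C * partial (v1_coord c) g (\<lambda>i. z (\<pi> (skip_index l i))) * foldr partial [x1_coord c] f (\<lambda>i. z (\<pi> i))
      + (- C) * partial (x1_coord c) g (\<lambda>i. z (\<pi> i)) * foldr partial [v1_coord c] f (\<lambda>i. z (\<pi> (skip_index j i)))"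
  have "diff_op l m ?L"
  proof (intro diff_op_sum diff_op_add)
    fix \<pi> :: "nat \<Rightarrow> nat" and c :: 'd
    have s: "smooth m (\<lambda>z. C * partial a g (\<lambda>i. z (\<tau> i)))" if "a \<in> coords j" for C a \<tau>
      by (rule smooth_scale[OF smooth_relabel[OF smooth_pts_partial[OF g that]]])
    show "diff_op l m (\<lambda>f z. C * partial (v1_coord c) g (\<lambda>i. z (\<pi> (skip_index l i))) *
        foldr partial [x1_coord c] f (\<lambda>i. z (\<pi> i)))"
      using first_coords[OF assms(2)] by (intro diff_op_term s first_coords assms(3)) simp
    show "diff_op l m (\<lambda>f z. (- C) * partial (x1_coord c) g (\<lambda>i. z (\<pi> i)) *
        foldr partial [v1_coord c] f (\<lambda>i. z (\<pi> (skip_index j i))))"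
      using first_coords[OF assms(2)] by (intro diff_op_term s first_coords assms(3)) simp
  qed
  moreover have "symmetrize k (wedge1 l j f g) = ?L f" for f
    unfolding symmetrize_def wedge1_expand sum_distrib_left C_def
    by (intro ext sum.cong refl) (simp add: field_simps)
  ultimately show ?thesis by simp
qed

lemma symmetrize_permute:
  assumes "\<sigma> permutes {1..k}" shows "symmetrize k h (\<lambda>i. z (\<sigma> i)) = symmetrize k h z"
  using setum_permutations_compose_left[OF assms, of "\<lambda>p. h (\<lambda>i. z (p i))"]
  by (simp add: symmetrize_def)

lemma symmetrize_wedge1_obs:
  assumes f: "f \<in> obs l" and g: "g \<in> obs j" and "l \<ge> 1" "j \<ge> 1" and k: "k = l + j - 1"
  shows "symmetrize k (wedge1 l j f g) \<in> obs k"
proof (rule obsI)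
  show "smooth k (symmetrize k (wedge1 l j f g))"
    by (rule diff_op_smooth[OF diff_op_symmetrize_wedge1[OF obs_smooth_pts[OF g] assms(3,4)] obs_smooth_pts[OF f]])
  show "symmetrize k (wedge1 l j f g) (\<lambda>i. z (\<pi> i)) = symmetrize k (wedge1 l j f g) z"
    if "\<pi> permutes {1..k}" for \<pi> z
    by (rule symmetrize_permute[OF that])
  fix z w :: "'a config" assume zw: "\<And>i. i \<in> {1..k} \<Longrightarrow> z i = w i"
  have "wedge1 l j f g (\<lambda>i. z (\<pi> i)) = wedge1 l j f g (\<lambda>i. w (\<pi> i))" if "\<pi> permutes {1..k}" for \<pi>
    by (rule wedge1_cong[OF obs_smooth_pts[OF f] obs_smooth_pts[OF g] assms(3-5)])
      (metis zw permutes_in_image that)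
  then show "symmetrize k (wedge1 l j f g) z = symmetrize k (wedge1 l j f g) w"
    by (simp add: symmetrize_def)
qed

definition bracket_pairs :: "nat \<Rightarrow> (nat \<times> nat) set" where
  "bracket_pairs k = {(l, j). 1 \<le> l \<and> 1 \<le> j \<and> l + j - 1 = k}"

lemma finite_bracket_pairs: "finite (bracket_pairs k)"
  by (rule finite_subset[of _ "{..k} \<times> {..k}"]) (auto simp: bracket_pairs_def)

lemma obs_sum: "(\<And>x. x \<in> A \<Longrightarrow> f x \<in> obs k) \<Longrightarrow> (\<lambda>z. \<Sum>x\<in>A. f x z) \<in> obs k"
  by (induction A rule: infinite_finite_induct) (simp_all add: obs_0 obs_add)

text \<open>This discharges the obligations hidden in \<open>Abs_hierarchy\<close>: each component
  is smooth and symmetric, no pair has \<open>l + j - 1 = 0\<close>, and a nonzero component comes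
  from some l in \<open>supp F\<close> and j in \<open>supp G\<close>.\<close>

lemma component_bracket:
  "component (hierarchy_bracket F G) k z =
    (\<Sum>(l, j)\<in>bracket_pairs k. symmetrize k (wedge1 l j (component F l) (component G j)) z)"
proof -
  let ?B = "\<lambda>k z. \<Sum>(l, j)\<in>bracket_pairs k. symmetrize k (wedge1 l j (component F l) (component G j)) z"
  have "?B k \<in> obs k" for k
    unfolding case_prod_unfold
    by (intro obs_sum symmetrize_wedge1_obs component_obs) (auto simp: bracket_pairs_def)
  moreover have "bracket_pairs 0 = {}" by (auto simp: bracket_pairs_def)
  then have "?B 0 = (\<lambda>z. 0)" by simp
  moreover have "finite {k. ?B k \<noteq> (\<lambda>z. 0)}"
  proof (rule finite_subset)
    show "finite ((\<lambda>(l, j). l + j - 1) ` (supp F \<times> supp G))" by (intro finite_imageI finite_cartesian_product finite_supp)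
    show "{k. ?B k \<noteq> (\<lambda>z. 0)} \<subseteq> (\<lambda>(l, j). l + j - 1) ` (supp F \<times> supp G)"
    proof
      fix k assume "k \<in> {k. ?B k \<noteq> (\<lambda>z. 0)}"
      then obtain z where "?B k z \<noteq> 0" by auto
      then obtain l j where lj: "(l, j) \<in> bracket_pairs k"
        "symmetrize k (wedge1 l j (component F l) (component G j)) z \<noteq> 0"
        by (auto elim!: sum.not_neutral_contains_not_neutral)
      have z: "symmetrize k (wedge1 l j (\<lambda>z. 0) g) z = 0" for l j g by (simp add: symmetrize_def wedge1_zero)
      have "l \<in> supp F" using lj(2) z by (auto simp: supp_def)
      moreover have "j \<in> supp G"
        using lj(2) z unfolding symmetrize_swap[of k l j] by (auto simp: supp_def)
      ultimately show "k \<in> (\<lambda>(l, j). l + j - 1) ` (supp F \<times> supp G)"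
        using lj(1) by (force simp: bracket_pairs_def)
    qed
  qed
  ultimately have "component (Abs_hierarchy ?B) = ?B" by (intro Abs_hierarchy_inverse) simp
  then show ?thesis by (simp add: hierarchy_bracket_def bracket_pairs_def)
qed

section \<open>Bilinearity, antisymmetry and homogeneous elements\<close>

lemma component_smooth: "k \<ge> 1 \<Longrightarrow> smooth k (component F k)"
  by (rule obs_smooth[OF component_obs])

lemma bracket_add_left: "hierarchy_bracket (F + G) H = hierarchy_bracket F H + hierarchy_bracket G H"
proof (rule hierarchy_eqI)
  fix k and z :: "'a config"
  have "symmetrize k (wedge1 l j (component (F + G) l) h) z
      = symmetrize k (wedge1 l j (component F l) h) z + symmetrize k (wedge1 l j (component G l) h) z"
    if "l \<ge> 1" for l j h
    unfolding plus_hierarchy.rep_eq symmetrize_add[symmetric]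
      wedge1_add[OF component_smooth[OF that, of F] component_smooth[OF that, of G] that] ..
  then show "component (hierarchy_bracket (F + G) H) k z = component (hierarchy_bracket F H + hierarchy_bracket G H) k z"
    unfolding plus_hierarchy.rep_eq[of "hierarchy_bracket F H"] component_bracket sum.distrib[symmetric]
    by (intro sum.cong refl) (auto simp: bracket_pairs_def)
qed

lemma bracket_scale_left: "hierarchy_bracket (c *\<^sub>R F) H = c *\<^sub>R hierarchy_bracket F H"
proof (rule hierarchy_eqI)
  fix k and z :: "'a config"
  have "symmetrize k (wedge1 l j (component (c *\<^sub>R F) l) h) z
      = c * symmetrize k (wedge1 l j (component F l) h) z" if "l \<ge> 1" for l j h
    unfolding scaleR_hierarchy.rep_eq symmetrize_scale[symmetric]
      wedge1_scale[OF component_smooth[OF that, of F] that] ..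
  then show "component (hierarchy_bracket (c *\<^sub>R F) H) k z = component (c *\<^sub>R hierarchy_bracket F H) k z"
    unfolding scaleR_hierarchy.rep_eq[of c "hierarchy_bracket F H"] component_bracket sum_distrib_left
    by (intro sum.cong refl) (auto simp: bracket_pairs_def)
qed

lemma bracket_antisym: "hierarchy_bracket F G = (-1) *\<^sub>R hierarchy_bracket G F"
proof (rule hierarchy_eqI)
  fix k and z :: "'a config"
  have "(\<Sum>(l, j)\<in>bracket_pairs k. symmetrize k (wedge1 l j (component F l) (component G j)) z)
    = (\<Sum>(l, j)\<in>bracket_pairs k. - symmetrize k (wedge1 l j (component G l) (component F j)) z)"
    by (rule sum.reindex_bij_witness[of _ prod.swap prod.swap])
      (auto simp: bracket_pairs_def symmetrize_swap[of _ _ _ "component F _"])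
  then show "component (hierarchy_bracket F G) k z = component ((-1) *\<^sub>R hierarchy_bracket G F) k z"
    unfolding scaleR_hierarchy.rep_eq component_bracket by (simp add: sum_negf case_prod_unfold)
qed

lemma bracket_add_right: "hierarchy_bracket H (F + G) = hierarchy_bracket H F + hierarchy_bracket H G"
  by (simp only: bracket_antisym[of H] bracket_add_left scaleR_add_right)

lemma bracket_scale_right: "hierarchy_bracket H (c *\<^sub>R F) = c *\<^sub>R hierarchy_bracket H F"
  by (simp only: bracket_antisym[of H] bracket_scale_left scaleR_left_commute)

lemma linear_bracket_left: "linear (\<lambda>F. hierarchy_bracket F G)"
  by (intro linearI bracket_add_left bracket_scale_left)

lemma linear_bracket_right: "linear (hierarchy_bracket F)"
  by (intro linearI bracket_add_right bracket_scale_right)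

lemma bracket_incl:
  assumes "l \<ge> 1" "j \<ge> 1" "f \<in> obs l" "g \<in> obs j"
  shows "hierarchy_bracket (incl l f) (incl j g) = incl (l + j - 1) (symmetrize (l + j - 1) (wedge1 l j f g))"
proof (rule hierarchy_eqI)
  fix k and z :: "'a config"
  have z1: "symmetrize k (wedge1 l j (\<lambda>z. 0) g) z = 0" for l j and g :: "'a config \<Rightarrow> real" by (simp add: symmetrize_def wedge1_zero)
  have z2: "symmetrize k (wedge1 l j g (\<lambda>z. 0)) z = 0" for l j and g :: "'a config \<Rightarrow> real" by (simp add: symmetrize_swap[of k l j g] z1)
  have "component (hierarchy_bracket (incl l f) (incl j g)) k z =
    (\<Sum>p\<in>bracket_pairs k. if p = (l, j) then symmetrize k (wedge1 l j f g) z else 0)"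
    unfolding component_bracket by (intro sum.cong refl) (auto simp: component_incl[OF assms(1,3)] component_incl[OF assms(2,4)] z1 z2 split: if_splits)
  also have "\<dots> = (if (l, j) \<in> bracket_pairs k then symmetrize k (wedge1 l j f g) z else 0)"
    by (simp add: finite_bracket_pairs)
  also have "\<dots> = component (incl (l + j - 1) (symmetrize (l + j - 1) (wedge1 l j f g))) k z"
    using component_incl[OF _ symmetrize_wedge1_obs[OF assms(3,4,1,2) refl]] assms(1,2)
    by (auto simp: bracket_pairs_def)
  finally show "component (hierarchy_bracket (incl l f) (incl j g)) k z =
    component (incl (l + j - 1) (symmetrize (l + j - 1) (wedge1 l j f g))) k z" .
qed

text \<open>Every element is a finite sum of homogeneous ones. Scalar multiples fall under the case
  \<open>incl\<close>, as each \<open>obs k\<close> is a vector space.\<close>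

lemma hierarchy_induct [case_names zero add incl]:
  assumes "P 0" "\<And>F G. P F \<Longrightarrow> P G \<Longrightarrow> P (F + G)" "\<And>k f. k \<ge> 1 \<Longrightarrow> f \<in> obs k \<Longrightarrow> P (incl k f)"
  shows "P F"
proof -
  have "P (\<Sum>k\<in>A. incl k (component F k))" if "A \<subseteq> supp F" for A
    using that
  proof (induction A rule: infinite_finite_induct)
    case (insert k A)
    then have k: "k \<ge> 1" using supp_pos by blast
    have "P (incl k (component F k) + (\<Sum>k\<in>A. incl k (component F k)))"
      by (rule assms(2)[OF assms(3)[OF k component_obs[OF k]]]) (use insert in auto)
    then show ?case using insert.hyps by simp
  qed (simp_all add: assms(1))
  then show ?thesis using hierarchy_expand[of F] by force
qed

text \<open>The universal property of the locally convex direct sum: preimages of absolutely convex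
  sets under a linear map are absolutely convex, so continuity on each summand is enough.\<close>

lemma linear_continuous_hierarchyI:
  fixes T :: "'d::finite hierarchy \<Rightarrow> 'd hierarchy"
  assumes lin: "linear T"
    and nhd: "\<And>U k. direct_sum_nhd U \<Longrightarrow> k \<ge> 1 \<Longrightarrow> \<exists>n K e. compact K \<and> K \<noteq> {} \<and> 0 < e \<and>
      (\<forall>f\<in>obs k. obs_seminorm k n K f < e \<longrightarrow> T (incl k f) \<in> U)"
  shows "continuous_on UNIV T"
  unfolding continuous_on_open_invariant
proof (intro allI impI exI conjI)
  fix V :: "'d hierarchy set" assume V: "open V"
  show "T -` V \<inter> UNIV = T -` V \<inter> UNIV" ..
  show "open (T -` V)"
    unfolding open_hierarchy_def lc_open_def
  proof
    fix F assume "F \<in> T -` V"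
    then obtain U where U: "direct_sum_nhd U" "\<forall>u\<in>U. T F + u \<in> V"
      using V unfolding open_hierarchy_def lc_open_def by blast
    have "convex (T -` U)" using U(1) by (intro convex_linear_vimage lin) (simp add: direct_sum_nhd_def)
    moreover have "balanced (T -` U)"
      using U(1) by (simp add: balanced_def direct_sum_nhd_def linear_scale[OF lin])
    ultimately have "direct_sum_nhd (T -` U)"
      using nhd[OF U(1)] unfolding direct_sum_nhd_iff by simp
    moreover have "\<forall>u\<in>T -` U. F + u \<in> T -` V" using U(2) by (simp add: linear_add[OF lin])
    ultimately show "\<exists>U. direct_sum_nhd U \<and> (\<forall>u\<in>U. F + u \<in> T -` V)" by blast
  qed
qed

text \<open>Induction on F reduces to a homogeneous F of degree j. On each summand, bracketing with
  it is a differential operator landing in degree \<open>k + j - 1\<close>, and its seminorm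
  estimate gives continuity there.\<close>

lemma continuous_bracket_left:
  fixes F :: "'d::finite hierarchy"
  shows "continuous_on UNIV (\<lambda>G. hierarchy_bracket G F)"
proof (induction F rule: hierarchy_induct)
  case zero
  show ?case by (simp add: linear_0[OF linear_bracket_right])
next
  case (add F G)
  then show ?case by (simp add: bracket_add_right continuous_on_add)
next
  case (incl j g)
  show ?case
  proof (rule linear_continuous_hierarchyI[OF linear_bracket_left])
    fix U :: "'d hierarchy set" and k :: nat assume U: "direct_sum_nhd U" and k: "k \<ge> 1"
    define m where "m = k + j - 1"
    have "m \<ge> 1" using k incl by (simp add: m_def)
    then obtain n K e where *: "compact K" "K \<noteq> {}" "0 < e" "\<forall>f\<in>obs m. obs_seminorm m n K f < e \<longrightarrow> incl m f \<in> U"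
      using U unfolding direct_sum_nhd_iff by meson
    let ?L = "\<lambda>f. symmetrize m (wedge1 k j f g)"
    have "diff_op k m ?L" by (rule diff_op_symmetrize_wedge1[OF obs_smooth_pts[OF incl(2)] k incl(1)])
    from diff_op_obs_seminorm[OF this *(1,2), of n] obtain n' K' C where
      L: "compact K'" "K' \<noteq> {}" "0 \<le> C" "\<forall>f\<in>obs k. obs_seminorm m n K (?L f) \<le> C * obs_seminorm k n' K' f"
      by blast
    \<comment> \<open>Dividing by \<open>C + 1\<close> keeps the radius positive also when C is
      0.\<close>
    have "hierarchy_bracket (incl k f) (incl j g) \<in> U"
      if f: "f \<in> obs k" "obs_seminorm k n' K' f < e / (C + 1)" for f
    proof -
      have "obs_seminorm m n K (?L f) \<le> C * obs_seminorm k n' K' f" using L(4) f(1) by blast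
      also have "\<dots> \<le> (C + 1) * obs_seminorm k n' K' f"
        using obs_seminorm_nonneg[OF f(1) L(1,2)] by (intro mult_right_mono) auto
      also have "\<dots> < e" using f(2) L(3) by (simp add: pos_less_divide_eq mult.commute)
      finally have "obs_seminorm m n K (?L f) < e" .
      then have "incl m (?L f) \<in> U"
        using *(4)[rule_format] symmetrize_wedge1_obs[OF f(1) incl(2) k incl(1) m_def] by simp
      then show ?thesis using bracket_incl[OF k incl(1) f(1) incl(2)] by (simp add: m_def)
    qed
    then show "\<exists>n K e. compact K \<and> K \<noteq> {} \<and> 0 < e \<and>
      (\<forall>f\<in>obs k. obs_seminorm k n K f < e \<longrightarrow> hierarchy_bracket (incl k f) (incl j g) \<in> U)"
      using L *(3) by (intro exI[of _ n'] exI[of _ K'] exI[of _ "e / (C + 1)"]) auto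
  qed
qed

subsection \<open>Particle systems and the Jacobi identity\<close>

text \<open>Extensional functions, so that there are finitely many tuples and each is determined by
  its entries at 1, ..., k.\<close>

abbreviation tuples :: "nat set \<Rightarrow> nat \<Rightarrow> (nat \<Rightarrow> nat) set" where
  "tuples A k \<equiv> {1..k} \<rightarrow>\<^sub>E A"

text \<open>The pairing of \<open>h\<close> with the \<open>k\<close>-th tensor power of \<open>\<Sum>i\<in>A. \<delta> (z i)\<close>.\<close>

definition particle_sum :: "nat set \<Rightarrow> nat \<Rightarrow> ('d::finite config \<Rightarrow> real) \<Rightarrow> 'd config \<Rightarrow> real" where
  "particle_sum A k h z = (\<Sum>m\<in>tuples A k. h (\<lambda>i. z (m i)))"

text \<open>The form that a derivative with respect to particle \<open>p\<close> takes: by symmetry,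
  the differentiated argument may be put first.\<close>

definition pinned_sum :: "nat set \<Rightarrow> nat \<Rightarrow> ('d::finite config \<Rightarrow> real) \<Rightarrow> nat \<Rightarrow> 'd config \<Rightarrow> real" where
  "pinned_sum A k h p z = (\<Sum>m | m \<in> tuples A k \<and> m 1 = p. h (\<lambda>i. z (m i)))"

lemma finite_tuples: "finite A \<Longrightarrow> finite (tuples A k)"
  by (simp add: finite_PiE)

lemma tuples_permute:
  assumes "\<pi> permutes {1..k}" "m \<in> tuples A k" shows "m \<circ> \<pi> \<in> tuples A k"
  using assms permutes_in_image[OF assms(1)] permutes_not_in[OF assms(1)]
  by (fastforce simp: PiE_iff extensional_def)

lemma sum_tuples_permute:
  assumes "\<pi> permutes {1..k}"
  shows "(\<Sum>m\<in>tuples A k. \<phi> (m \<circ> \<pi>)) = (\<Sum>m\<in>tuples A k. \<phi> m)"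
proof (rule sum.reindex_bij_witness[of _ "\<lambda>m. m \<circ> inv \<pi>" "\<lambda>m. m \<circ> \<pi>"])
  show "m \<circ> inv \<pi> \<in> tuples A k" if "m \<in> tuples A k" for m
    by (rule tuples_permute[OF permutes_inv[OF assms] that])
  show "m \<circ> \<pi> \<in> tuples A k" if "m \<in> tuples A k" for m
    by (rule tuples_permute[OF assms that])
qed (simp_all add: comp_assoc permutes_inv_o[OF assms])

text \<open>The tensor power is itself invariant under permuting its factors, so averaging h over
  permutations changes nothing.\<close>

lemma particle_sum_symmetrize: "particle_sum A k (symmetrize k h) z = particle_sum A k h z"
proof -
  have "particle_sum A k (symmetrize k h) z
      = 1 / fact k * (\<Sum>\<pi> | \<pi> permutes {1..k}. \<Sum>m\<in>tuples A k. h (\<lambda>i. z ((m \<circ> \<pi>) i)))"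
    unfolding particle_sum_def symmetrize_def sum_distrib_left[symmetric] by (subst sum.swap) simp
  also have "(\<Sum>\<pi> | \<pi> permutes {1..k}. \<Sum>m\<in>tuples A k. h (\<lambda>i. z ((m \<circ> \<pi>) i)))
      = (\<Sum>\<pi> | \<pi> permutes {1..k}. particle_sum A k h z)"
    unfolding particle_sum_def by (intro sum.cong refl sum_tuples_permute) simp
  also have "\<dots> = fact k * particle_sum A k h z"
    using card_permutations[of "{1..k}" k] by simp
  finally show ?thesis by simp
qed

section \<open>Derivatives and products of particle sums\<close>

lemma shift_permute:
  assumes "\<pi> permutes S" shows "shift (p, e) t (\<lambda>i. w (\<pi> i)) = (\<lambda>i. shift (\<pi> p, e) t w (\<pi> i))"
  using permutes_inj[OF assms] by (auto simp: shift_def fun_eq_iff dest: injD)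

lemma partial_permute:
  assumes "f \<in> obs k" "\<pi> permutes {1..k}"
  shows "partial (p, e) f (\<lambda>i. w (\<pi> i)) = partial (\<pi> p, e) f w"
  by (simp add: partial_def shift_permute[OF assms(2)] obs_permute[OF assms])

text \<open>The chain rule gives one term for each slot q with \<open>m q = p\<close>. Symmetry of f
  moves slot q to slot 1, so the l slots contribute equally; these factors account for
  \<open>l * j\<close> in \<open>wedge1\<close>.\<close>

lemma partial_particle_sum:
  fixes f :: "'d::finite config \<Rightarrow> real"
  assumes A: "finite A" and f: "f \<in> obs l" and l: "l \<ge> 1" and e: "e \<in> Basis"
  shows "partial (p, e) (particle_sum A l f) z = real l * pinned_sum A l (partial (1, e) f) p z"
proof -
  have "((\<lambda>t. particle_sum A l f (shift (p, e) t z)) has_real_derivative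
      (\<Sum>m\<in>tuples A l. \<Sum>q | q \<in> {1..l} \<and> m q = p. partial (q, e) f (\<lambda>i. z (m i)))) (at 0)"
    unfolding particle_sum_def
    by (rule DERIV_sum) (rule has_derivative_shift_relabel[OF obs_smooth_pts[OF f] e])
  then have "partial (p, e) (particle_sum A l f) z =
      (\<Sum>m\<in>tuples A l. \<Sum>q | q \<in> {1..l} \<and> m q = p. partial (q, e) f (\<lambda>i. z (m i)))"
    unfolding partial_def[of "(p, e)" "particle_sum A l f"] by (rule DERIV_imp_deriv)
  also have "\<dots> = (\<Sum>q\<in>{1..l}. \<Sum>m | m \<in> tuples A l \<and> m q = p. partial (q, e) f (\<lambda>i. z (m i)))"
    by (rule sum.swap_restrict) (simp_all add: finite_tuples[OF A] del: One_nat_def)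
  also have "\<dots> = (\<Sum>q\<in>{1..l}. pinned_sum A l (partial (1, e) f) p z)"
  proof (rule sum.cong[OF refl])
    fix q assume q: "q \<in> {1..l}"
    let ?\<pi> = "Transposition.transpose 1 q"
    have \<pi>: "?\<pi> permutes {1..l}" using q l by (intro permutes_swap_id) auto
    \<comment> \<open>The restriction on m is moved into the summand, so that the sum runs over all
      tuples and may be permuted by the transposition.\<close>
    let ?G = "\<lambda>m. if m q = p then partial (q, e) f (\<lambda>i. z (m i)) else 0"
    have "(\<Sum>m | m \<in> tuples A l \<and> m q = p. partial (q, e) f (\<lambda>i. z (m i))) = (\<Sum>m\<in>tuples A l. ?G m)"
      using sum.inter_filter[OF finite_tuples[OF A]] by fastforce
    also have "\<dots> = (\<Sum>m\<in>tuples A l. ?G (m \<circ> ?\<pi>))" by (rule sum_tuples_permute[OF \<pi>, symmetric])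
    also have "\<dots> = (\<Sum>m\<in>tuples A l. if m 1 = p then partial (1, e) f (\<lambda>i. z (m i)) else 0)"
    proof (rule sum.cong[OF refl])
      fix m
      show "?G (m \<circ> ?\<pi>) = (if m 1 = p then partial (1, e) f (\<lambda>i. z (m i)) else 0)"
        using partial_permute[OF f \<pi>, of q e "\<lambda>i. z (m i)"] by simp
    qed
    also have "\<dots> = pinned_sum A l (partial (1, e) f) p z"
      unfolding pinned_sum_def by (rule sum.inter_filter[OF finite_tuples[OF A], symmetric])
    finally show "(\<Sum>m | m \<in> tuples A l \<and> m q = p. partial (q, e) f (\<lambda>i. z (m i)))
      = pinned_sum A l (partial (1, e) f) p z" .
  qed
  finally show ?thesis by simp
qed

text \<open>A tuple of length \<open>l + j - 1\<close> is the same as an l-tuple and a j-tuple with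
  equal first entries. Sorting such pairs by the common entry p gives the products of pinned
  sums.\<close>

lemma particle_sum_glue:
  assumes A: "finite A" and F: "smooth_pts l F" and G: "smooth_pts j G" and l: "l \<ge> 1" and j: "j \<ge> 1"
    and k: "k = l + j - 1"
  shows "particle_sum A k (\<lambda>z. F z * G (\<lambda>i. z (skip_index l i))) z
    = (\<Sum>p\<in>A. pinned_sum A l F p z * pinned_sum A j G p z)"
proof -
  let ?P = "{(m1, m2). m1 \<in> tuples A l \<and> m2 \<in> tuples A j \<and> m1 1 = m2 1}"
  let ?left = "\<lambda>m. restrict m {1..l}" and ?right = "\<lambda>m. restrict (\<lambda>i. m (skip_index l i)) {1..j}"
  \<comment> \<open>\<open>i - l + 1\<close> inverts \<open>skip_index l\<close> beyond the first
    block; the entry \<open>m2 1\<close> is dropped, as it equals \<open>m1 1\<close>.\<close>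
  let ?glue = "\<lambda>(m1, m2). restrict (\<lambda>i. if i \<le> l then m1 i else m2 (i - l + 1)) {1..k}"
  have "particle_sum A k (\<lambda>z. F z * G (\<lambda>i. z (skip_index l i))) z
      = (\<Sum>(m1, m2)\<in>?P. F (\<lambda>i. z (m1 i)) * G (\<lambda>i. z (m2 i)))"
    unfolding particle_sum_def
  proof (rule sum.reindex_bij_witness[of _ ?glue "\<lambda>m. (?left m, ?right m)"])
    fix m assume m: "m \<in> tuples A k"
    show "?glue (?left m, ?right m) = m"
      using m l j k by (auto simp: fun_eq_iff PiE_iff extensional_def restrict_def)
    have mA: "m i \<in> A" if "i \<in> {1..k}" for i using m that by (rule PiE_mem)
    show "(?left m, ?right m) \<in> ?P"
      using l j k by (auto simp: PiE_iff intro!: mA)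
    have "F (\<lambda>i. z (m i)) = F (\<lambda>i. z (?left m i))"
      by (rule smooth_pts_cong[OF F]) simp
    moreover have "G (\<lambda>i. z (m (skip_index l i))) = G (\<lambda>i. z (?right m i))"
      by (rule smooth_pts_cong[OF G]) simp
    ultimately show "(case (?left m, ?right m) of (m1, m2) \<Rightarrow> F (\<lambda>i. z (m1 i)) * G (\<lambda>i. z (m2 i)))
        = F (\<lambda>i. z (m i)) * G (\<lambda>i. z (m (skip_index l i)))" by simp
  next
    fix b assume "b \<in> ?P"
    then obtain m1 m2 where b: "b = (m1, m2)" and m: "m1 \<in> tuples A l" "m2 \<in> tuples A j" "m1 1 = m2 1" by blast
    show "?glue b \<in> tuples A k"
      using m l j k by (auto simp: b PiE_iff)
    have "?left (?glue b) = m1"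
      using m l j k by (auto simp: b fun_eq_iff PiE_iff extensional_def restrict_def)
    moreover have "?right (?glue b) = m2"
      using m l j k by (auto simp: b fun_eq_iff PiE_iff extensional_def restrict_def)
    ultimately show "(?left (?glue b), ?right (?glue b)) = b" by (simp add: b)
  qed
  also have "?P = Sigma (tuples A l) (\<lambda>m1. {m2. m2 \<in> tuples A j \<and> m2 1 = m1 1})" by auto
  also have "(\<Sum>(m1, m2)\<in>\<dots>. F (\<lambda>i. z (m1 i)) * G (\<lambda>i. z (m2 i)))
      = (\<Sum>m1\<in>tuples A l. F (\<lambda>i. z (m1 i)) * pinned_sum A j G (m1 1) z)"
    by (subst sum.Sigma[symmetric])
      (simp_all add: finite_tuples[OF A] pinned_sum_def sum_distrib_left del: One_nat_def)
  also have "\<dots> = (\<Sum>p\<in>A. \<Sum>m1 | m1 \<in> tuples A l \<and> m1 1 = p. F (\<lambda>i. z (m1 i)) * pinned_sum A j G (m1 1) z)"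
    by (rule sum.group[symmetric, OF finite_tuples[OF A] A]) (use l in \<open>auto simp: PiE_iff\<close>)
  also have "\<dots> = (\<Sum>p\<in>A. pinned_sum A l F p z * pinned_sum A j G p z)"
    by (simp add: pinned_sum_def[of A l] sum_distrib_right)
  finally show ?thesis .
qed

section \<open>Particle functions of whole hierarchies\<close>

lemma particle_sum_add: "particle_sum A k (\<lambda>z. f z + g z) z = particle_sum A k f z + particle_sum A k g z"
  by (simp add: particle_sum_def sum.distrib)

lemma particle_sum_zero: "particle_sum A k (\<lambda>z. 0) z = 0"
  by (simp add: particle_sum_def)

lemma smooth_particle_sum:
  assumes "f \<in> obs k" shows "smooth N (particle_sum A k f)"
proof -
  have "diff_op k N (\<lambda>f z. \<Sum>m\<in>tuples A k. 1 * foldr partial [] f (\<lambda>i. z (m i)))"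
    by (intro diff_op_sum diff_op_term smooth_const) simp
  from diff_op_smooth[OF this obs_smooth_pts[OF assms]]
  show ?thesis unfolding particle_sum_def[abs_def] by simp
qed

definition particle :: "nat set \<Rightarrow> 'd::finite hierarchy \<Rightarrow> 'd config \<Rightarrow> real" where
  "particle A F z = (\<Sum>k\<in>supp F. particle_sum A k (component F k) z)"

lemma particle_superset:
  assumes "finite S" "supp F \<subseteq> S"
  shows "particle A F z = (\<Sum>k\<in>S. particle_sum A k (component F k) z)"
  unfolding particle_def
  by (rule sum.mono_neutral_left[OF assms]) (auto simp: supp_def particle_sum_zero)

lemma particle_add: "particle A (F + G) z = particle A F z + particle A G z"
proof -
  let ?S = "supp F \<union> supp G"
  have S: "finite ?S" by (simp add: finite_supp)
  have "supp (F + G) \<subseteq> ?S" by (auto simp: supp_def component_simps)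
  then show ?thesis
    using particle_superset[OF S, of F A z] particle_superset[OF S, of G A z] particle_superset[OF S, of "F + G" A z]
    by (simp add: plus_hierarchy.rep_eq particle_sum_add sum.distrib)
qed

lemma particle_zero: "particle A 0 z = 0"
  by (simp add: particle_def supp_def component_simps)

lemma particle_incl:
  assumes "k \<ge> 1" "f \<in> obs k" shows "particle A (incl k f) z = particle_sum A k f z"
proof -
  have "supp (incl k f) \<subseteq> {k}" by (auto simp: supp_def component_incl[OF assms] split: if_splits)
  from particle_superset[OF _ this] show ?thesis by (simp add: component_incl[OF assms])
qed

lemma smooth_particle: "smooth N (particle A F)"
proof (induction F rule: hierarchy_induct)
  case zero
  show ?case unfolding particle_zero[abs_def] by (rule smooth_0)
next
  case (add F G)
  then show ?case unfolding particle_add[abs_def] by (rule smooth_add)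
next
  case (incl k f)
  then have "particle A (incl k f) = particle_sum A k f" by (auto simp: particle_incl)
  then show ?case using smooth_particle_sum[OF incl(2)] by simp
qed

section \<open>The canonical bracket of finitely many particles\<close>

abbreviation x_coord :: "nat \<times> 'd::finite \<Rightarrow> nat \<times> 'd phase" where "x_coord p \<equiv> (fst p, (axis (snd p) 1, 0))"
abbreviation v_coord :: "nat \<times> 'd::finite \<Rightarrow> nat \<times> 'd phase" where "v_coord p \<equiv> (fst p, (0, axis (snd p) 1))"

definition canonical_bracket ::
  "nat set \<Rightarrow> ('d::finite config \<Rightarrow> real) \<Rightarrow> ('d config \<Rightarrow> real) \<Rightarrow> 'd config \<Rightarrow> real" where
  "canonical_bracket A \<Phi> \<Psi> z = (\<Sum>p\<in>A \<times> UNIV.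
     partial (x_coord p) \<Phi> z * partial (v_coord p) \<Psi> z - partial (v_coord p) \<Phi> z * partial (x_coord p) \<Psi> z)"

lemma particle_coords:
  "A \<subseteq> {1..N} \<Longrightarrow> p \<in> A \<times> UNIV \<Longrightarrow> x_coord p \<in> coords N"
  "A \<subseteq> {1..N} \<Longrightarrow> p \<in> A \<times> UNIV \<Longrightarrow> v_coord p \<in> coords N"
  by (auto simp: coords_def Basis_prod_def)

lemma canonical_bracket_add_left:
  assumes "A \<subseteq> {1..N}" "smooth N \<Phi>" "smooth N \<Phi>'"
  shows "canonical_bracket A (\<lambda>z. \<Phi> z + \<Phi>' z) \<Psi> z = canonical_bracket A \<Phi> \<Psi> z + canonical_bracket A \<Phi>' \<Psi> z"
  unfolding canonical_bracket_def sum.distrib[symmetric]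
proof (intro sum.cong refl)
  fix p :: "nat \<times> 'a" assume "p \<in> A \<times> UNIV"
  note c = particle_coords[OF assms(1) this]
  show "partial (x_coord p) (\<lambda>z. \<Phi> z + \<Phi>' z) z * partial (v_coord p) \<Psi> z
      - partial (v_coord p) (\<lambda>z. \<Phi> z + \<Phi>' z) z * partial (x_coord p) \<Psi> z =
    (partial (x_coord p) \<Phi> z * partial (v_coord p) \<Psi> z - partial (v_coord p) \<Phi> z * partial (x_coord p) \<Psi> z) +
    (partial (x_coord p) \<Phi>' z * partial (v_coord p) \<Psi> z - partial (v_coord p) \<Phi>' z * partial (x_coord p) \<Psi> z)"
    unfolding partial_add[OF assms(2,3) c(1)] partial_add[OF assms(2,3) c(2)] by (simp only: algebra_simps)
qed

lemma canonical_bracket_swap: "canonical_bracket A \<Phi> \<Psi> z = - canonical_bracket A \<Psi> \<Phi> z"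
  unfolding canonical_bracket_def sum_negf[symmetric] by (intro sum.cong refl) (simp only: algebra_simps)

lemma canonical_bracket_zero: "canonical_bracket A (\<lambda>z. 0) \<Psi> z = 0"
  by (simp add: canonical_bracket_def partial_def)

text \<open>Symmetrization is invisible to the particle sum, gluing splits each product of
  derivatives into pinned sums at the common particle, and the factors l and j turn these into
  derivatives of particle sums.\<close>

lemma particle_bracket_incl:
  fixes f g :: "'d::finite config \<Rightarrow> real"
  assumes A: "finite A" and "l \<ge> 1" "j \<ge> 1" "f \<in> obs l" "g \<in> obs j"
  shows "particle A (hierarchy_bracket (incl l f) (incl j g)) z
    = canonical_bracket A (particle A (incl l f)) (particle A (incl j g)) z"
proof -
  define k where "k = l + j - 1"
  have k: "k \<ge> 1" using assms by (simp add: k_def)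
  have k': "k = j + l - 1" by (simp add: k_def)
  have B: "(axis c 1, 0) \<in> (Basis :: 'd phase set)" "(0, axis c 1) \<in> (Basis :: 'd phase set)" for c :: 'd by (simp_all add: Basis_prod_def image_iff)
  have P: "smooth_pts l (partial (x1_coord c) f)" "smooth_pts l (partial (v1_coord c) f)"
     "smooth_pts j (partial (x1_coord c) g)" "smooth_pts j (partial (v1_coord c) g)" for c
    by (rule smooth_pts_partial[OF obs_smooth_pts[OF assms(4)] first_coords(1)[OF assms(2)]]
        smooth_pts_partial[OF obs_smooth_pts[OF assms(4)] first_coords(2)[OF assms(2)]]
        smooth_pts_partial[OF obs_smooth_pts[OF assms(5)] first_coords(1)[OF assms(3)]]
        smooth_pts_partial[OF obs_smooth_pts[OF assms(5)] first_coords(2)[OF assms(3)]])+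
  have "particle A (hierarchy_bracket (incl l f) (incl j g)) z = particle_sum A k (wedge1 l j f g) z"
    unfolding bracket_incl[OF assms(2-5)] k_def[symmetric]
    using particle_incl[OF k symmetrize_wedge1_obs[OF assms(4,5,2,3) k_def]]
    by (simp add: particle_sum_symmetrize)
  also have "\<dots> = (\<Sum>c\<in>UNIV. real (l * j) *
      (particle_sum A k (\<lambda>z. partial (x1_coord c) f z * partial (v1_coord c) g (\<lambda>i. z (skip_index l i))) z
      - particle_sum A k (\<lambda>z. partial (x1_coord c) g z * partial (v1_coord c) f (\<lambda>i. z (skip_index j i))) z))"
    unfolding particle_sum_def wedge1_expand sum_subtractf[symmetric] sum_distrib_left by (rule sum.swap)
  also have "\<dots> = (\<Sum>c\<in>UNIV. \<Sum>p\<in>A. real (l * j) *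
      (pinned_sum A l (partial (x1_coord c) f) p z * pinned_sum A j (partial (v1_coord c) g) p z
      - pinned_sum A j (partial (x1_coord c) g) p z * pinned_sum A l (partial (v1_coord c) f) p z))"
    \<comment> \<open>The second product is glued in the opposite order, with g supplying the first
      block; hence the degree is also needed as \<open>j + l - 1\<close>.\<close>
    unfolding particle_sum_glue[OF A P(1,4) assms(2,3) k_def] particle_sum_glue[OF A P(3,2) assms(3,2) k']
    by (simp only: sum_subtractf[symmetric] sum_distrib_left)
  also have "\<dots> = (\<Sum>c\<in>UNIV. \<Sum>p\<in>A.
      partial (x_coord (p, c)) (particle_sum A l f) z * partial (v_coord (p, c)) (particle_sum A j g) z
      - partial (v_coord (p, c)) (particle_sum A l f) z * partial (x_coord (p, c)) (particle_sum A j g) z)"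
    by (simp add: partial_particle_sum[OF A] assms B algebra_simps del: One_nat_def)
  also have "\<dots> = canonical_bracket A (particle_sum A l f) (particle_sum A j g) z"
    unfolding canonical_bracket_def by (subst sum.swap) (simp add: sum.cartesian_product case_prod_unfold)
  also have "\<dots> = canonical_bracket A (particle A (incl l f)) (particle A (incl j g)) z"
    unfolding particle_incl[OF assms(2,4), abs_def] particle_incl[OF assms(3,5), abs_def] ..
  finally show ?thesis .
qed

text \<open>Both sides are additive in each argument, so homogeneous arguments suffice. The bound N
  fixes the finite set of coordinates in which the particle functions are smooth.\<close>

lemma particle_bracket:
  assumes A: "A \<subseteq> {1..N}"
  shows "particle A (hierarchy_bracket F G) z = canonical_bracket A (particle A F) (particle A G) z"
proof (induction F rule: hierarchy_induct)
  case zero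
  show ?case
    by (simp add: linear_0[OF linear_bracket_left] particle_zero particle_zero[abs_def] canonical_bracket_zero)
next
  case (add F F')
  then show ?case
    unfolding bracket_add_left particle_add particle_add[abs_def]
      canonical_bracket_add_left[OF A smooth_particle smooth_particle] by simp
next
  case (incl l f)
  show ?case
  proof (induction G rule: hierarchy_induct)
    case zero
    show ?case
      by (simp add: linear_0[OF linear_bracket_right] particle_zero particle_zero[abs_def]
          canonical_bracket_zero canonical_bracket_swap[of A _ "\<lambda>z. 0"])
  next
    case (add G G')
    then show ?case
      unfolding bracket_add_right particle_add particle_add[abs_def] canonical_bracket_swap[of A "particle A (incl l f)"]
        canonical_bracket_add_left[OF A smooth_particle smooth_particle] by simp
  next
    case (incl j g)
    then show ?case using particle_bracket_incl[OF finite_subset[OF A]] \<open>l \<ge> 1\<close> \<open>f \<in> obs l\<close> by simp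
  qed
qed

text \<open>The term of \<open>{\<Phi>, {\<Psi>, \<Theta>}}\<close> for one pair \<open>p\<close>, \<open>q\<close> of conjugate coordinates, in terms of first
  derivatives \<open>u\<close>, \<open>v\<close>, \<open>w\<close> and second derivatives \<open>v2\<close>, \<open>w2\<close>.\<close>

definition double_bracket_term ::
  "('p \<Rightarrow> 'c) \<Rightarrow> ('p \<Rightarrow> 'c) \<Rightarrow> ('c \<Rightarrow> real) \<Rightarrow> ('c \<Rightarrow> real) \<Rightarrow> ('c \<Rightarrow> 'c \<Rightarrow> real) \<Rightarrow>
   ('c \<Rightarrow> real) \<Rightarrow> ('c \<Rightarrow> 'c \<Rightarrow> real) \<Rightarrow> 'p \<Rightarrow> 'p \<Rightarrow> real" where
  "double_bracket_term X Y u v v2 w w2 p q =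
     u (X p) * (v2 (Y p) (X q) * w (Y q) + v (X q) * w2 (Y p) (Y q)
              - (v2 (Y p) (Y q) * w (X q) + v (Y q) * w2 (Y p) (X q)))
   - u (Y p) * (v2 (X p) (X q) * w (Y q) + v (X q) * w2 (X p) (Y q)
              - (v2 (X p) (Y q) * w (X q) + v (Y q) * w2 (X p) (X q)))"

text \<open>Once second derivatives are symmetric, the cyclic sum of the terms changes sign when p
  and q are exchanged. The double sum over all pairs therefore equals its own negative.\<close>

lemma double_bracket_cyclic_sum:
  assumes sym: "\<And>a b. a \<in> X ` I \<union> Y ` I \<Longrightarrow> b \<in> X ` I \<union> Y ` I \<Longrightarrow>
    u2 a b = u2 b a \<and> v2 a b = v2 b a \<and> w2 a b = w2 b a"
  shows "(\<Sum>p\<in>I. \<Sum>q\<in>I. double_bracket_term X Y u v v2 w w2 p q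
    + double_bracket_term X Y v w w2 u u2 p q + double_bracket_term X Y w u u2 v v2 p q) = 0"
proof -
  let ?T = "\<lambda>p q. double_bracket_term X Y u v v2 w w2 p q
    + double_bracket_term X Y v w w2 u u2 p q + double_bracket_term X Y w u u2 v v2 p q"
  have "?T q p = - ?T p q" if "p \<in> I" "q \<in> I" for p q
  proof -
    have eqs: "u2 (X q) (X p) = u2 (X p) (X q)" "u2 (X q) (Y p) = u2 (Y p) (X q)"
      "u2 (Y q) (X p) = u2 (X p) (Y q)" "u2 (Y q) (Y p) = u2 (Y p) (Y q)"
      "v2 (X q) (X p) = v2 (X p) (X q)" "v2 (X q) (Y p) = v2 (Y p) (X q)"
      "v2 (Y q) (X p) = v2 (X p) (Y q)" "v2 (Y q) (Y p) = v2 (Y p) (Y q)"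
      "w2 (X q) (X p) = w2 (X p) (X q)" "w2 (X q) (Y p) = w2 (Y p) (X q)"
      "w2 (Y q) (X p) = w2 (X p) (Y q)" "w2 (Y q) (Y p) = w2 (Y p) (Y q)"
      using sym that by blast+
    show ?thesis unfolding double_bracket_term_def eqs by (simp add: algebra_simps)
  qed
  then have "(\<Sum>p\<in>I. \<Sum>q\<in>I. ?T q p) = (\<Sum>p\<in>I. \<Sum>q\<in>I. - ?T p q)"
    by (intro sum.cong refl) blast
  moreover have "(\<Sum>p\<in>I. \<Sum>q\<in>I. ?T q p) = (\<Sum>p\<in>I. \<Sum>q\<in>I. ?T p q)" by (rule sum.swap)
  ultimately show ?thesis by (simp only: sum_negf)
qed

lemma partial_canonical_bracket:
  assumes A: "A \<subseteq> {1..N}" and a: "a \<in> coords N" and \<Phi>: "smooth N \<Phi>" and \<Psi>: "smooth N \<Psi>"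
  shows "partial a (canonical_bracket A \<Phi> \<Psi>) z = (\<Sum>q\<in>A \<times> UNIV.
      partial a (partial (x_coord q) \<Phi>) z * partial (v_coord q) \<Psi> z
      + partial (x_coord q) \<Phi> z * partial a (partial (v_coord q) \<Psi>) z
      - (partial a (partial (v_coord q) \<Phi>) z * partial (x_coord q) \<Psi> z
      + partial (v_coord q) \<Phi> z * partial a (partial (x_coord q) \<Psi>) z))"
proof -
  have prod: "((\<lambda>t. partial b f (shift a t z) * partial c g (shift a t z)) has_real_derivative
      partial a (partial b f) z * partial c g z + partial b f z * partial a (partial c g) z) (at 0)"
    if "smooth N f" "smooth N g" "b \<in> coords N" "c \<in> coords N" for f g b c
    using DERIV_mult[OF smooth_has_partial[OF smooth_partial[OF that(1,3)] a, of z]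
        smooth_has_partial[OF smooth_partial[OF that(2,4)] a, of z]]
    by (simp add: mult.commute)
  show ?thesis
    unfolding partial_def[of a "canonical_bracket A \<Phi> \<Psi>"]
  proof (rule DERIV_imp_deriv, unfold canonical_bracket_def, rule DERIV_sum)
    fix q :: "nat \<times> 'a" assume q: "q \<in> A \<times> UNIV"
    note c = particle_coords[OF A q]
    show "((\<lambda>t. partial (x_coord q) \<Phi> (shift a t z) * partial (v_coord q) \<Psi> (shift a t z)
        - partial (v_coord q) \<Phi> (shift a t z) * partial (x_coord q) \<Psi> (shift a t z)) has_real_derivative
      partial a (partial (x_coord q) \<Phi>) z * partial (v_coord q) \<Psi> z
      + partial (x_coord q) \<Phi> z * partial a (partial (v_coord q) \<Psi>) z
      - (partial a (partial (v_coord q) \<Phi>) z * partial (x_coord q) \<Psi> z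
      + partial (v_coord q) \<Phi> z * partial a (partial (x_coord q) \<Psi>) z)) (at 0)"
      by (rule DERIV_diff[OF prod[OF \<Phi> \<Psi> c] prod[OF \<Phi> \<Psi> c(2,1)]])
  qed
qed

lemma canonical_bracket_jacobi:
  fixes \<Phi> :: "'d::finite config \<Rightarrow> real"
  assumes A: "A \<subseteq> {1..N}" and s: "smooth N \<Phi>" "smooth N \<Psi>" "smooth N \<Theta>"
  shows "canonical_bracket A \<Phi> (canonical_bracket A \<Psi> \<Theta>) z
    + canonical_bracket A \<Psi> (canonical_bracket A \<Theta> \<Phi>) z
    + canonical_bracket A \<Theta> (canonical_bracket A \<Phi> \<Psi>) z = 0"
proof -
  let ?I = "A \<times> (UNIV :: 'd set)"
  let ?D = "\<lambda>f a. partial a f z" and ?D2 = "\<lambda>f a b. partial a (partial b f) z"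
  have expand: "canonical_bracket A f (canonical_bracket A g h) z =
      (\<Sum>p\<in>?I. \<Sum>q\<in>?I. double_bracket_term x_coord v_coord (?D f) (?D g) (?D2 g) (?D h) (?D2 h) p q)"
    if "smooth N g" "smooth N h" for f g h
    unfolding canonical_bracket_def[of A f]
  proof (intro sum.cong refl)
    fix p assume p: "p \<in> ?I"
    note c = particle_coords[OF A p]
    show "partial (x_coord p) f z * partial (v_coord p) (canonical_bracket A g h) z
        - partial (v_coord p) f z * partial (x_coord p) (canonical_bracket A g h) z =
      (\<Sum>q\<in>?I. double_bracket_term x_coord v_coord (?D f) (?D g) (?D2 g) (?D h) (?D2 h) p q)"
      unfolding partial_canonical_bracket[OF A c(1) that] partial_canonical_bracket[OF A c(2) that]
        double_bracket_term_def sum_subtractf[symmetric] sum_distrib_left ..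
  qed
  have coords: "a \<in> coords N" if "a \<in> x_coord ` ?I \<union> v_coord ` ?I" for a
    using that particle_coords[OF A] by blast
  show ?thesis
    unfolding expand[OF s(2,3)] expand[OF s(3,1)] expand[OF s(1,2)] sum.distrib[symmetric]
    by (rule double_bracket_cyclic_sum) (simp add: partial_commute[OF s(1)] partial_commute[OF s(2)]
        partial_commute[OF s(3)] coords)
qed

section \<open>Separation of hierarchies by particle functions\<close>

definition onto_sum :: "nat set \<Rightarrow> nat \<Rightarrow> ('d::finite config \<Rightarrow> real) \<Rightarrow> 'd config \<Rightarrow> real" where
  "onto_sum A k h z = (\<Sum>m | m \<in> tuples A k \<and> m ` {1..k} = A. h (\<lambda>i. z (m i)))"

text \<open>Each tuple is counted under the set of labels that occur in it.\<close>

lemma particle_sum_onto: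
  assumes A: "finite A" shows "particle_sum A k h z = (\<Sum>B\<in>Pow A. onto_sum B k h z)"
proof -
  have "particle_sum A k h z = (\<Sum>B\<in>Pow A. \<Sum>m | m \<in> tuples A k \<and> m ` {1..k} = B. h (\<lambda>i. z (m i)))"
    unfolding particle_sum_def
    by (rule sum.group[symmetric]) (use A in \<open>auto simp: finite_tuples[OF A] simp del: One_nat_def\<close>)
  also have "\<dots> = (\<Sum>B\<in>Pow A. onto_sum B k h z)"
    unfolding onto_sum_def by (intro sum.cong refl) (auto simp: PiE_iff)
  finally show ?thesis .
qed

text \<open>Induction on the finite set A replaces inclusion-exclusion: in the sum over all subsets
  of A, the proper ones already contribute 0.\<close>

lemma onto_sum_zero:
  assumes F: "\<And>A z. A \<subseteq> {1..N} \<Longrightarrow> particle A F z = 0" and A: "A \<subseteq> {1..N}"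
  shows "(\<Sum>k\<in>supp F. onto_sum A k (component F k) z) = 0"
proof -
  have "finite A" using A finite_subset by blast
  then show ?thesis using A
  proof (induction A rule: finite_psubset_induct)
    case (psubset A)
    have "0 = particle A F z" using F[OF psubset.prems] by simp
    also have "\<dots> = (\<Sum>B\<in>Pow A. \<Sum>k\<in>supp F. onto_sum B k (component F k) z)"
      unfolding particle_def particle_sum_onto[OF psubset.hyps(1)] by (rule sum.swap)
    also have "\<dots> = (\<Sum>B\<in>{A}. \<Sum>k\<in>supp F. onto_sum B k (component F k) z)"
      by (rule sum.mono_neutral_right) (use psubset in auto)
    finally show ?case by simp
  qed
qed

lemma onto_sum_less:
  assumes "k < N" shows "onto_sum {1..N} k h z = 0"
proof -
  have "m ` {1..k} \<noteq> {1..N}" for m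
    using card_image_le[of "{1..k}" m] assms by auto
  then show ?thesis unfolding onto_sum_def by (simp only: simp_thms) simp
qed

text \<open>A tuple of k labels onto \<open>{1..k}\<close> is a permutation, and f is invariant
  under it, so every summand is \<open>f z\<close>.\<close>

lemma onto_sum_obs:
  assumes f: "f \<in> obs k"
  shows "onto_sum {1..k} k f z = real (card {m. m \<in> tuples {1..k} k \<and> m ` {1..k} = {1..k}}) * f z"
proof -
  have "f (\<lambda>i. z (m i)) = f z" if m: "m ` {1..k} = {1..k}" for m
  proof -
    \<comment> \<open>Tuples are undefined outside \<open>{1..k}\<close>; putting the identity there
      gives a permutation in the sense of \<open>permutes\<close>.\<close>
    define \<pi> where "\<pi> i = (if i \<in> {1..k} then m i else i)" for i
    have im: "\<pi> ` {1..k} = {1..k}" using m by (simp add: \<pi>_def)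
    have "\<pi> permutes {1..k}"
      by (rule bij_imp_permutes) (use im in \<open>auto simp: bij_betw_def \<pi>_def intro: eq_card_imp_inj_on\<close>)
    from obs_permute[OF f this, of z] show ?thesis
      using obs_cong[OF f, of "\<lambda>i. z (m i)" "\<lambda>i. z (\<pi> i)"] by (simp add: \<pi>_def)
  qed
  then have "onto_sum {1..k} k f z = (\<Sum>m | m \<in> tuples {1..k} k \<and> m ` {1..k} = {1..k}. f z)"
    unfolding onto_sum_def by (intro sum.cong refl) blast
  then show ?thesis by simp
qed

lemma particle_injective:
  assumes F: "\<And>N A z. A \<subseteq> {1..N} \<Longrightarrow> particle A F z = 0" shows "F = 0"
proof (rule ccontr)
  assume "F \<noteq> 0"
  then have ne: "supp F \<noteq> {}" using hierarchy_expand[of F] by auto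
  define K where "K = Max (supp F)"
  have K: "K \<in> supp F" "\<And>k. k \<in> supp F \<Longrightarrow> k \<le> K" using ne finite_supp[of F] by (auto simp: K_def)
  have f: "component F K \<in> obs K" by (rule component_obs[OF supp_pos[OF K(1)]])
  let ?S = "{m. m \<in> tuples {1..K} K \<and> m ` {1..K} = {1..K}}"
  \<comment> \<open>The identity tuple is onto, so the number of surjective tuples is not 0 and can
    be cancelled.\<close>
  have "restrict id {1..K} \<in> ?S" by auto
  then have "?S \<noteq> {}" by blast
  moreover have "finite ?S" by (rule finite_subset[OF _ finite_tuples[of "{1..K}" K]]) auto
  ultimately have card: "card ?S \<noteq> 0" by (simp only: card_eq_0_iff) simp
  have "component F K z = 0" for z
  proof -
    have "0 = (\<Sum>k\<in>supp F. onto_sum {1..K} k (component F k) z)"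
      using onto_sum_zero[where A = "{1..K}" and N = K and F = F and z = z, OF F] by simp
    also have "\<dots> = (\<Sum>k\<in>{K}. onto_sum {1..K} k (component F k) z)"
    proof (rule sum.mono_neutral_right)
      show "\<forall>k\<in>supp F - {K}. onto_sum {1..K} k (component F k) z = 0"
        using K(2) by (intro ballI onto_sum_less) (simp add: order.strict_iff_order)
    qed (use K(1) finite_supp[of F] in auto)
    finally show ?thesis using card onto_sum_obs[OF f, of z] by (simp del: One_nat_def)
  qed
  then show False using K(1) by (auto simp: supp_def)
qed

lemma bracket_jacobi:
  "hierarchy_bracket F (hierarchy_bracket G H) + hierarchy_bracket G (hierarchy_bracket H F)
    + hierarchy_bracket H (hierarchy_bracket F G) = 0"
proof (rule particle_injective)
  fix N and A :: "nat set" and z :: "'a config" assume A: "A \<subseteq> {1..N}"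
  have eq: "particle A (hierarchy_bracket F G) = canonical_bracket A (particle A F) (particle A G)" for F G :: "'a hierarchy"
    by (rule ext) (rule particle_bracket[OF A])
  show "particle A (hierarchy_bracket F (hierarchy_bracket G H) + hierarchy_bracket G (hierarchy_bracket H F)
    + hierarchy_bracket H (hierarchy_bracket F G)) z = 0"
    unfolding particle_add eq
    by (rule canonical_bracket_jacobi[OF A smooth_particle smooth_particle smooth_particle])
qed

subsection \<open>Gateaux smooth polynomial maps on the strong dual\<close>

lemma tendsto_scaleR_lcs:
  fixes g :: "'a \<Rightarrow> 'b::locally_convex_space"
  assumes "(f \<longlongrightarrow> a) F" "(g \<longlongrightarrow> b) F" shows "((\<lambda>x. f x *\<^sub>R g x) \<longlongrightarrow> a *\<^sub>R b) F"
  using filterlim_compose[OF tendsto_scaleR_nhds filterlim_Pair[OF assms]] by simp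

lemma continuous_on_scaleR_lcs:
  fixes g :: "'a::topological_space \<Rightarrow> 'b::locally_convex_space"
  assumes "continuous_on S f" "continuous_on S g" shows "continuous_on S (\<lambda>x. f x *\<^sub>R g x)"
  using assms unfolding continuous_on_def by (blast intro: tendsto_scaleR_lcs)

lemma pairing_add: "pairing (L + M) x = pairing L x + pairing M x"
  and pairing_scale: "pairing (c *\<^sub>R L) x = c * pairing L x"
  by (simp_all add: pairing_simps)

text \<open>Singletons are bounded, so their polars are neighbourhoods of 0; the scaling
  \<open>2 / e\<close> bounds the value by e / 2 on the polar.\<close>

lemma continuous_pairing_left: "continuous_on UNIV (\<lambda>L. pairing L x)"
  unfolding continuous_on_def
proof (intro ballI tendstoI)
  fix L :: "'a strong_dual" and e :: real assume e: "e > 0"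
  let ?U = "{M. \<forall>y\<in>{(2 / e) *\<^sub>R x}. \<bar>pairing M y\<bar> \<le> 1}"
  have "polar_nhd ?U" by (rule polar_nhdI[OF vn_bounded_singleton])
  moreover have "dist (pairing (L + M) x) (pairing L x) < e" if "M \<in> ?U" for M
  proof -
    have "2 / e * \<bar>pairing M x\<bar> \<le> 1" using that e by (simp add: linear_scale[OF linear_pairing] abs_mult)
    then have "2 * \<bar>pairing M x\<bar> \<le> e" using e by (simp add: field_simps)
    then show ?thesis using e by (simp add: dist_real_def pairing_add)
  qed
  ultimately have "\<forall>\<^sub>F M in nhds L. dist (pairing M x) (pairing L x) < e"
    unfolding strong_dual.eventually_nhds_N by blast
  then show "\<forall>\<^sub>F M in at L. dist (pairing M x) (pairing L x) < e"
    by (simp add: eventually_at_filter eventually_mono)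
qed

section \<open>Transposes of continuous linear maps\<close>

lemma vn_bounded_image:
  fixes T :: "'a::locally_convex_space \<Rightarrow> 'b::locally_convex_space"
  assumes T: "linear T" "continuous_on UNIV T" and B: "vn_bounded B" shows "vn_bounded (T ` B)"
  unfolding vn_bounded_def
proof (intro allI impI)
  fix U :: "'b set" assume U: "open U" "0 \<in> U"
  have "open (T -` U)" using T(2) U(1) by (simp add: continuous_on_open_vimage)
  moreover have "0 \<in> T -` U" using U(2) by (simp add: linear_0[OF T(1)])
  ultimately obtain s where s: "s > 0" "\<forall>t\<ge>s. B \<subseteq> (*\<^sub>R) t ` (T -` U)"
    using B unfolding vn_bounded_def by meson
  have "T ` B \<subseteq> (*\<^sub>R) t ` U" if t: "t \<ge> s" for t
  proof (rule image_subsetI)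
    fix x assume "x \<in> B"
    then obtain u where "x = t *\<^sub>R u" "T u \<in> U" using s(2) t by blast
    then show "T x \<in> (*\<^sub>R) t ` U" by (auto simp: linear_scale[OF T(1)])
  qed
  then show "\<exists>s>0. \<forall>t\<ge>s. T ` B \<subseteq> (*\<^sub>R) t ` U" using s(1) by blast
qed

text \<open>The transpose of \<open>T\<close>, meaningful for continuous linear \<open>T\<close>;
  otherwise \<open>Abs_strong_dual\<close> leaves the value unspecified.\<close>

definition dual_map :: "('a::locally_convex_space \<Rightarrow> 'b::locally_convex_space) \<Rightarrow> 'b strong_dual \<Rightarrow> 'a strong_dual" where
  "dual_map T L = Abs_strong_dual (\<lambda>x. pairing L (T x))"

lemma pairing_dual_map:
  assumes "linear T" "continuous_on UNIV T" shows "pairing (dual_map T L) x = pairing L (T x)"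
proof -
  have "linear (\<lambda>x. pairing L (T x))" using linear_compose[OF assms(1) linear_pairing] by (simp add: comp_def)
  moreover have "continuous_on UNIV (\<lambda>x. pairing L (T x))"
    by (rule continuous_on_compose2[OF continuous_pairing assms(2)]) simp
  ultimately show ?thesis by (simp add: dual_map_def Abs_strong_dual_inverse)
qed

lemma linear_dual_map:
  assumes "linear T" "continuous_on UNIV T" shows "linear (dual_map T)"
  by (intro linearI strong_dual_eqI) (simp_all add: pairing_dual_map[OF assms] pairing_simps)

text \<open>Continuous linear maps preserve bounded sets, and the transpose carries the polar of the
  image of B into the polar of B.\<close>

lemma continuous_dual_map:
  fixes T :: "'a::locally_convex_space \<Rightarrow> 'b::locally_convex_space"
  assumes T: "linear T" "continuous_on UNIV T" shows "continuous_on UNIV (dual_map T)"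
  unfolding continuous_on_open_vimage[OF open_UNIV]
proof (intro allI impI)
  fix W :: "'a strong_dual set" assume W: "open W"
  have "\<exists>V. polar_nhd V \<and> (\<forall>M\<in>V. L + M \<in> dual_map T -` W)" if L: "dual_map T L \<in> W" for L
  proof -
    obtain B where B: "vn_bounded B" "\<And>M. \<forall>x\<in>B. \<bar>pairing M x\<bar> \<le> 1 \<Longrightarrow> dual_map T L + M \<in> W"
      using W L unfolding open_strong_dual_def lc_open_def polar_nhd_def by blast
    let ?V = "{M. \<forall>x\<in>T ` B. \<bar>pairing M x\<bar> \<le> 1}"
    have "polar_nhd ?V" by (rule polar_nhdI[OF vn_bounded_image[OF T B(1)]])
    moreover have "L + M \<in> dual_map T -` W" if "M \<in> ?V" for M
      using that B(2)[of "dual_map T M"] by (simp add: linear_add[OF linear_dual_map[OF T]] pairing_dual_map[OF T])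
    ultimately show ?thesis by blast
  qed
  then have "open (dual_map T -` W)" unfolding open_strong_dual_def lc_open_def by blast
  then show "open (dual_map T -` W \<inter> UNIV)" by simp
qed

text \<open>Contains the polynomial functionals and, in the form \<open>x\<close>, \<open>v 0\<close>, \<open>v 1\<close>, \<open>\<dots>\<close> of \<^const>\<open>gateaux\<close>, all
  their iterated directional derivatives.\<close>

inductive jet :: "('a::locally_convex_space strong_dual \<Rightarrow> (nat \<Rightarrow> 'a strong_dual) \<Rightarrow> real) \<Rightarrow> bool" where
  jet_const: "jet (\<lambda>x v. c)"
| jet_base: "jet (\<lambda>x v. pairing x F)"
| jet_direction: "jet (\<lambda>x v. pairing (v i) F)"
| jet_add: "jet q \<Longrightarrow> jet r \<Longrightarrow> jet (\<lambda>x v. q x v + r x v)"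
| jet_mult: "jet q \<Longrightarrow> jet r \<Longrightarrow> jet (\<lambda>x v. q x v * r x v)"

lemma continuous_direction: "continuous_on UNIV (\<lambda>p. snd p i)"
  by (rule continuous_on_product_then_coordinatewise[OF continuous_on_snd[OF continuous_on_id]])

lemma continuous_jet: "jet q \<Longrightarrow> continuous_on UNIV (\<lambda>p. q (fst p) (snd p))"
proof (induction rule: jet.induct)
  case (jet_base F)
  show ?case
    by (rule continuous_on_compose2[OF continuous_pairing_left continuous_on_fst[OF continuous_on_id]]) simp
next
  case (jet_direction i F)
  show ?case
    by (rule continuous_on_compose2[OF continuous_pairing_left continuous_direction]) simp
qed (simp_all add: continuous_on_add continuous_on_mult)

lemma has_derivative_pairing_line: "((\<lambda>t. pairing (x + t *\<^sub>R v) F) has_real_derivative pairing v F) (at 0)"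
  unfolding pairing_add pairing_scale by (auto intro!: derivative_eq_intros)

text \<open>Differentiation acts on x along \<open>v n\<close> while all directions are held fixed.
  Thus \<open>pairing x F\<close> becomes \<open>pairing (v n) F\<close>, and factors in the
  directions are constants.\<close>

lemma jet_derivative:
  "jet q \<Longrightarrow> \<exists>q'. jet q' \<and> (\<forall>x v. ((\<lambda>t. q (x + t *\<^sub>R v n) v) has_real_derivative q' x v) (at 0))"
proof (induction rule: jet.induct)
  case (jet_const c)
  show ?case by (intro exI[of _ "\<lambda>x v. 0"]) (simp add: jet.jet_const)
next
  case (jet_base F)
  show ?case
    by (intro exI[of _ "\<lambda>x v. pairing (v n) F"]) (simp add: jet.jet_direction has_derivative_pairing_line)
next
  case (jet_direction i F)
  show ?case by (intro exI[of _ "\<lambda>x v. 0"]) (simp add: jet.jet_const)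
next
  case (jet_add q r)
  then obtain q' r' where "jet q'" "jet r'"
    and d: "\<And>x v. ((\<lambda>t. q (x + t *\<^sub>R v n) v) has_real_derivative q' x v) (at 0)"
      "\<And>x v. ((\<lambda>t. r (x + t *\<^sub>R v n) v) has_real_derivative r' x v) (at 0)"
    by blast
  then show ?case
    by (intro exI[of _ "\<lambda>x v. q' x v + r' x v"]) (simp add: jet.jet_add DERIV_add[OF d])
next
  case (jet_mult q r)
  then obtain q' r' where j: "jet q'" "jet r'"
    and d: "\<And>x v. ((\<lambda>t. q (x + t *\<^sub>R v n) v) has_real_derivative q' x v) (at 0)"
      "\<And>x v. ((\<lambda>t. r (x + t *\<^sub>R v n) v) has_real_derivative r' x v) (at 0)"
    by blast
  have "((\<lambda>t. q (x + t *\<^sub>R v n) v * r (x + t *\<^sub>R v n) v) has_real_derivative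
      q' x v * r x v + q x v * r' x v) (at 0)" for x v
    using DERIV_mult[OF d(1) d(2), of x v x v] by (simp add: mult.commute)
  then show ?case
    using j jet_mult.hyps by (intro exI[of _ "\<lambda>x v. q' x v * r x v + q x v * r' x v"]) (simp add: jet.jet_add jet.jet_mult)
qed

lemma DERIV_iff_gateaux_quotient:
  "((\<lambda>t. (1 / t) *\<^sub>R (f t - f 0)) \<longlongrightarrow> l) (at 0) \<longleftrightarrow> (f has_real_derivative l) (at 0)"
  by (simp add: DERIV_def)

lemma jet_gateaux_derivative:
  "jet q \<Longrightarrow> \<exists>q'. jet q' \<and>
    (\<forall>x v. ((\<lambda>t. (1 / t) *\<^sub>R (q (x + t *\<^sub>R v n) v - q x v)) \<longlongrightarrow> q' x v) (at (0::real)))"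
  using jet_derivative[of q n] by (simp add: DERIV_def)

text \<open>In the application \<open>T\<close> is the transpose of G \<mapsto> [G, F]. Directions
  must be allowed inside \<open>T\<close>, because differentiating \<open>T x\<close> produces
  \<open>T (v n)\<close>.\<close>

inductive vector_jet ::
  "('a::locally_convex_space strong_dual \<Rightarrow> (nat \<Rightarrow> 'a strong_dual) \<Rightarrow> 'a strong_dual) \<Rightarrow> bool" where
  vector_jet_base: "jet q \<Longrightarrow> linear T \<Longrightarrow> continuous_on UNIV T \<Longrightarrow> vector_jet (\<lambda>x v. q x v *\<^sub>R T x)"
| vector_jet_direction: "jet q \<Longrightarrow> linear T \<Longrightarrow> continuous_on UNIV T \<Longrightarrow> vector_jet (\<lambda>x v. q x v *\<^sub>R T (v i))"
| vector_jet_add: "vector_jet Q \<Longrightarrow> vector_jet R \<Longrightarrow> vector_jet (\<lambda>x v. Q x v + R x v)"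

lemma continuous_vector_jet: "vector_jet Q \<Longrightarrow> continuous_on UNIV (\<lambda>p. Q (fst p) (snd p))"
proof (induction rule: vector_jet.induct)
  case (vector_jet_base q T)
  show ?case
    by (rule continuous_on_scaleR_lcs[OF continuous_jet[OF vector_jet_base(1)]
          continuous_on_compose2[OF vector_jet_base(3) continuous_on_fst[OF continuous_on_id]]]) simp
next
  case (vector_jet_direction q T i)
  show ?case
    by (rule continuous_on_scaleR_lcs[OF continuous_jet[OF vector_jet_direction(1)]
          continuous_on_compose2[OF vector_jet_direction(3) continuous_direction]]) simp
qed (rule continuous_on_add)

lemma vector_jet_derivative:
  fixes Q :: "'a::locally_convex_space strong_dual \<Rightarrow> (nat \<Rightarrow> 'a strong_dual) \<Rightarrow> 'a strong_dual"
  assumes "vector_jet Q"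
  shows "\<exists>Q'. vector_jet Q' \<and>
    (\<forall>x v. ((\<lambda>t. (1 / t) *\<^sub>R (Q (x + t *\<^sub>R v n) v - Q x v)) \<longlongrightarrow> Q' x v) (at (0::real)))"
  using assms
proof (induction rule: vector_jet.induct)
  case (vector_jet_base q T)
  obtain q' where q': "jet q'" "\<And>x v. ((\<lambda>t. q (x + t *\<^sub>R v n) v) has_real_derivative q' x v) (at 0)"
    using jet_derivative[OF vector_jet_base(1)] by blast
  have "((\<lambda>t. (1 / t) *\<^sub>R (q (x + t *\<^sub>R v n) v *\<^sub>R T (x + t *\<^sub>R v n) - q x v *\<^sub>R T x))
      \<longlongrightarrow> q' x v *\<^sub>R T x + q x v *\<^sub>R T (v n)) (at (0::real))" for x v
  \<comment> \<open>By linearity of \<open>T\<close>, the quotient is regrouped into the quotient of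
    q times \<open>T x\<close>, plus q at the moved point times \<open>T (v n)\<close>; both parts
    have limits.\<close>
  proof (rule Lim_transform_eventually)
    have "((\<lambda>t. q (x + t *\<^sub>R v n) v) \<longlongrightarrow> q x v) (at 0)"
      using DERIV_isCont[OF q'(2), of x v] by (simp add: isCont_def)
    moreover have "((\<lambda>t. (q (x + t *\<^sub>R v n) v - q x v) / t) \<longlongrightarrow> q' x v) (at 0)"
      using q'(2)[of x v] by (simp add: DERIV_def)
    ultimately show "((\<lambda>t. ((q (x + t *\<^sub>R v n) v - q x v) / t) *\<^sub>R T x + q (x + t *\<^sub>R v n) v *\<^sub>R T (v n))
        \<longlongrightarrow> q' x v *\<^sub>R T x + q x v *\<^sub>R T (v n)) (at (0::real))"
      by (intro tendsto_add tendsto_scaleR_lcs tendsto_const)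
    show "\<forall>\<^sub>F t in at (0::real).
        ((q (x + t *\<^sub>R v n) v - q x v) / t) *\<^sub>R T x + q (x + t *\<^sub>R v n) v *\<^sub>R T (v n) =
        (1 / t) *\<^sub>R (q (x + t *\<^sub>R v n) v *\<^sub>R T (x + t *\<^sub>R v n) - q x v *\<^sub>R T x)"
      unfolding eventually_at_filter
      by (intro always_eventually allI impI)
        (simp add: linear_add[OF vector_jet_base(2)] linear_scale[OF vector_jet_base(2)] scaleR_right_distrib
          scaleR_diff_right scaleR_diff_left diff_divide_distrib)
  qed
  moreover have "vector_jet (\<lambda>x v. q' x v *\<^sub>R T x + q x v *\<^sub>R T (v n))"
    using vector_jet_base q'(1) by (intro vector_jet_add vector_jet.vector_jet_base vector_jet_direction)
  ultimately show ?case by blast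
next
  case (vector_jet_direction q T i)
  obtain q' where q': "jet q'" "\<And>x v. ((\<lambda>t. q (x + t *\<^sub>R v n) v) has_real_derivative q' x v) (at 0)"
    using jet_derivative[OF vector_jet_direction(1)] by blast
  have "((\<lambda>t. (1 / t) *\<^sub>R (q (x + t *\<^sub>R v n) v *\<^sub>R T (v i) - q x v *\<^sub>R T (v i)))
      \<longlongrightarrow> q' x v *\<^sub>R T (v i)) (at (0::real))" for x v
  proof -
    have "((\<lambda>t. (q (x + t *\<^sub>R v n) v - q x v) / t) \<longlongrightarrow> q' x v) (at 0)"
      using q'(2)[of x v] by (simp add: DERIV_def)
    from tendsto_scaleR_lcs[OF this tendsto_const]
    show ?thesis by (simp add: scaleR_diff_left[symmetric])
  qed
  then show ?case
    using vector_jet_direction q'(1) vector_jet.vector_jet_direction by blast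
next
  case (vector_jet_add Q R)
  then obtain Q' R' where j: "vector_jet Q'" "vector_jet R'"
    and d: "\<And>x v. ((\<lambda>t. (1 / t) *\<^sub>R (Q (x + t *\<^sub>R v n) v - Q x v)) \<longlongrightarrow> Q' x v) (at (0::real))"
      "\<And>x v. ((\<lambda>t. (1 / t) *\<^sub>R (R (x + t *\<^sub>R v n) v - R x v)) \<longlongrightarrow> R' x v) (at (0::real))"
    by blast
  have "((\<lambda>t. (1 / t) *\<^sub>R (Q (x + t *\<^sub>R v n) v + R (x + t *\<^sub>R v n) v - (Q x v + R x v)))
      \<longlongrightarrow> Q' x v + R' x v) (at (0::real))" for x v
    using tendsto_add[OF d(1) d(2), of x v x v] by (simp only: scaleR_add_right[symmetric] add_diff_add)
  then show ?case using vector_jet.vector_jet_add[OF j] by blast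
qed

text \<open>\<open>gateaux\<close> takes each derivative as a \<open>Lim\<close>, so an established
  limit identifies the next one by uniqueness. All iterated derivatives thus stay in the class
  \<open>P\<close>, as in \<open>smooth_coinduct\<close>.\<close>

lemma gateaux_smoothI:
  fixes f :: "'a::locally_convex_space \<Rightarrow> 'b::locally_convex_space"
    and P :: "('a \<Rightarrow> (nat \<Rightarrow> 'a) \<Rightarrow> 'b) \<Rightarrow> bool"
  assumes "P (\<lambda>x v. f x)"
    and cont: "\<And>q. P q \<Longrightarrow> continuous_on UNIV (\<lambda>p. q (fst p) (snd p))"
    and deriv: "\<And>q n. P q \<Longrightarrow> \<exists>q'. P q' \<and>
      (\<forall>x v. ((\<lambda>t. (1 / t) *\<^sub>R (q (x + t *\<^sub>R v n) v - q x v)) \<longlongrightarrow> q' x v) (at (0::real)))"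
  shows "gateaux_smooth f"
proof -
  have P: "P (gateaux n f)" for n
  proof (induction n)
    case 0
    have "gateaux 0 f = (\<lambda>x v. f x)" by (intro ext) simp
    then show ?case using assms(1) by simp
  next
    case (Suc n)
    obtain q' where q': "P q'"
      "\<And>x v. ((\<lambda>t. (1 / t) *\<^sub>R (gateaux n f (x + t *\<^sub>R v n) v - gateaux n f x v)) \<longlongrightarrow> q' x v) (at (0::real))"
      using deriv[OF Suc, of n] by blast
    have "gateaux (Suc n) f = q'"
      by (intro ext) (simp add: tendsto_Lim[OF _ q'(2)])
    then show ?case using q'(1) by simp
  qed
  show ?thesis
    unfolding gateaux_smooth_def case_prod_unfold using cont[OF P] deriv[OF P] by blast
qed

subsection \<open>Gradients and the Poisson algebra\<close>

lemma direct_sum_nhd_component: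
  fixes z :: "'d::finite config"
  assumes e: "e > 0" shows "direct_sum_nhd {F. \<bar>component F k z\<bar> < e}"
  unfolding direct_sum_nhd_iff
proof (intro conjI allI impI)
  have "convex ((\<lambda>F. component F k z) -` ball 0 e)"
    by (intro convex_linear_vimage linearI convex_ball) (simp_all add: component_simps)
  then show "convex {F. \<bar>component F k z\<bar> < e}" by (simp add: vimage_def dist_real_def)
  show "balanced {F. \<bar>component F k z\<bar> < e}"
    unfolding balanced_def
    by (auto simp: component_simps abs_mult intro: le_less_trans[OF mult_left_le_one_le])
  fix j :: nat assume j: "j \<ge> 1"
  show "\<exists>n K d. compact K \<and> K \<noteq> {} \<and> 0 < d \<and>
      (\<forall>f\<in>obs j. obs_seminorm j n K f < d \<longrightarrow> incl j f \<in> {F. \<bar>component F k z\<bar> < e})"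
  proof (intro exI[of _ "0::nat"] exI[of _ "{z}"] exI[of _ e] conjI ballI impI)
    fix f :: "'d config \<Rightarrow> real" assume f: "f \<in> obs j" "obs_seminorm j 0 {z} f < e"
    have "\<bar>foldr partial [] f z\<bar> \<le> obs_seminorm j 0 {z} f"
      by (rule obs_seminorm_upper[OF f(1)]) simp_all
    then show "incl j f \<in> {F. \<bar>component F k z\<bar> < e}" using f j e by (auto simp: component_incl)
  qed (use e in simp_all)
qed

text \<open>Evaluating a component at a configuration is a continuous linear functional, and these
  evaluations determine an element. This gives the uniqueness that the description in
  \<open>gradient\<close> relies on.\<close>

lemma pairing_separates:
  fixes F G :: "'d::finite hierarchy"
  assumes "\<And>L. pairing L F = pairing L G" shows "F = G"
proof (rule hierarchy_eqI)
  fix k and z :: "'d config"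
  let ?E = "\<lambda>F. component F k z"
  have lin: "linear ?E" by (rule linearI) (simp_all add: component_simps)
  have "continuous_on UNIV ?E"
    unfolding continuous_on_def
  proof (intro ballI tendstoI)
    fix F :: "'d hierarchy" and e :: real assume "e > 0"
    then have "\<forall>\<^sub>F G in nhds F. dist (?E G) (?E F) < e"
      unfolding direct_sum.eventually_nhds_N
      by (intro exI[of _ "{F. \<bar>?E F\<bar> < e}"]) (simp add: direct_sum_nhd_component component_simps dist_real_def)
    then show "\<forall>\<^sub>F G in at F. dist (?E G) (?E F) < e"
      by (simp add: eventually_at_filter eventually_mono)
  qed
  then have "pairing (Abs_strong_dual ?E) = ?E" using lin by (simp add: Abs_strong_dual_inverse)
  then show "?E F = ?E G" using assms by metis
qed

text \<open>Asks that the limit exists, whereas \<open>gateaux_deriv\<close> is a \<open>Lim\<close>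
  and always has a value; sum and product rules need the former.\<close>

definition has_gradient :: "('d::finite hierarchy strong_dual \<Rightarrow> real) \<Rightarrow> 'd hierarchy strong_dual \<Rightarrow> 'd hierarchy \<Rightarrow> bool" where
  "has_gradient f x F \<longleftrightarrow> (\<forall>v. ((\<lambda>t. f (x + t *\<^sub>R v)) has_real_derivative pairing v F) (at 0))"

lemma gateaux_deriv_has_gradient: "has_gradient f x F \<Longrightarrow> gateaux_deriv f x v = pairing v F"
  using DERIV_iff_gateaux_quotient[of "\<lambda>t. f (x + t *\<^sub>R v)" "pairing v F"]
  by (simp add: gateaux_deriv_def has_gradient_def tendsto_Lim)

lemma gradient_eqI: assumes "has_gradient f x F" shows "gradient f x = F"
  unfolding gradient_def
proof (rule the_equality)
  show "\<forall>v. gateaux_deriv f x v = pairing v F" using gateaux_deriv_has_gradient[OF assms] by blast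
  fix G assume "\<forall>v. gateaux_deriv f x v = pairing v G"
  then show "G = F" by (intro pairing_separates) (simp add: gateaux_deriv_has_gradient[OF assms])
qed

lemmas pairing_linear_right = linear_add[OF linear_pairing] linear_scale[OF linear_pairing] linear_neg[OF linear_pairing]
  linear_0[OF linear_pairing]

lemma has_gradient_linear: "has_gradient (\<lambda>x. pairing x F) x F"
  by (simp add: has_gradient_def has_derivative_pairing_line)

lemma has_gradient_const: "has_gradient (\<lambda>x. c) x 0"
  by (simp add: has_gradient_def pairing_linear_right)

lemma has_gradient_add:
  "has_gradient f x F \<Longrightarrow> has_gradient g x G \<Longrightarrow> has_gradient (\<lambda>x. f x + g x) x (F + G)"
  by (simp add: has_gradient_def pairing_linear_right DERIV_add)

lemma has_gradient_mult:
  assumes "has_gradient f x F" "has_gradient g x G"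
  shows "has_gradient (\<lambda>x. f x * g x) x (g x *\<^sub>R F + f x *\<^sub>R G)"
  unfolding has_gradient_def
proof
  fix v
  show "((\<lambda>t. f (x + t *\<^sub>R v) * g (x + t *\<^sub>R v)) has_real_derivative pairing v (g x *\<^sub>R F + f x *\<^sub>R G)) (at 0)"
    using DERIV_mult[OF assms[unfolded has_gradient_def, rule_format, of v]]
    by (simp add: pairing_linear_right mult.commute)
qed

section \<open>The generated algebra and its gradients\<close>

lemma function_subalgebra_A_inf: "function_subalgebra A_inf"
  unfolding A_inf_def by (rule hull_in) (auto simp: function_subalgebra_def)

lemma A_inf_linear: "(\<lambda>x. pairing x F) \<in> A_inf"
  unfolding A_inf_def by (rule hull_inc) auto

lemma A_inf_const: "(\<lambda>x. c) \<in> A_inf"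
  unfolding A_inf_def by (rule hull_inc) auto

lemma A_inf_add: "f \<in> A_inf \<Longrightarrow> g \<in> A_inf \<Longrightarrow> (\<lambda>x. f x + g x) \<in> A_inf"
  using function_subalgebra_A_inf unfolding function_subalgebra_def by blast

lemma A_inf_mult: "f \<in> A_inf \<Longrightarrow> g \<in> A_inf \<Longrightarrow> (\<lambda>x. f x * g x) \<in> A_inf"
  using function_subalgebra_A_inf unfolding function_subalgebra_def by blast

text \<open>Minimality of the hull is applied to the members of \<open>A_inf\<close> that satisfy
  \<open>P\<close>, so that membership is available in the cases of sums and products.\<close>

lemma A_inf_induct [consumes 1, case_names linear const add mult]:
  assumes "f \<in> A_inf" and lin: "\<And>F. P (\<lambda>x. pairing x F)" and const: "\<And>c. P (\<lambda>x. c)"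
    and add: "\<And>f g. f \<in> A_inf \<Longrightarrow> g \<in> A_inf \<Longrightarrow> P f \<Longrightarrow> P g \<Longrightarrow> P (\<lambda>x. f x + g x)"
    and mult: "\<And>f g. f \<in> A_inf \<Longrightarrow> g \<in> A_inf \<Longrightarrow> P f \<Longrightarrow> P g \<Longrightarrow> P (\<lambda>x. f x * g x)"
  shows "P f"
proof -
  have "A_inf \<subseteq> {f \<in> A_inf. P f}"
    unfolding A_inf_def
  proof (rule hull_minimal, fold A_inf_def)
    show "range (\<lambda>F \<Gamma>. pairing \<Gamma> F) \<union> range (\<lambda>c \<Gamma>. c) \<subseteq> {f \<in> A_inf. P f}"
      using lin const by (auto simp: A_inf_linear A_inf_const)
    show "function_subalgebra {f \<in> A_inf. P f}"
      unfolding function_subalgebra_def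
      \<comment> \<open>A scalar multiple is a product with a constant functional.\<close>
      using add mult mult[OF A_inf_const _ const]
      by (auto simp: A_inf_const const intro: A_inf_add A_inf_mult)
  qed
  then show ?thesis using assms(1) by blast
qed

text \<open>The module over \<open>A_inf\<close> generated by constant fields. It is closed under
  the Leibniz rule, and keeping each \<open>F\<close> fixed leaves all dependence on the point in
  scalar coefficients.\<close>

inductive poly_field :: "('d::finite hierarchy strong_dual \<Rightarrow> 'd hierarchy) \<Rightarrow> bool" where
  poly_field_term: "c \<in> A_inf \<Longrightarrow> poly_field (\<lambda>x. c x *\<^sub>R F)"
| poly_field_add: "poly_field \<Phi> \<Longrightarrow> poly_field \<Psi> \<Longrightarrow> poly_field (\<lambda>x. \<Phi> x + \<Psi> x)"

lemma poly_field_scale: "poly_field \<Phi> \<Longrightarrow> c \<in> A_inf \<Longrightarrow> poly_field (\<lambda>x. c x *\<^sub>R \<Phi> x)"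
proof (induction rule: poly_field.induct)
  case (poly_field_term c' F)
  then show ?case using poly_field.poly_field_term[OF A_inf_mult[of c c'], of F] by simp
next
  case (poly_field_add \<Phi> \<Psi>)
  then show ?case by (simp add: scaleR_add_right poly_field.poly_field_add)
qed

lemma A_inf_has_gradient: "f \<in> A_inf \<Longrightarrow> \<exists>\<Phi>. poly_field \<Phi> \<and> (\<forall>x. has_gradient f x (\<Phi> x))"
proof (induction rule: A_inf_induct)
  case (linear F)
  show ?case
    using poly_field_term[OF A_inf_const, of 1 F] by (intro exI[of _ "\<lambda>x. F"]) (simp add: has_gradient_linear)
next
  case (const c)
  show ?case
    using poly_field_term[OF A_inf_const, of 0 0] by (intro exI[of _ "\<lambda>x. 0"]) (simp add: has_gradient_const)
next
  case (add f g)
  then obtain \<Phi> \<Psi> where *: "poly_field \<Phi>" "poly_field \<Psi>" "\<And>x. has_gradient f x (\<Phi> x)" "\<And>x. has_gradient g x (\<Psi> x)"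
    by blast
  then show ?case using poly_field_add[OF *(1,2)] has_gradient_add[OF *(3,4)] by blast
next
  case (mult f g)
  then obtain \<Phi> \<Psi> where *: "poly_field \<Phi>" "poly_field \<Psi>" "\<And>x. has_gradient f x (\<Phi> x)" "\<And>x. has_gradient g x (\<Psi> x)"
    by blast
  have "poly_field (\<lambda>x. g x *\<^sub>R \<Phi> x + f x *\<^sub>R \<Psi> x)"
    using * mult.hyps by (intro poly_field_add poly_field_scale)
  then show ?case using has_gradient_mult[OF *(3,4)] by blast
qed

lemma has_gradient_gradient: "f \<in> A_inf \<Longrightarrow> has_gradient f x (gradient f x)"
  using A_inf_has_gradient gradient_eqI by metis

lemma poly_field_gradient: assumes "f \<in> A_inf" shows "poly_field (gradient f)"
proof -
  obtain \<Phi> where "poly_field \<Phi>" "\<And>x. has_gradient f x (\<Phi> x)" using A_inf_has_gradient[OF assms] by blast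
  moreover then have "gradient f = \<Phi>" by (intro ext gradient_eqI)
  ultimately show ?thesis by simp
qed

text \<open>Bilinearity pulls the coefficients out and leaves linear functionals given by brackets
  of fixed elements.\<close>

lemma poly_field_bracket_A_inf:
  "poly_field \<Phi> \<Longrightarrow> poly_field \<Psi> \<Longrightarrow> (\<lambda>x. pairing x (hierarchy_bracket (\<Phi> x) (\<Psi> x))) \<in> A_inf"
proof (induction rule: poly_field.induct)
  case (poly_field_term c F)
  from poly_field_term(2) show ?case
  proof (induction rule: poly_field.induct)
    case (poly_field_term c' G)
    have "(\<lambda>x. c x * (c' x * pairing x (hierarchy_bracket F G))) \<in> A_inf"
      using \<open>c \<in> A_inf\<close> \<open>c' \<in> A_inf\<close> by (intro A_inf_mult A_inf_linear)
    then show ?case by (simp add: bracket_scale_left bracket_scale_right pairing_linear_right ac_simps)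
  next
    case (poly_field_add \<Phi> \<Psi>)
    then show ?case by (simp add: bracket_add_right pairing_linear_right A_inf_add)
  qed
next
  case (poly_field_add \<Phi> \<Phi>')
  then show ?case by (simp add: bracket_add_left pairing_linear_right A_inf_add)
qed

lemma jet_A_inf: "f \<in> A_inf \<Longrightarrow> jet (\<lambda>x v. f x)"
  by (induction rule: A_inf_induct) (auto intro: jet.intros)

lemma gateaux_smooth_A_inf: "f \<in> A_inf \<Longrightarrow> gateaux_smooth f"
  by (rule gateaux_smoothI[where P = jet, OF jet_A_inf continuous_jet jet_gateaux_derivative])

text \<open>For a single term, the field is the coefficient times the transpose of G \<mapsto>
  [G, F] at x. The field \<open>\<Phi>\<close> stands second in the bracket, which is the order
  required of a Hamiltonian vector field.\<close>

lemma poly_field_vector_field: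
  "poly_field \<Phi> \<Longrightarrow> \<exists>X. vector_jet (\<lambda>x v. X x) \<and>
     (\<forall>x G. pairing (X x) G = pairing x (hierarchy_bracket G (\<Phi> x)))"
proof (induction rule: poly_field.induct)
  case (poly_field_term c F)
  let ?T = "\<lambda>G. hierarchy_bracket G F"
  note T = linear_bracket_left[of F] continuous_bracket_left[of F]
  show ?case
    using vector_jet_base[OF jet_A_inf[OF poly_field_term] linear_dual_map[OF T] continuous_dual_map[OF T]]
    by (intro exI[of _ "\<lambda>x. c x *\<^sub>R dual_map ?T x"])
      (simp add: pairing_scale pairing_dual_map[OF T] bracket_scale_right pairing_linear_right)
next
  case (poly_field_add \<Phi> \<Psi>)
  then obtain X Y where XY: "vector_jet (\<lambda>x v. X x)" "vector_jet (\<lambda>x v. Y x)"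
    "\<And>x G. pairing (X x) G = pairing x (hierarchy_bracket G (\<Phi> x))"
    "\<And>x G. pairing (Y x) G = pairing x (hierarchy_bracket G (\<Psi> x))"
    by blast
  then show ?case
    using vector_jet_add[OF XY(1,2)]
    by (intro exI[of _ "\<lambda>x. X x + Y x"]) (simp add: pairing_add bracket_add_right pairing_linear_right)
qed

lemma poisson_bracket_A_inf: "f \<in> A_inf \<Longrightarrow> g \<in> A_inf \<Longrightarrow> poisson_bracket f g \<in> A_inf"
  using poly_field_bracket_A_inf[OF poly_field_gradient poly_field_gradient]
  unfolding poisson_bracket_def[abs_def] by blast

section \<open>Derivation properties of the Poisson bracket\<close>

lemma poisson_bracket_antisym: "poisson_bracket f g x = - poisson_bracket g f x"
  unfolding poisson_bracket_def bracket_antisym[of "gradient f x"] by (simp add: pairing_linear_right)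

lemma gradient_linear: "gradient (\<lambda>x. pairing x F) = (\<lambda>x. F)"
  by (intro ext gradient_eqI has_gradient_linear)

lemma poisson_bracket_const: "poisson_bracket f (\<lambda>x. c) x = 0"
  unfolding poisson_bracket_def gradient_eqI[OF has_gradient_const]
  by (simp add: linear_0[OF linear_bracket_right] pairing_linear_right)

lemma poisson_bracket_add:
  assumes "g \<in> A_inf" "h \<in> A_inf"
  shows "poisson_bracket f (\<lambda>x. g x + h x) x = poisson_bracket f g x + poisson_bracket f h x"
  unfolding poisson_bracket_def
    gradient_eqI[OF has_gradient_add[OF has_gradient_gradient[OF assms(1)] has_gradient_gradient[OF assms(2)]]]
  by (simp add: bracket_add_right pairing_linear_right)

lemma poisson_bracket_mult:
  assumes "g \<in> A_inf" "h \<in> A_inf"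
  shows "poisson_bracket f (\<lambda>x. g x * h x) x = h x * poisson_bracket f g x + g x * poisson_bracket f h x"
  unfolding poisson_bracket_def
    gradient_eqI[OF has_gradient_mult[OF has_gradient_gradient[OF assms(1)] has_gradient_gradient[OF assms(2)]]]
  by (simp add: bracket_add_right bracket_scale_right pairing_linear_right)

lemma poisson_bracket_combination:
  assumes "f \<in> A_inf" "g \<in> A_inf"
  shows "poisson_bracket h (\<lambda>x. a * f x + b * g x) x = a * poisson_bracket h f x + b * poisson_bracket h g x"
  using assms
  by (simp add: poisson_bracket_add A_inf_mult A_inf_const poisson_bracket_mult poisson_bracket_const)

section \<open>The Jacobi identity on the generated algebra\<close>

definition jacobiator ::
  "('d::finite hierarchy strong_dual \<Rightarrow> real) \<Rightarrow> ('d hierarchy strong_dual \<Rightarrow> real) \<Rightarrow>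
   ('d hierarchy strong_dual \<Rightarrow> real) \<Rightarrow> 'd hierarchy strong_dual \<Rightarrow> real" where
  "jacobiator f g h x = poisson_bracket f (poisson_bracket g h) x
     + poisson_bracket g (poisson_bracket h f) x + poisson_bracket h (poisson_bracket f g) x"

lemma jacobiator_cyclic: "jacobiator f g h x = jacobiator g h f x"
  by (simp add: jacobiator_def)

text \<open>With h always last, this is the commutator of the derivations {f, .} and {g, .} minus
  the derivation {{f, g}, .}, applied to h.\<close>

lemma jacobiator_alt:
  assumes "f \<in> A_inf" "h \<in> A_inf"
  shows "jacobiator f g h x = poisson_bracket f (poisson_bracket g h) x
     - poisson_bracket g (poisson_bracket f h) x - poisson_bracket (poisson_bracket f g) h x"
proof -
  have "poisson_bracket h f = (\<lambda>x. (-1) * poisson_bracket f h x + 0 * f x)"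
    by (rule ext) (simp add: poisson_bracket_antisym[of h])
  then have "poisson_bracket g (poisson_bracket h f) x = - poisson_bracket g (poisson_bracket f h) x"
    using poisson_bracket_combination[OF poisson_bracket_A_inf[OF assms] assms(1), of g "-1" 0 x] by simp
  then show ?thesis by (simp add: jacobiator_def poisson_bracket_antisym[of h])
qed

text \<open>A commutator of derivations is a derivation, so the jacobiator is one in its last
  argument and is determined by its values on the generators.\<close>

lemma jacobiator_derivation:
  assumes f: "f \<in> A_inf" and g: "g \<in> A_inf" and h: "h \<in> A_inf"
    and gen: "\<And>F. jacobiator f g (\<lambda>x. pairing x F) y = 0"
  shows "jacobiator f g h y = 0"
  using h
proof (induction rule: A_inf_induct)
  case (linear F)
  show ?case by (rule gen)
next
  case (const c)
  have "poisson_bracket k (\<lambda>x. c) = (\<lambda>x. 0)" for k :: "'a hierarchy strong_dual \<Rightarrow> real"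
    by (rule ext) (rule poisson_bracket_const)
  then show ?case by (simp add: jacobiator_alt[OF f A_inf_const] poisson_bracket_const)
next
  case (add h k)
  note b = poisson_bracket_A_inf
  have *: "poisson_bracket u (\<lambda>x. h x + k x) = (\<lambda>x. poisson_bracket u h x + poisson_bracket u k x)" for u
    by (rule ext) (rule poisson_bracket_add[OF add.hyps])
  show ?case
    using add.IH unfolding jacobiator_alt[OF f A_inf_add[OF add.hyps]] jacobiator_alt[OF f add.hyps(1)]
      jacobiator_alt[OF f add.hyps(2)] *
      poisson_bracket_add[OF b[OF g add.hyps(1)] b[OF g add.hyps(2)]]
      poisson_bracket_add[OF b[OF f add.hyps(1)] b[OF f add.hyps(2)]] by simp
next
  case (mult h k)
  note A = f g mult.hyps and b = poisson_bracket_A_inf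
  have *: "poisson_bracket u (\<lambda>x. h x * k x) = (\<lambda>x. k x * poisson_bracket u h x + h x * poisson_bracket u k x)" for u
    by (rule ext) (rule poisson_bracket_mult[OF mult.hyps])
  \<comment> \<open>The products of two single brackets are symmetric in u and w, so they cancel in
    the commutator.\<close>
  have **: "poisson_bracket u (\<lambda>x. k x * poisson_bracket w h x + h x * poisson_bracket w k x) y =
      poisson_bracket w h y * poisson_bracket u k y + k y * poisson_bracket u (poisson_bracket w h) y
      + poisson_bracket w k y * poisson_bracket u h y + h y * poisson_bracket u (poisson_bracket w k) y"
    if "w \<in> A_inf" for u w
    using that mult.hyps by (simp add: poisson_bracket_add poisson_bracket_mult A_inf_mult b)
  have "jacobiator f g (\<lambda>x. h x * k x) y = k y * jacobiator f g h y + h y * jacobiator f g k y"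
    unfolding jacobiator_alt[OF f A_inf_mult[OF mult.hyps]] jacobiator_alt[OF f mult.hyps(1)]
      jacobiator_alt[OF f mult.hyps(2)] * **[OF f] **[OF g] by (simp add: algebra_simps)
  then show ?case using mult.IH by simp
qed

text \<open>Linear functionals reduce to \<open>bracket_jacobi\<close>. Cyclic symmetry then rotates
  each argument in turn into the last slot, where \<open>jacobiator_derivation\<close> extends the
  identity to \<open>A_inf\<close>.\<close>

lemma poisson_bracket_jacobi:
  assumes f: "f \<in> A_inf" and g: "g \<in> A_inf" and h: "h \<in> A_inf" shows "jacobiator f g h y = 0"
proof -
  \<comment> \<open>A linear functional has a constant gradient, so the bracket of two of them is
    again linear.\<close>
  have lin: "poisson_bracket (\<lambda>x. pairing x F) (\<lambda>x. pairing x G) = (\<lambda>x. pairing x (hierarchy_bracket F G))" for F G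
    by (simp add: poisson_bracket_def[abs_def] gradient_linear)
  have 1: "jacobiator (\<lambda>x. pairing x F) (\<lambda>x. pairing x G) (\<lambda>x. pairing x H) y = 0" for F G H
    unfolding jacobiator_def lin using bracket_jacobi[of F G H]
    by (simp add: linear_add[OF linear_pairing, symmetric] linear_0[OF linear_pairing])
  have 2: "jacobiator (\<lambda>x. pairing x F) (\<lambda>x. pairing x G) h y = 0" if "h \<in> A_inf" for F G h
    by (rule jacobiator_derivation[OF A_inf_linear A_inf_linear that 1])
  have 3: "jacobiator h (\<lambda>x. pairing x F) g y = 0" if "g \<in> A_inf" "h \<in> A_inf" for F g h
  proof (rule jacobiator_derivation[OF that(2) A_inf_linear that(1)])
    show "jacobiator h (\<lambda>x. pairing x F) (\<lambda>x. pairing x G) y = 0" for G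
      using 2[OF that(2), of F G] jacobiator_cyclic[of h] by metis
  qed
  show ?thesis
  proof (rule jacobiator_derivation[OF f g h])
    show "jacobiator f g (\<lambda>x. pairing x F) y = 0" for F
      using 3[OF f g, of F] jacobiator_cyclic[of g] jacobiator_cyclic[of _ f] by metis
  qed
qed

theorem theorem2p11:
  shows "weak_poisson_vector_space
    (A_inf :: ('d::finite hierarchy strong_dual \<Rightarrow> real) set) poisson_bracket"
  unfolding weak_poisson_vector_space_def
proof (intro conjI ballI allI impI)
  show "(A_inf :: ('d hierarchy strong_dual \<Rightarrow> real) set) \<subseteq> {f. gateaux_smooth f}"
    using gateaux_smooth_A_inf by blast
  fix f g h :: "'d hierarchy strong_dual \<Rightarrow> real"
  assume f: "f \<in> A_inf"
  obtain X where X: "vector_jet (\<lambda>x v. X x)"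
    "\<And>x G. pairing (X x) G = pairing x (hierarchy_bracket G (gradient f x))"
    using poly_field_vector_field[OF poly_field_gradient[OF f]] by blast
  have "gateaux_smooth X"
    by (rule gateaux_smoothI[where P = vector_jet, OF X(1) continuous_vector_jet vector_jet_derivative])
  moreover have "gateaux_deriv k x (X x) = poisson_bracket k f x" if "k \<in> A_inf" for k x
    using gateaux_deriv_has_gradient[OF has_gradient_gradient[OF that]] by (simp add: X(2) poisson_bracket_def)
  ultimately show "\<exists>X. gateaux_smooth X \<and> (\<forall>g\<in>A_inf. \<forall>x. gateaux_deriv g x (X x) = poisson_bracket g f x)"
    by blast
  assume g: "g \<in> A_inf"
  show "poisson_bracket f g \<in> A_inf" by (rule poisson_bracket_A_inf[OF f g])
  show "poisson_bracket f g = (\<lambda>x. - poisson_bracket g f x)"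
    by (rule ext) (rule poisson_bracket_antisym)
  assume h: "h \<in> A_inf"
  show "poisson_bracket h (\<lambda>x. a * f x + b * g x) = (\<lambda>x. a * poisson_bracket h f x + b * poisson_bracket h g x)" for a b
    by (rule ext) (rule poisson_bracket_combination[OF f g])
  then show "poisson_bracket (\<lambda>x. a * f x + b * g x) h = (\<lambda>x. a * poisson_bracket f h x + b * poisson_bracket g h x)" for a b
    by (simp add: poisson_bracket_antisym[of _ h] fun_eq_iff)
  show "poisson_bracket f (poisson_bracket g h) x + poisson_bracket g (poisson_bracket h f) x
      + poisson_bracket h (poisson_bracket f g) x = 0" for x
    using poisson_bracket_jacobi[OF f g h] by (simp add: jacobiator_def)
  show "poisson_bracket f (\<lambda>x. g x * h x) = (\<lambda>x. h x * poisson_bracket f g x + g x * poisson_bracket f h x)"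
    by (rule ext) (rule poisson_bracket_mult[OF g h])
next
  fix x v :: "'d hierarchy strong_dual"
  assume v: "\<forall>f\<in>A_inf. gateaux_deriv f x v = 0"
  \<comment> \<open>Linear functionals already separate directions: the derivative along v is the
    value of v at \<open>F\<close>.\<close>
  have "pairing v F = 0" for F
    using v A_inf_linear[of F] gateaux_deriv_has_gradient[OF has_gradient_linear, of F x v] by simp
  then show "v = 0" by (intro strong_dual_eqI) (simp add: pairing_simps)
qed (simp_all add: function_subalgebra_A_inf A_inf_const)

end
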